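(* Let $N\ge 1$ and $\eta\ge 1$ be integers, let $\lambda\in\mathbf R$ (or, possibly, $\lambda\in\mathbf C$), and let $q$ be an integer with $q>\frac N2$ and $q\ge\eta$. Suppose that $\mathcal F_\eta(\psi)=\lambda|\psi|^{2\eta}\psi$ satisfies the following two hypotheses. (H1) There is a constant $C^{\mathrm L}=C(\lambda,\eta)$ such that for all $f,g\in\mathbf R$, $|\mathcal F_\eta(f)-\mathcal F_\eta(g)|\le C^{\mathrm L}|f-g|\,(|f|^{2\eta}+|g|^{2\eta})$. (H2) There exists an integer $\sigma$ such that the $\sigma$-th derivative $\mathcal F_\eta^{(\sigma)}$ satisfies, for all $f,g\in\mathbf R$, $|\mathcal F_\eta^{(\sigma)}(f)-\mathcal F_\eta^{(\sigma)}(g)|\le C^{\mathrm L}|f-g|\,(|f|^{2\eta-\sigma}+|g|^{2\eta-\sigma})$. Then for every $\psi_0\in H^q(\mathbf R^N)$ there exist a maximal time $T_\star>0$ (possibly $T_\star=\infty$) and a unique solution $\psi\in L^\infty((0,T_\star);H^q(\mathbf R^N))$ of $$\Big(\mathrm i\frac{\partial}{\partial t}+\Delta\Big)\psi=\lambda|\psi|^{2\eta}\psi\quad (x\in\mathbf R^N,\ t>0),\qquad \psi(\cdot,0)=\psi_0,$$ which satisfies the integral equation $$\psi(t)=e^{\mathrm i t\Delta}\psi_0-\mathrm i\lambda\int_0^t e^{\mathrm i(t-\nu)\Delta}\big\{|\psi(\nu)|^{2\eta}\psi(\nu)\big\}\,d\nu,$$ and, in addition: (I) if $T_\star<\infty$,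 then $\lim_{t\uparrow T_\star^-}\|\psi(\cdot,t)\|_{H^q(\mathbf R^N)}=\infty$; if $T_\star=\infty$, the solution exists globally; (II) if $\psi_{0j}\to\psi_0$ in $H^q(\mathbf R^N)$ and $\psi_j$ is the maximal solution corresponding to the initial data $\psi_{0j}$, then $\psi_j\to\psi$ in $L^\infty((0,T);H^q(\mathbf R^N))$ for every interval $[0,T]\subset[0,T_\star)$.
   Context: Mild solution on $[0,T]$: a function $\psi\in C([0,T];H^q(\mathbf R^N))$ satisfying the displayed Duhamel integral equation for $t\in[0,T]$. $H^q(\mathbf R^N)$ is the $L^2$-based Sobolev space of order $q$. Maximal time of existence $T_\star$: $T_\star=\infty$ if the (unique) mild solution exists for all $t\in[0,\infty)$; if there is a finite $T>0$ such that the mild solution exists for $t\in[0,T)$ but does not exist at $t=T$, then $T_\star=T$. The corresponding solution is called the maximal solution.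
   Formalization: The solution is asserted to lie in L^∞((0,T);H^q) for every finite T<T⋆ rather than in L^∞((0,T⋆);H^q), since for finite T⋆ the latter contradicts the blow-up in (I). *)

theory Defs
  imports "HOL-Analysis.Analysis" "HOL-Probability.Essential_Supremum"
begin

text \<open>
  Elements of $L^2(\mathbf R^N)$ and $H^q(\mathbf R^N)$ are represented by Borel functions
  \<open>real ^ 'n \<Rightarrow> complex\<close> with $N =$ \<open>CARD('n)\<close>. There is no quotient: equality in these spaces
  is equality almost everywhere. (Every Lebesgue class has a Borel representative.)
\<close>

definition square_integrable :: "(real ^ 'n \<Rightarrow> complex) \<Rightarrow> bool" where
  "square_integrable u \<longleftrightarrow>
     u \<in> borel_measurable lborel \<and> integrable lborel (\<lambda>x. (cmod (u x))\<^sup>2)"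

text \<open>
  The unitary Fourier transform on $L^2$: the $L^2$-limit, as $R \to \infty$, of
  $(2\pi)^{-N/2} \int_{|x| \le R} e^{-i x \cdot \xi} u(x)\,dx$. By Plancherel's theorem the limit
  exists for every square-integrable \<open>u\<close>; it is unique up to null sets, and \<open>SOME\<close> picks
  a representative. The distance is a nonnegative extended integral, so that a difference outside
  $L^2$ does not count as small.
\<close>

definition fourier_trunc :: "real \<Rightarrow> (real ^ 'n \<Rightarrow> complex) \<Rightarrow> real ^ 'n \<Rightarrow> complex" where
  "fourier_trunc R u \<xi> =
     (2 * pi) powr (- real CARD('n) / 2) *\<^sub>R (LINT x:cball 0 R|lborel. cis (- (x \<bullet> \<xi>)) * u x)"

definition fourier :: "(real ^ 'n \<Rightarrow> complex) \<Rightarrow> real ^ 'n \<Rightarrow> complex" where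
  "fourier u = (SOME v. square_integrable v \<and>
     ((\<lambda>R. \<integral>\<^sup>+\<xi>. ennreal ((cmod (v \<xi> - fourier_trunc R u \<xi>))\<^sup>2) \<partial>lborel) \<longlongrightarrow> 0) at_top)"

definition inverse_fourier :: "(real ^ 'n \<Rightarrow> complex) \<Rightarrow> real ^ 'n \<Rightarrow> complex" where
  "inverse_fourier v x = fourier v (- x)"

text \<open>
  \<open>bessel_energy s g\<close> is the square of the $H^s$-norm of the distribution with Fourier
  transform \<open>g\<close>; the order \<open>s\<close> may be negative.
\<close>

definition bessel_energy :: "int \<Rightarrow> (real ^ 'n \<Rightarrow> complex) \<Rightarrow> ennreal" where
  "bessel_energy s g =
     (\<integral>\<^sup>+\<xi>. ennreal ((1 + (norm \<xi>)\<^sup>2) powi s * (cmod (g \<xi>))\<^sup>2) \<partial>lborel)"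

definition sobolev :: "nat \<Rightarrow> (real ^ 'n \<Rightarrow> complex) set" where
  "sobolev q = {u. square_integrable u \<and> bessel_energy (int q) (fourier u) < \<infinity>}"

text \<open>The following norm is meaningful only for members of \<open>sobolev q\<close>.\<close>

definition sobolev_norm :: "nat \<Rightarrow> (real ^ 'n \<Rightarrow> complex) \<Rightarrow> real" where
  "sobolev_norm q u = sqrt (enn2real (bessel_energy (int q) (fourier u)))"

text \<open>The free Schroedinger group $e^{it\Delta}$, i.e. the Fourier multiplier $e^{-it|\xi|^2}$.\<close>

definition schroedinger_group ::
    "real \<Rightarrow> (real ^ 'n \<Rightarrow> complex) \<Rightarrow> real ^ 'n \<Rightarrow> complex" where
  "schroedinger_group t u = inverse_fourier (\<lambda>\<xi>. cis (- (t * (norm \<xi>)\<^sup>2)) * fourier u \<xi>)"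

text \<open>The nonlinearity $\mathcal F_\eta(z) = \lambda |z|^{2\eta} z$.\<close>

definition nls_nonlin :: "complex \<Rightarrow> nat \<Rightarrow> complex \<Rightarrow> complex" where
  "nls_nonlin lam \<eta> z = lam * complex_of_real (cmod z ^ (2 * \<eta>)) * z"

definition nth_vector_derivative :: "nat \<Rightarrow> (real \<Rightarrow> complex) \<Rightarrow> real \<Rightarrow> complex" where
  "nth_vector_derivative n = ((\<lambda>g x. vector_derivative g (at x)) ^^ n)"

definition sobolev_continuous_on ::
    "nat \<Rightarrow> real set \<Rightarrow> (real \<Rightarrow> real ^ 'n \<Rightarrow> complex) \<Rightarrow> bool" where
  "sobolev_continuous_on q S \<psi> \<longleftrightarrow>
     (\<forall>t\<in>S. \<psi> t \<in> sobolev q) \<and>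
     (\<forall>t\<in>S. ((\<lambda>s. sobolev_norm q (\<lambda>x. \<psi> s x - \<psi> t x)) \<longlongrightarrow> 0) (at t within S))"

text \<open>
  The $H^q$-valued integral of \<open>g\<close> over \<open>{a..b}\<close>. This is \<open>has_integral\<close> (on a compact interval)
  with the norm of the target space replaced by the $H^q$-norm; the library constant does not apply
  because $H^q$ is not a type here. For (strongly measurable and bounded, in particular for
  continuous) integrands it is the Bochner integral.
\<close>

definition has_sobolev_integral ::
    "nat \<Rightarrow> (real \<Rightarrow> real ^ 'n \<Rightarrow> complex) \<Rightarrow> (real ^ 'n \<Rightarrow> complex) \<Rightarrow> real \<Rightarrow> real \<Rightarrow> bool" where
  "has_sobolev_integral q g v a b \<longleftrightarrow>
     v \<in> sobolev q \<and> (\<forall>s\<in>{a..b}. g s \<in> sobolev q) \<and>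
     (\<forall>e>0. \<exists>\<gamma>. gauge \<gamma> \<and>
        (\<forall>\<D>. \<D> tagged_division_of {a..b} \<and> \<gamma> fine \<D> \<longrightarrow>
           sobolev_norm q (\<lambda>x. (\<Sum>(s, K)\<in>\<D>. measure lborel K *\<^sub>R g s x) - v x) < e))"

definition duhamel_at ::
    "nat \<Rightarrow> nat \<Rightarrow> complex \<Rightarrow> (real ^ 'n \<Rightarrow> complex) \<Rightarrow> (real \<Rightarrow> real ^ 'n \<Rightarrow> complex)
      \<Rightarrow> real \<Rightarrow> bool" where
  "duhamel_at q \<eta> lam \<psi>0 \<psi> t \<longleftrightarrow>
     (\<exists>I. has_sobolev_integral q
            (\<lambda>\<nu>. schroedinger_group (t - \<nu>)
                   (\<lambda>x. complex_of_real (cmod (\<psi> \<nu> x) ^ (2 * \<eta>)) * \<psi> \<nu> x)) I 0 t \<and>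
          (AE x in lborel. \<psi> t x = schroedinger_group t \<psi>0 x - \<i> * lam * I x))"

definition mild_solution ::
    "nat \<Rightarrow> nat \<Rightarrow> complex \<Rightarrow> (real ^ 'n \<Rightarrow> complex) \<Rightarrow> real
      \<Rightarrow> (real \<Rightarrow> real ^ 'n \<Rightarrow> complex) \<Rightarrow> bool" where
  "mild_solution q \<eta> lam \<psi>0 T \<psi> \<longleftrightarrow>
     sobolev_continuous_on q {0..T} \<psi> \<and> (\<forall>t\<in>{0..T}. duhamel_at q \<eta> lam \<psi>0 \<psi> t)"

text \<open>
  $T_\star$ is either \<open>\<infinity>\<close>, or finite and such that no mild solution exists on the closed interval
  $[0,T_\star]$ although \<open>\<psi>\<close> is one on every $[0,T]$ with $T < T_\star$. The values of \<open>\<psi>\<close> outside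
  $[0,T_\star)$ are irrelevant.
\<close>

definition maximal_solution ::
    "nat \<Rightarrow> nat \<Rightarrow> complex \<Rightarrow> (real ^ 'n \<Rightarrow> complex) \<Rightarrow> ereal
      \<Rightarrow> (real \<Rightarrow> real ^ 'n \<Rightarrow> complex) \<Rightarrow> bool" where
  "maximal_solution q \<eta> lam \<psi>0 Tstar \<psi> \<longleftrightarrow>
     0 < Tstar \<and>
     (\<forall>T\<ge>0. ereal T < Tstar \<longrightarrow> mild_solution q \<eta> lam \<psi>0 T \<psi>) \<and>
     (\<forall>T. Tstar = ereal T \<longrightarrow> \<not> (\<exists>\<phi>. mild_solution q \<eta> lam \<psi>0 T \<phi>))"

text \<open>The norm of $L^\infty((0,T);H^q)$.\<close>

definition Linf_sobolev_norm ::
    "nat \<Rightarrow> real \<Rightarrow> (real \<Rightarrow> real ^ 'n \<Rightarrow> complex) \<Rightarrow> ereal" where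
  "Linf_sobolev_norm q T \<psi> =
     esssup (lebesgue_on {0<..<T}) (\<lambda>t. ereal (sobolev_norm q (\<psi> t)))"

text \<open>
  Membership in $L^\infty((0,T);H^q)$: strongly measurable (an almost everywhere limit of
  $H^q$-valued simple functions) and essentially bounded.
\<close>

definition Linf_sobolev ::
    "nat \<Rightarrow> real \<Rightarrow> (real \<Rightarrow> real ^ 'n \<Rightarrow> complex) set" where
  "Linf_sobolev q T =
     {\<psi>. (\<forall>t\<in>{0<..<T}. \<psi> t \<in> sobolev q) \<and>
         (\<exists>\<sigma>. (\<forall>n. simple_function (lebesgue_on {0<..<T}) (\<sigma> n) \<and>
                   (\<forall>t\<in>{0<..<T}. \<sigma> n t \<in> sobolev q)) \<and>
              (AE t in lebesgue_on {0<..<T}.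
                 (\<lambda>n. sobolev_norm q (\<lambda>x. \<sigma> n t x - \<psi> t x)) \<longlonglongrightarrow> 0)) \<and>
         Linf_sobolev_norm q T \<psi> < \<infinity>}"

text \<open>
  $L^\infty$-solutions of the integral equation, with no continuity in time required. An element
  of $L^\infty((0,T);H^q)$ that satisfies the equation for almost every \<open>t\<close> has a representative
  satisfying it for every $t \in [0,T]$; this representative is the one meant here.
\<close>

definition Linf_solution ::
    "nat \<Rightarrow> nat \<Rightarrow> complex \<Rightarrow> (real ^ 'n \<Rightarrow> complex) \<Rightarrow> real
      \<Rightarrow> (real \<Rightarrow> real ^ 'n \<Rightarrow> complex) \<Rightarrow> bool" where
  "Linf_solution q \<eta> lam \<psi>0 T \<psi> \<longleftrightarrow>
     \<psi> \<in> Linf_sobolev q T \<and> (\<forall>t\<in>{0..T}. \<psi> t \<in> sobolev q \<and> duhamel_at q \<eta> lam \<psi>0 \<psi> t)"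

text \<open>
  The equation $i \partial_t\psi + \Delta\psi = \mathcal F_\eta(\psi)$ at time \<open>t\<close>, in $H^{q-2}$:
  the difference quotients of \<open>\<psi>\<close> converge in $H^{q-2}$, and the equation holds there.
  It is written on the Fourier side, where $\Delta$ is multiplication by $-|\xi|^2$, because for
  $q = 1$ the terms are distributions rather than functions.
\<close>

definition nls_equation_at ::
    "nat \<Rightarrow> nat \<Rightarrow> complex \<Rightarrow> (real \<Rightarrow> real ^ 'n \<Rightarrow> complex) \<Rightarrow> real \<Rightarrow> bool" where
  "nls_equation_at q \<eta> lam \<psi> t \<longleftrightarrow>
     ((\<lambda>h. bessel_energy (int q - 2)
            (\<lambda>\<xi>. \<i> * ((fourier (\<psi> (t + h)) \<xi> - fourier (\<psi> t) \<xi>) / complex_of_real h)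
                 - complex_of_real ((norm \<xi>)\<^sup>2) * fourier (\<psi> t) \<xi>
                 - fourier (\<lambda>x. nls_nonlin lam \<eta> (\<psi> t x)) \<xi>)) \<longlongrightarrow> 0) (at 0)"

end

theory Submission
  imports Defs "HOL-Probability.Characteristic_Functions"
begin

text \<open>
  Weighting the Fourier transform with $(1 + |\xi|^2)^{q/2}$ identifies $H^q$ with $L^2$, turns the
  free group into multiplication by $e^{-it|\xi|^2}$, and turns products into convolutions. Since
  $q > N/2$, transforms of $H^q$ functions are integrable by Cauchy--Schwarz, so Young's inequality
  makes $H^q$ an algebra; as $|\psi|^{2\eta}\psi = (\psi\bar\psi)^\eta\psi$, the nonlinearity is
  locally Lipschitz. In the interaction picture $z(t) = e^{-it\Delta}\psi(t)$ the Duhamel formula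
  becomes $z(t) = z(0) + \int_0^t f(s, z(s))\,ds$ with $f$ locally Lipschitz uniformly in time, an
  ordinary differential equation in a Banach space, for which maximal solutions, the blow-up
  alternative and continuous dependence follow from Picard iteration and a Gronwall estimate.
\<close>

section \<open>Locally Lipschitz equations in Banach spaces\<close>

text \<open>The Banach-space theory needs a type, while \<open>sobolev q\<close> is a set of
  functions that depends on \<open>q\<close>. One type \<open>l2\<close> of classes serves every
  order: \<open>bessel_l2 q\<close> gives the coordinate of an H^q function and
  \<open>sobolev_rep q\<close> goes back. The way back is what forces a full inversion theory: a
  solution found in \<open>l2\<close> is useless until each of its values is the weighted transform
  of an actual function, and the product estimate has to recognize u v as the inverse transform of a
  convolution.

  The Duhamel integrand depends on the final time through e^{i(t-s)Delta}, so the formula is not yet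
  the integral equation of a differential equation; undoing the flow removes that dependence. The
  flow is isometric, so norms and distances are the same in both pictures, and blow-up and
  convergence need no translation. It is however only strongly continuous, with an unbounded
  generator. Hence the abstract theory asks for continuity along curves only, and the differential
  equation is verified after multiplication by (1 + |xi|^2)^{-1}.\<close>

lemma gronwall_exp:
  fixes e :: "real \<Rightarrow> real"
  assumes cont: "continuous_on {a..b} e" and L: "L > 0" and eps: "\<epsilon> \<ge> 0"
    and le: "\<And>t. t \<in> {a..b} \<Longrightarrow> e t \<le> \<epsilon> + L * integral {a..t} e"
    and t: "t \<in> {a..b}"
  shows "e t \<le> 2 * \<epsilon> * exp (2 * L * (t - a))"
proof -
  \<comment> \<open>The weight decays at twice the rate \<open>L\<close>, which halves the integral
    term: at the maximum \<open>t1\<close> of the weighted function the hypothesis reads M E <=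
    \<epsilon> + (M/2)(E - 1), and M can be absorbed. Both factors 2 of the bound come from here.
    The sign of \<open>e\<close> does not enter.\<close>
  define g where "g s = e s * exp (- (2 * L * (s - a)))" for s
  have "continuous_on {a..b} g"
    unfolding g_def by (intro continuous_intros cont)
  then obtain t1 where t1: "t1 \<in> {a..b}" and max: "\<And>s. s \<in> {a..b} \<Longrightarrow> g s \<le> g t1"
    using continuous_attains_sup[of "{a..b}" g] t by fastforce
  define M where "M = g t1"
  define E where "E = exp (2 * L * (t1 - a))"
  have E: "E \<ge> 1" using t1 L by (simp add: E_def)
  have bd: "e s \<le> M * exp (2 * L * (s - a))" if "s \<in> {a..b}" for s
  proof -
    have "e s = g s * exp (2 * L * (s - a))" by (simp add: g_def mult.assoc flip: exp_add)
    also have "\<dots> \<le> M * exp (2 * L * (s - a))"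
      unfolding M_def by (intro mult_right_mono max that) simp
    finally show ?thesis .
  qed
  have I: "((\<lambda>s. M * exp (2 * L * (s - a))) has_integral
      (M / (2 * L) * exp (2 * L * (t1 - a)) - M / (2 * L) * exp (2 * L * (a - a)))) {a..t1}"
    using t1 L
    by (intro fundamental_theorem_of_calculus)
       (auto intro!: derivative_eq_intros simp: has_real_derivative_iff_has_vector_derivative[symmetric])
  have "e t1 \<le> \<epsilon> + L * integral {a..t1} e" by (rule le[OF t1])
  also have "integral {a..t1} e \<le> M / (2 * L) * exp (2 * L * (t1 - a)) - M / (2 * L) * exp (2 * L * (a - a))"
  proof (rule has_integral_le[OF integrable_integral I])
    show "e integrable_on {a..t1}"
      using t1 by (intro integrable_continuous_interval continuous_on_subset[OF cont]) auto
  qed (use t1 bd in auto)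
  also have "L * (M / (2 * L) * exp (2 * L * (t1 - a)) - M / (2 * L) * exp (2 * L * (a - a))) = M / 2 * (E - 1)"
    using L by (simp add: E_def right_diff_distrib)
  finally have "e t1 \<le> \<epsilon> + M / 2 * (E - 1)" using L by simp
  moreover have "e t1 = M * E" by (simp add: M_def g_def E_def exp_minus)
  ultimately have *: "M * E + M \<le> 2 * \<epsilon>" by (simp add: field_simps)
  have "M \<le> 2 * \<epsilon>"
  proof (cases "M \<ge> 0")
    case True
    then have "M * E \<ge> 0" using E by simp
    with * show ?thesis by linarith
  qed (use eps in simp)
  have "e t \<le> M * exp (2 * L * (t - a))" by (rule bd[OF t])
  also have "\<dots> \<le> 2 * \<epsilon> * exp (2 * L * (t - a))"
    by (intro mult_right_mono) (use \<open>M \<le> 2 * \<epsilon>\<close> in auto)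
  finally show ?thesis .
qed

text \<open>\<open>L\<close> depends on the radius but not on the time, so existence times will
  depend only on the size of the data. Continuity is required along continuous curves, the form in
  which a strongly continuous flow supplies it. Together with \<open>zero\<close>, the Lipschitz
  bound also bounds \<open>f\<close> itself on balls.\<close>

locale lipschitz_ode =
  fixes f :: "real \<Rightarrow> 'a::banach \<Rightarrow> 'a"
  assumes cont_comp: "\<And>S z. continuous_on S z \<Longrightarrow> continuous_on S (\<lambda>t. f t (z t))"
    and lip: "\<And>R. \<exists>L. \<forall>t (x :: 'a) y. norm x \<le> R \<longrightarrow> norm y \<le> R \<longrightarrow> norm (f t x - f t y) \<le> L * norm (x - y)"
    and zero: "\<And>t. f t 0 = 0"
begin

text \<open>The case \<open>t = a\<close> of the integral identity carries the initial condition
  \<open>z a = x\<close>. No derivative is involved, so intervals can be cut and glued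
  freely.\<close>

definition sol :: "real \<Rightarrow> real \<Rightarrow> 'a \<Rightarrow> (real \<Rightarrow> 'a) \<Rightarrow> bool" where
  "sol a b x z \<longleftrightarrow> continuous_on {a..b} z \<and>
     (\<forall>t\<in>{a..b}. ((\<lambda>s. f s (z s)) has_integral (z t - x)) {a..t})"

lemma lip_pos:
  obtains L where "L > 0"
    "\<And>t (x :: 'a) y. norm x \<le> R \<Longrightarrow> norm y \<le> R \<Longrightarrow> norm (f t x - f t y) \<le> L * norm (x - y)"
proof -
  obtain L where L: "\<And>t x y. norm x \<le> R \<Longrightarrow> norm y \<le> R \<Longrightarrow> norm (f t x - f t y) \<le> L * norm (x - y)"
    using lip by blast
  show ?thesis
  proof (rule that[of "max L 1"])
    fix t and x y :: 'a assume "norm x \<le> R" "norm y \<le> R"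
    then have "norm (f t x - f t y) \<le> L * norm (x - y)" by (rule L)
    also have "\<dots> \<le> max L 1 * norm (x - y)" by (intro mult_right_mono) auto
    finally show "norm (f t x - f t y) \<le> max L 1 * norm (x - y)" .
  qed simp
qed

lemma sol_cong:
  assumes "sol a b x z" "\<And>t. t \<in> {a..b} \<Longrightarrow> w t = z t"
  shows "sol a b x w"
  unfolding sol_def
proof (intro conjI ballI)
  show "continuous_on {a..b} w"
    using assms continuous_on_cong[of "{a..b}" "{a..b}" w z] by (simp add: sol_def)
  fix t assume t: "t \<in> {a..b}"
  then have "((\<lambda>s. f s (z s)) has_integral (z t - x)) {a..t}" using assms by (simp add: sol_def)
  then show "((\<lambda>s. f s (w s)) has_integral (w t - x)) {a..t}"
    using t by (subst has_integral_cong[where g = "\<lambda>s. f s (z s)"]) (auto simp: assms(2))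
qed

lemma sol_mono: "sol a b x z \<Longrightarrow> b' \<le> b \<Longrightarrow> sol a b' x z"
  unfolding sol_def by (auto intro: continuous_on_subset)

lemma sol_integral:
  "sol a b x z \<Longrightarrow> t \<in> {a..b} \<Longrightarrow> ((\<lambda>s. f s (z s)) has_integral (z t - x)) {a..t}"
  by (simp add: sol_def)

lemma sol_start: "sol a b x z \<Longrightarrow> a \<le> b \<Longrightarrow> z a = x"
proof -
  assume "sol a b x z" "a \<le> b"
  then have "((\<lambda>s. f s (z s)) has_integral (z a - x)) {a..a}"
    unfolding sol_def by (meson atLeastAtMost_iff order_refl)
  moreover have "((\<lambda>s. f s (z s)) has_integral 0) {a..a}" by (simp add: has_integral_refl)
  ultimately have "z a - x = 0" by (rule has_integral_unique)
  then show ?thesis by simp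
qed

lemma sol_bounded:
  assumes "sol a b x z"
  obtains R where "R > 0" "\<And>t. t \<in> {a..b} \<Longrightarrow> norm (z t) \<le> R"
proof -
  have "bounded (z ` {a..b})"
    using assms by (intro compact_imp_bounded compact_continuous_image) (auto simp: sol_def)
  then show ?thesis using that unfolding bounded_pos by auto
qed

text \<open>Gronwall's estimate for the distance of two solutions. A common ball is needed because
  only there a common \<open>L\<close> is available.\<close>

lemma sol_compare:
  assumes z: "sol a b x z" and w: "sol a b y w"
    and Rz: "\<And>t. t \<in> {a..b} \<Longrightarrow> norm (z t) \<le> R" and Rw: "\<And>t. t \<in> {a..b} \<Longrightarrow> norm (w t) \<le> R"
    and L: "L > 0" "\<And>t x y. norm x \<le> R \<Longrightarrow> norm y \<le> R \<Longrightarrow> norm (f t x - f t y) \<le> L * norm (x - y)"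
    and t: "t \<in> {a..b}"
  shows "norm (z t - w t) \<le> 2 * norm (x - y) * exp (2 * L * (t - a))"
proof (rule gronwall_exp[where b = b and e = "\<lambda>t. norm (z t - w t)"])
  show "continuous_on {a..b} (\<lambda>t. norm (z t - w t))"
    using z w by (intro continuous_intros) (auto simp: sol_def)
  fix t assume t: "t \<in> {a..b}"
  have cz: "continuous_on {a..t} z" and cw: "continuous_on {a..t} w"
    using z w t by (auto simp: sol_def intro: continuous_on_subset)
  have iz: "((\<lambda>s. f s (z s)) has_integral (z t - x)) {a..t}"
    and iw: "((\<lambda>s. f s (w s)) has_integral (w t - y)) {a..t}"
    using z w t by (auto simp: sol_def)
  have i: "((\<lambda>s. f s (z s) - f s (w s)) has_integral ((z t - x) - (w t - y))) {a..t}"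
    by (rule has_integral_diff[OF iz iw])
  have "norm ((z t - x) - (w t - y)) = norm (integral {a..t} (\<lambda>s. f s (z s) - f s (w s)))"
    using i by (simp add: integral_unique)
  also have "\<dots> \<le> integral {a..t} (\<lambda>s. L * norm (z s - w s))"
  proof (rule integral_norm_bound_integral)
    show "(\<lambda>s. f s (z s) - f s (w s)) integrable_on {a..t}" using i by blast
    show "(\<lambda>s. L * norm (z s - w s)) integrable_on {a..t}"
      by (intro integrable_continuous_interval continuous_intros cz cw)
    show "norm (f s (z s) - f s (w s)) \<le> L * norm (z s - w s)" if "s \<in> {a..t}" for s
      using that t by (intro L(2) Rz Rw) auto
  qed
  also have "\<dots> = L * integral {a..t} (\<lambda>s. norm (z s - w s))" by simp
  finally have "norm ((z t - x) - (w t - y)) \<le> L * integral {a..t} (\<lambda>s. norm (z s - w s))" .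
  moreover have "norm (z t - w t) \<le> norm (x - y) + norm ((z t - x) - (w t - y))"
    using norm_triangle_ineq[of "x - y" "(z t - x) - (w t - y)"] by simp
  ultimately show "norm (z t - w t) \<le> norm (x - y) + L * integral {a..t} (\<lambda>s. norm (z s - w s))"
    by linarith
qed (use L t in auto)

lemma sol_unique:
  assumes z: "sol a b x z" and w: "sol a b x w" and t: "t \<in> {a..b}"
  shows "z t = w t"
proof -
  obtain R1 where R1: "\<And>t. t \<in> {a..b} \<Longrightarrow> norm (z t) \<le> R1" using sol_bounded[OF z] by blast
  obtain R2 where R2: "\<And>t. t \<in> {a..b} \<Longrightarrow> norm (w t) \<le> R2" using sol_bounded[OF w] by blast
  obtain L where L: "L > 0" "\<And>t x y. norm x \<le> max R1 R2 \<Longrightarrow> norm y \<le> max R1 R2 \<Longrightarrow>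
      norm (f t x - f t y) \<le> L * norm (x - y)"
    using lip_pos[of "max R1 R2"] by blast
  have "norm (z t - w t) \<le> 2 * norm (x - x) * exp (2 * L * (t - a))"
    by (rule sol_compare[OF z w _ _ L t]) (auto simp: max.coboundedI1 max.coboundedI2 R1 R2)
  then show ?thesis by simp
qed

lemma sol_glue:
  assumes z: "sol a b x z" and w: "sol b c (z b) w" and ab: "a \<le> b" and bc: "b \<le> c"
  shows "sol a c x (\<lambda>t. if t \<le> b then z t else w t)"
proof -
  let ?v = "\<lambda>t. if t \<le> b then z t else w t"
  have wb: "w b = z b" by (rule sol_start[OF w bc])
  have "continuous_on ({a..b} \<union> {b..c}) ?v"
    using z w wb by (intro continuous_on_If) (auto simp: sol_def)
  moreover have "{a..b} \<union> {b..c} = {a..c}" using ab bc by auto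
  ultimately have c: "continuous_on {a..c} ?v" by simp
  have z': "sol a b x ?v" by (rule sol_cong[OF z]) auto
  have w': "sol b c (z b) ?v" by (rule sol_cong[OF w]) (auto simp: wb)
  have "((\<lambda>s. f s (?v s)) has_integral (?v t - x)) {a..t}" if t: "t \<in> {a..c}" for t
  proof (cases "t \<le> b")
    case True
    then show ?thesis using z' t by (auto simp: sol_def)
  next
    case False
    have 1: "((\<lambda>s. f s (?v s)) has_integral (z b - x)) {a..b}"
      using sol_integral[OF z', of b] ab by simp
    have 2: "((\<lambda>s. f s (?v s)) has_integral (?v t - z b)) {b..t}"
      using sol_integral[OF w', of t] t False by simp
    have "((\<lambda>s. f s (?v s)) has_integral (z b - x) + (?v t - z b)) {a..t}"
      by (rule has_integral_combine[OF _ _ 1 2]) (use ab False in auto)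
    then show ?thesis by simp
  qed
  then show ?thesis using c by (simp add: sol_def)
qed

text \<open>Picard iteration as a contraction. The order of the quantifiers is the point: \<delta>
  is chosen from the bound \<open>r\<close> before the starting time and the datum, which later
  allows restarts arbitrarily close to a supposed end of life.\<close>

lemma local_existence:
  obtains \<delta> where "\<delta> > 0" "\<And>a x. norm x \<le> r \<Longrightarrow> \<exists>z. sol a (a + \<delta>) x z"
proof -
  define R where "R = max r 1"
  have R: "R > 0" by (simp add: R_def)
  obtain L where L: "L > 0" "\<And>t x y. norm x \<le> 2 * R \<Longrightarrow> norm y \<le> 2 * R \<Longrightarrow>
      norm (f t x - f t y) \<le> L * norm (x - y)"
    using lip_pos[of "2 * R"] by blast
  \<comment> \<open>This value does two jobs. On curves bounded by \<open>2 * R\<close> the integral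
    has norm at most \<open>L * (2 * R) * \<delta> = R\<close>, which together with
    \<open>norm x \<le> R\<close> keeps the ball invariant; and the contraction factor is
    \<open>L * \<delta> = 1/2\<close>.\<close>
  define \<delta> where "\<delta> = 1 / (2 * L)"
  have \<delta>: "\<delta> > 0" using L by (simp add: \<delta>_def)
  show ?thesis
  proof (rule that[OF \<delta>])
    fix a and x :: 'a assume "norm x \<le> r"
    then have x: "norm x \<le> R" by (simp add: R_def)
    define B where "B = {z :: real \<Rightarrow>\<^sub>C 'a. \<forall>t. norm (z t) \<le> 2 * R}"
    \<comment> \<open>Clamping the time to [a, a + \<delta>] freezes the image outside that
      interval, so the iteration can run in the complete space of bounded continuous functions on
      the whole line.\<close>
    define cl where "cl t = max a (min t (a + \<delta>))" for t
    define I where "I z t = x + integral {a..cl t} (\<lambda>s. f s (apply_bcontfun z s))" for z t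
    have cl: "cl t \<in> {a..a + \<delta>}" for t using \<delta> by (auto simp: cl_def)
    have cz: "continuous_on S (apply_bcontfun z)" for z :: "real \<Rightarrow>\<^sub>C 'a" and S
      by (rule continuous_on_subset[where s = UNIV]) (auto simp: apply_bcontfun[unfolded bcontfun_def, simplified])
    have cf: "continuous_on S (\<lambda>s. f s (apply_bcontfun z s))" for z :: "real \<Rightarrow>\<^sub>C 'a" and S
      by (rule cont_comp[OF cz])
    have int: "(\<lambda>s. f s (apply_bcontfun z s)) integrable_on {u..v}" for z :: "real \<Rightarrow>\<^sub>C 'a" and u v
      by (rule integrable_continuous_interval[OF cf])
    have nI: "norm (I z t) \<le> 2 * R" if z: "z \<in> B" for z t
    proof -
      have "norm (integral {a..cl t} (\<lambda>s. f s (apply_bcontfun z s))) \<le> (L * (2 * R)) * (cl t - a)"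
      proof (rule integral_bound)
        show "a \<le> cl t" using cl[of t] by auto
        show "norm (f s (apply_bcontfun z s)) \<le> L * (2 * R)" for s
        proof -
          have "norm (f s (apply_bcontfun z s) - f s 0) \<le> L * norm (apply_bcontfun z s - 0)"
            using z R by (intro L) (auto simp: B_def)
          also have "\<dots> \<le> L * (2 * R)" using z L by (auto simp: B_def)
          finally show ?thesis by (simp add: zero)
        qed
      qed (rule cf)
      also have "\<dots> \<le> (L * (2 * R)) * \<delta>"
        using cl[of t] L R by (intro mult_left_mono) auto
      also have "\<dots> = R" using L by (simp add: \<delta>_def)
      finally show ?thesis
        using x norm_triangle_ineq[of x "integral {a..cl t} (\<lambda>s. f s (apply_bcontfun z s))"]
        by (simp add: I_def)
    qed
    have ccl: "continuous_on UNIV cl" unfolding cl_def by (intro continuous_intros)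
    have cI: "continuous_on UNIV (I z)" for z
    proof -
      have c: "continuous_on {a..a + \<delta>} (\<lambda>u. integral {a..u} (\<lambda>s. f s (apply_bcontfun z s)))"
        by (rule indefinite_integral_continuous_1[OF int])
      have "continuous_on UNIV (\<lambda>t. integral {a..cl t} (\<lambda>s. f s (apply_bcontfun z s)))"
        by (rule continuous_on_compose2[OF c ccl]) (use cl in auto)
      then show ?thesis unfolding I_def by (intro continuous_intros)
    qed
    have bI: "I z \<in> bcontfun" if "z \<in> B" for z
      using cI nI[OF that] by (intro bcontfun_normI) auto
    define \<Phi> where "\<Phi> z = Bcontfun (I z)" for z
    have \<Phi>: "apply_bcontfun (\<Phi> z) = I z" if "z \<in> B" for z
      using bI[OF that] by (simp add: \<Phi>_def Bcontfun_inverse)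
    have "B = (\<Inter>t. {z. norm (apply_bcontfun z t) \<le> 2 * R})" by (auto simp: B_def)
    moreover have "closed {z :: real \<Rightarrow>\<^sub>C 'a. norm (apply_bcontfun z t) \<le> 2 * R}" for t
    proof -
      have "continuous_on UNIV (\<lambda>z :: real \<Rightarrow>\<^sub>C 'a. apply_bcontfun z t)"
      proof (rule continuous_onI)
        fix z :: "real \<Rightarrow>\<^sub>C 'a" and e :: real assume "e > 0"
        then show "\<exists>d>0. \<forall>y\<in>UNIV. dist y z < d \<longrightarrow> dist (apply_bcontfun y t) (apply_bcontfun z t) \<le> e"
          by (intro exI[of _ e]) (auto intro: order_trans[OF dist_bounded])
      qed
      then show ?thesis by (intro closed_Collect_le continuous_intros)
    qed
    ultimately have cB: "complete B" by (simp add: closed_INT complete_eq_closed)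
    have "0 \<in> B" using R by (auto simp: B_def zero_bcontfun.rep_eq)
    have "\<exists>!z\<in>B. \<Phi> z = z"
    proof (rule Banach_fix[OF cB, where c = "1/2"])
      show "B \<noteq> {}" using \<open>0 \<in> B\<close> by blast
      show "\<Phi> ` B \<subseteq> B" using nI \<Phi> by (auto simp: B_def)
      fix z w assume zw: "z \<in> B" "w \<in> B"
      have "dist (I z t) (I w t) \<le> 1/2 * dist z w" for t
      proof -
        have "I z t - I w t = integral {a..cl t} (\<lambda>s. f s (apply_bcontfun z s) - f s (apply_bcontfun w s))"
          by (simp add: I_def integral_diff[OF int int])
        also have "norm \<dots> \<le> (L * dist z w) * (cl t - a)"
        proof (rule integral_bound)
          show "a \<le> cl t" using cl[of t] by auto
          show "continuous_on {a..cl t} (\<lambda>s. f s (apply_bcontfun z s) - f s (apply_bcontfun w s))"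
            by (intro continuous_intros cf)
          fix s
          have "norm (f s (apply_bcontfun z s) - f s (apply_bcontfun w s))
              \<le> L * norm (apply_bcontfun z s - apply_bcontfun w s)"
            using zw by (intro L) (auto simp: B_def)
          also have "\<dots> \<le> L * dist z w"
            using L dist_bounded[of z s w] by (intro mult_left_mono) (auto simp: dist_norm)
          finally show "norm (f s (apply_bcontfun z s) - f s (apply_bcontfun w s)) \<le> L * dist z w" .
        qed
        also have "\<dots> \<le> (L * dist z w) * \<delta>"
          using cl[of t] L by (intro mult_left_mono) auto
        also have "\<dots> = 1/2 * dist z w" using L by (simp add: \<delta>_def)
        finally show ?thesis by (simp add: dist_norm)
      qed
      then show "dist (\<Phi> z) (\<Phi> w) \<le> 1/2 * dist z w"
        using zw by (intro dist_bound) (simp add: \<Phi>)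
    qed auto
    then obtain z where z: "z \<in> B" "\<Phi> z = z" by blast
    have "sol a (a + \<delta>) x (apply_bcontfun z)"
      unfolding sol_def
    proof (intro conjI ballI cz)
      fix t assume t: "t \<in> {a..a + \<delta>}"
      then have "cl t = t" by (auto simp: cl_def)
      have "apply_bcontfun z t = I z t" using \<Phi>[OF z(1)] z(2) by simp
      then have "apply_bcontfun z t - x = integral {a..t} (\<lambda>s. f s (apply_bcontfun z s))"
        using \<open>cl t = t\<close> by (simp add: I_def)
      then show "((\<lambda>s. f s (apply_bcontfun z s)) has_integral (apply_bcontfun z t - x)) {a..t}"
        using int[of z a t] by (simp add: has_integral_integral)
    qed
    then show "\<exists>z. sol a (a + \<delta>) x z" by blast
  qed
qed

section \<open>Maximal solutions, blow-up alternative and continuous dependence\<close>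

definition max_sol :: "'a \<Rightarrow> ereal \<Rightarrow> (real \<Rightarrow> 'a) \<Rightarrow> bool" where
  "max_sol x Tstar z \<longleftrightarrow> 0 < Tstar \<and> (\<forall>T\<ge>0. ereal T < Tstar \<longrightarrow> sol 0 T x z) \<and>
     (\<forall>T. Tstar = ereal T \<longrightarrow> \<not> (\<exists>w. sol 0 T x w))"

lemma max_sol_exists: "\<exists>Tstar z. max_sol x Tstar z"
proof -
  define S where "S = {T. 0 \<le> T \<and> (\<exists>w. sol 0 T x w)}"
  define Tstar where "Tstar = (SUP T\<in>S. ereal T)"
  \<comment> \<open>Every time \<open>t\<close> chooses its own solution on [0, t]; uniqueness makes
    the choices agree on overlaps, so that \<open>z\<close> is one curve.\<close>
  define z where "z t = (SOME w. sol 0 t x w) t" for t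
  obtain \<delta> where \<delta>: "\<delta> > 0" "\<And>a y. norm y \<le> norm x \<Longrightarrow> \<exists>w. sol a (a + \<delta>) y w"
    using local_existence[of "norm x"] by blast
  have "\<delta> \<in> S" using \<delta>(1) \<delta>(2)[of x 0] by (auto simp: S_def)
  then have "ereal \<delta> \<le> Tstar" unfolding Tstar_def by (rule SUP_upper)
  moreover have "0 < ereal \<delta>" using \<delta>(1) by simp
  ultimately have pos: "0 < Tstar" by (rule less_le_trans[rotated])
  have 2: "sol 0 T x z" if T: "0 \<le> T" "ereal T < Tstar" for T
  proof -
    obtain T' where T': "T' \<in> S" "T < T'"
      using T(2) unfolding Tstar_def less_SUP_iff by auto
    then obtain w where w: "sol 0 T' x w" by (auto simp: S_def)
    have "sol 0 T x w" using sol_mono[OF w] T' by simp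
    then show ?thesis
    proof (rule sol_cong)
      fix t assume t: "t \<in> {0..T}"
      have wt: "sol 0 t x w" using sol_mono[OF w] T' t by simp
      then have "sol 0 t x (SOME w. sol 0 t x w)" by (rule someI[where P = "sol 0 t x"])
      then show "z t = w t" unfolding z_def using sol_unique[OF _ wt, of _ t] t by auto
    qed
  qed
  \<comment> \<open>The supremum of the existence times is not attained: a restart from the endpoint
    value would go beyond it.\<close>
  have 3: "\<not> sol 0 T x w" if T: "Tstar = ereal T" for T w
  proof
    assume w: "sol 0 T x w"
    have T0: "0 \<le> T" using pos T by simp
    obtain \<delta> where \<delta>: "\<delta> > 0" "\<And>a y. norm y \<le> norm (w T) \<Longrightarrow> \<exists>v. sol a (a + \<delta>) y v"
      using local_existence[of "norm (w T)"] by blast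
    then obtain v where v: "sol T (T + \<delta>) (w T) v" by blast
    have "sol 0 (T + \<delta>) x (\<lambda>t. if t \<le> T then w t else v t)"
      by (rule sol_glue[OF w v T0]) (use \<delta> in auto)
    then have "T + \<delta> \<in> S" using T0 \<delta> by (auto simp: S_def)
    then have "ereal (T + \<delta>) \<le> Tstar" unfolding Tstar_def by (rule SUP_upper)
    then show False using T \<delta>(1) by simp
  qed
  show ?thesis using pos 2 3 by (auto simp: max_sol_def)
qed

lemma max_sol_less:
  assumes m: "max_sol x Tstar z" and w: "sol 0 T x w"
  shows "ereal T < Tstar"
proof (rule ccontr)
  assume "\<not> ereal T < Tstar"
  then have le: "Tstar \<le> ereal T" by simp
  then obtain \<tau> where \<tau>: "Tstar = ereal \<tau>" using m by (cases Tstar) (auto simp: max_sol_def)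
  then have "sol 0 \<tau> x w" using sol_mono[OF w] le by simp
  then show False using m \<tau> by (auto simp: max_sol_def)
qed

text \<open>If the lifespans differed, the longer solution would live on the closed interval on
  which the shorter one rules out any solution.\<close>

lemma max_sol_unique:
  assumes z: "max_sol x T1 z" and w: "max_sol x T2 w"
  shows "T2 = T1" and "\<And>t. 0 \<le> t \<Longrightarrow> ereal t < T1 \<Longrightarrow> w t = z t"
proof -
  have aux: "\<not> T1 < T2" if z: "max_sol x T1 z" and w: "max_sol x T2 w" for T1 T2 z w
  proof
    assume less: "T1 < T2"
    then obtain \<tau> where \<tau>: "T1 = ereal \<tau>" using z by (cases T1) (auto simp: max_sol_def)
    have "0 < \<tau>" using z \<tau> by (simp add: max_sol_def)
    then have "sol 0 \<tau> x w" using w less \<tau> by (auto simp: max_sol_def)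
    then show False using z \<tau> by (auto simp: max_sol_def)
  qed
  show eq: "T2 = T1" using aux[OF z w] aux[OF w z] by (meson antisym_conv3)
  fix t assume t: "0 \<le> t" "ereal t < T1"
  then have "sol 0 t x z" "sol 0 t x w" using z w eq by (auto simp: max_sol_def)
  then show "w t = z t" using sol_unique[of 0 t x w z t] t by auto
qed

text \<open>A value of norm below M at a time close to \<tau> could be restarted for a duration that
  depends on M alone, stepping over \<tau>. Since this excludes every such time in a left
  neighbourhood of \<tau>, the result is a genuine limit and not merely an unbounded
  sequence.\<close>

lemma max_sol_blowup:
  assumes z: "max_sol x (ereal \<tau>) z"
  shows "filterlim (\<lambda>t. norm (z t)) at_top (at_left \<tau>)"
  unfolding filterlim_at_top
proof
  fix M :: real
  have \<tau>: "\<tau> > 0" using z by (simp add: max_sol_def)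
  obtain \<delta> where \<delta>: "\<delta> > 0" "\<And>a y. norm y \<le> M \<Longrightarrow> \<exists>w. sol a (a + \<delta>) y w"
    using local_existence[of M] by blast
  have "M \<le> norm (z t)" if t: "t < \<tau>" "t > max 0 (\<tau> - \<delta>)" for t
  proof (rule ccontr)
    assume "\<not> M \<le> norm (z t)"
    then obtain w where w: "sol t (t + \<delta>) (z t) w" using \<delta>(2)[of "z t" t] by auto
    have zt: "sol 0 t x z" using z t by (auto simp: max_sol_def)
    have "sol 0 (t + \<delta>) x (\<lambda>s. if s \<le> t then z s else w s)"
      by (rule sol_glue[OF zt w]) (use t \<delta> in auto)
    then have "ereal (t + \<delta>) < ereal \<tau>" by (rule max_sol_less[OF z])
    then show False using t by simp
  qed
  then show "\<forall>\<^sub>F t in at_left \<tau>. M \<le> norm (z t)"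
    unfolding eventually_at_left_field using \<tau> \<delta>(1) by (intro exI[of _ "max 0 (\<tau> - \<delta>)"]) auto
qed

text \<open>Two things are unknown at the start: a bound on the perturbed solutions and their
  lifespans. As long as the distance to \<open>z\<close> is at most 1, Gronwall applies in a fixed
  ball and improves this to less than 1; a continuity argument removes the proviso. The resulting
  bound then excludes blow-up before \<open>T\<close>.\<close>

lemma max_sol_dependence:
  assumes z: "max_sol x Tstar z" and zj: "\<And>j. max_sol (xs j) (Ts j) (zs j)"
    and lim: "xs \<longlonglongrightarrow> x" and T: "0 < T" "ereal T < Tstar"
  obtains C where "C \<ge> 0" "\<forall>\<^sub>F j in sequentially. ereal T < Ts j \<and>
     (\<forall>t\<in>{0..T}. norm (zs j t - z t) \<le> C * norm (xs j - x))"
proof -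
  have zT: "sol 0 T x z" using z T by (auto simp: max_sol_def)
  obtain R0 where R0: "R0 > 0" "\<And>t. t \<in> {0..T} \<Longrightarrow> norm (z t) \<le> R0"
    using sol_bounded[OF zT] by blast
  \<comment> \<open>The extra 1 leaves room for curves within distance 1 of \<open>z\<close>, so
    that one \<open>L\<close> serves both solutions.\<close>
  define R where "R = R0 + 1"
  obtain L where L: "L > 0" "\<And>t x y. norm x \<le> R \<Longrightarrow> norm y \<le> R \<Longrightarrow>
      norm (f t x - f t y) \<le> L * norm (x - y)"
    using lip_pos[of R] by blast
  define C where "C = 2 * exp (2 * L * T)"
  have C: "C > 0" by (simp add: C_def)
  have key: "norm (zs j t - z t) \<le> C * norm (xs j - x)"
    if small: "C * norm (xs j - x) < 1" and t: "t \<in> {0..T}" "ereal t < Ts j" for j t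
  proof -
    have st: "sol 0 t (xs j) (zs j)" using zj[of j] t by (auto simp: max_sol_def)
    have zt: "sol 0 t x z" using sol_mono[OF zT] t by auto
    have bound_on: "norm (zs j r - z r) \<le> C * norm (xs j - x)"
      if r: "r \<in> {0..t}" and le: "\<And>s. s \<in> {0..r} \<Longrightarrow> norm (zs j s - z s) \<le> 1" for r
    proof -
      have "norm (zs j r - z r) \<le> 2 * norm (xs j - x) * exp (2 * L * (r - 0))"
      proof (rule sol_compare[where b = r and R = R])
        show "sol 0 r (xs j) (zs j)" "sol 0 r x z" using sol_mono[OF st] sol_mono[OF zt] r by auto
        fix s assume s: "s \<in> {0..r}"
        then have z: "norm (z s) \<le> R0" using R0 r t by auto
        then show "norm (z s) \<le> R" by (simp add: R_def)
        show "norm (zs j s) \<le> R"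
          using le[OF s] z norm_triangle_ineq[of "zs j s - z s" "z s"] by (simp add: R_def)
      qed (use L r in auto)
      also have "\<dots> \<le> 2 * norm (xs j - x) * exp (2 * L * T)"
        using r t L by (intro mult_left_mono) auto
      finally show ?thesis by (simp add: C_def mult_ac)
    qed
    \<comment> \<open>continuity argument: the distance cannot reach 1 because it stays below \<open>C * norm (xs j - x) < 1\<close>\<close>
    have "norm (zs j s - z s) \<le> 1" if s: "s \<in> {0..t}" for s
    proof (rule ccontr)
      assume neg: "\<not> norm (zs j s - z s) \<le> 1"
      let ?h = "\<lambda>s. norm (zs j s - z s)"
      have ch: "continuous_on {0..s} ?h"
        using st zt s unfolding sol_def
        by (intro continuous_intros) (auto intro: continuous_on_subset)
      \<comment> \<open>The infimum of this closed set is the first time at which the distance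
        reaches 1. The intermediate value theorem makes the distance there exactly 1, so it is at
        most 1 up to that time and the comparison applies; it yields a value below 1 at that very
        time.\<close>
      define B where "B = {r \<in> {0..s}. 1 \<le> ?h r}"
      have "closed B" unfolding B_def
        by (rule continuous_on_closed_Collect_le[OF continuous_on_const ch closed_atLeastAtMost])
      moreover have "B \<noteq> {}" "bdd_below B" using neg s by (auto simp: B_def)
      ultimately have inB: "Inf B \<in> B" by (intro closed_contains_Inf)
      define r where "r = Inf B"
      have r: "r \<in> {0..s}" "1 \<le> ?h r" using inB by (auto simp: B_def r_def)
      have less: "?h u < 1" if "u \<in> {0..<r}" for u
      proof (rule ccontr)
        assume "\<not> ?h u < 1"
        then have "u \<in> B" using that r by (auto simp: B_def)
        then have "r \<le> u" unfolding r_def using \<open>bdd_below B\<close> by (rule cInf_lower)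
        then show False using that by simp
      qed
      have "?h r = 1"
      proof (rule ccontr)
        assume "?h r \<noteq> 1"
        then have gt: "?h r > 1" using r by simp
        have "?h 0 = norm (xs j - x)" using sol_start[OF st] sol_start[OF zt] t by simp
        also have "\<dots> \<le> C * norm (xs j - x)"
        proof -
          have "1 \<le> exp (2 * L * T)" using L T by simp
          then have "1 \<le> C" unfolding C_def by linarith
          then have "1 * norm (xs j - x) \<le> C * norm (xs j - x)" by (intro mult_right_mono) auto
          then show ?thesis by simp
        qed
        finally have h0: "?h 0 < 1" using small by simp
        have "\<exists>u\<ge>0. u \<le> r \<and> ?h u = 1"
          by (rule IVT') (use h0 gt r ch in \<open>auto intro: continuous_on_subset\<close>)
        then obtain u where u: "0 \<le> u" "u \<le> r" "?h u = 1" by blast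
        then have "u \<noteq> r" using gt by auto
        then show False using less[of u] u by simp
      qed
      then have "?h v \<le> 1" if "v \<in> {0..r}" for v using less[of v] that by (cases "v = r") auto
      then have "?h r \<le> C * norm (xs j - x)" using r s by (intro bound_on) auto
      then show False using r small by simp
    qed
    then show ?thesis using t by (intro bound_on) auto
  qed
  have "(\<lambda>j. C * norm (xs j - x)) \<longlonglongrightarrow> C * 0"
    using lim by (intro tendsto_mult tendsto_const) (simp add: tendsto_norm_zero_iff LIM_zero_iff)
  then have ev: "\<forall>\<^sub>F j in sequentially. C * norm (xs j - x) < 1"
    by (rule order_tendstoD) simp
  show ?thesis
  proof (rule that[of C])
    show "\<forall>\<^sub>F j in sequentially. ereal T < Ts j \<and>
       (\<forall>t\<in>{0..T}. norm (zs j t - z t) \<le> C * norm (xs j - x))"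
      using ev
    proof eventually_elim
      case (elim j)
      \<comment> \<open>Otherwise the lifespan of \<open>zs j\<close> is a finite number in (0, T],
        and blow-up pushes its norm beyond \<open>R0 + 2\<close> just before the end, whereas the
        comparison keeps it below \<open>R0 + 1\<close>.\<close>
      have "ereal T < Ts j"
      proof (rule ccontr)
        assume "\<not> ereal T < Ts j"
        then have le: "Ts j \<le> ereal T" by simp
        then obtain \<tau> where \<tau>: "Ts j = ereal \<tau>" using zj[of j] by (cases "Ts j") (auto simp: max_sol_def)
        have \<tau>0: "\<tau> > 0" using zj[of j] \<tau> by (simp add: max_sol_def)
        have "\<forall>\<^sub>F t in at_left \<tau>. R0 + 2 \<le> norm (zs j t)"
          using max_sol_blowup[of "xs j" \<tau> "zs j"] zj[of j] \<tau> by (auto simp: filterlim_at_top)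
        moreover have "\<forall>\<^sub>F t in at_left \<tau>. t \<in> {0<..<\<tau>}"
          using \<tau>0 by (rule eventually_at_left_real)
        ultimately have "\<forall>\<^sub>F t in at_left \<tau>. False"
        proof eventually_elim
          case (elim t)
          then have "norm (zs j t - z t) \<le> C * norm (xs j - x)"
            using le \<tau> \<open>C * norm (xs j - x) < 1\<close> by (intro key) auto
          moreover have "norm (z t) \<le> R0" using elim le \<tau> by (intro R0) auto
          ultimately show False
            using elim \<open>C * norm (xs j - x) < 1\<close> norm_triangle_ineq[of "zs j t - z t" "z t"] by simp
        qed
        then show False by (simp add: trivial_limit_at_left_real)
      qed
      moreover have "norm (zs j t - z t) \<le> C * norm (xs j - x)" if "t \<in> {0..T}" for t
      proof -
        have "ereal t \<le> ereal T" using that by simp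
        then have "ereal t < Ts j" using \<open>ereal T < Ts j\<close> by (rule le_less_trans)
        then show ?thesis using elim that by (intro key) auto
      qed
      ultimately show ?case by blast
    qed
  qed (use C in simp)
qed

end

section \<open>The Hilbert space of square-integrable functions modulo null sets\<close>

text \<open>Extended-valued on purpose: a finite energy is then a real condition, while the Bochner
  integral of a non-integrable function would be 0.\<close>

definition l2_energy :: "(real ^ 'n \<Rightarrow> complex) \<Rightarrow> ennreal" where
  "l2_energy u = (\<integral>\<^sup>+x. ennreal ((cmod (u x))\<^sup>2) \<partial>lborel)"

lemma square_integrable_iff_l2_energy:
  "square_integrable u \<longleftrightarrow> u \<in> borel_measurable lborel \<and> l2_energy u < \<infinity>"
  unfolding square_integrable_def l2_energy_def by (auto simp: integrable_iff_bounded)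

lemma square_integrableD: "square_integrable u \<Longrightarrow> u \<in> borel_measurable borel"
  by (simp add: square_integrable_def)

lemma l2_energy_eq_integral:
  "square_integrable u \<Longrightarrow> l2_energy u = ennreal (LINT x|lborel. (cmod (u x))\<^sup>2)"
  unfolding square_integrable_def l2_energy_def by (intro nn_integral_eq_integral) auto

lemma l2_energy_cong_AE: "(AE x in lborel. u x = v x) \<Longrightarrow> l2_energy u = l2_energy v"
  unfolding l2_energy_def by (intro nn_integral_cong_AE) auto

lemma l2_energy_mono_AE: "(AE x in lborel. cmod (u x) \<le> cmod (v x)) \<Longrightarrow> l2_energy u \<le> l2_energy v"
  unfolding l2_energy_def by (intro nn_integral_mono_AE) (auto elim!: eventually_mono)

lemma l2_energy_cmult: "l2_energy (\<lambda>x. c * u x) = ennreal ((cmod c)\<^sup>2) * l2_energy u"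
  if "u \<in> borel_measurable borel"
  unfolding l2_energy_def using that
  by (simp add: norm_mult power_mult_distrib ennreal_mult nn_integral_cmult)

lemma l2_energy_minus_commute: "l2_energy (\<lambda>x. u x - v x) = l2_energy (\<lambda>x. v x - u x)"
  by (simp add: l2_energy_def norm_minus_commute)

lemma norm_add_squared_le:
  fixes a b :: "'a::real_normed_vector"
  shows "(norm (a + b))\<^sup>2 \<le> 2 * (norm a)\<^sup>2 + 2 * (norm b)\<^sup>2"
proof -
  have "(norm (a + b))\<^sup>2 \<le> (norm a + norm b)\<^sup>2" by (intro power_mono norm_triangle_ineq) auto
  also have "\<dots> \<le> 2 * (norm a)\<^sup>2 + 2 * (norm b)\<^sup>2"
    using sum_squares_bound[of "norm a" "norm b"] by (simp add: power2_sum)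
  finally show ?thesis .
qed

lemma l2_energy_add_le:
  assumes "u \<in> borel_measurable borel" "v \<in> borel_measurable borel"
  shows "l2_energy (\<lambda>x. u x + v x) \<le> 2 * l2_energy u + 2 * l2_energy v"
proof -
  have "l2_energy (\<lambda>x. u x + v x)
      \<le> (\<integral>\<^sup>+x. ennreal (2 * (cmod (u x))\<^sup>2 + 2 * (cmod (v x))\<^sup>2) \<partial>lborel)"
    unfolding l2_energy_def by (intro nn_integral_mono ennreal_leI norm_add_squared_le)
  also have "\<dots> = (\<integral>\<^sup>+x. (2 * ennreal ((cmod (u x))\<^sup>2) + 2 * ennreal ((cmod (v x))\<^sup>2)) \<partial>lborel)"
    by (simp add: ennreal_mult)
  also have "\<dots> = 2 * l2_energy u + 2 * l2_energy v"
    unfolding l2_energy_def using assms by (simp add: nn_integral_add nn_integral_cmult)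
  finally show ?thesis .
qed

lemma square_integrable_0 [simp]: "square_integrable (\<lambda>x. 0)"
  by (simp add: square_integrable_def)

lemma square_integrable_add:
  assumes "square_integrable u" "square_integrable v"
  shows "square_integrable (\<lambda>x. u x + v x)"
proof -
  have "l2_energy (\<lambda>x. u x + v x) \<le> 2 * l2_energy u + 2 * l2_energy v"
    using assms by (intro l2_energy_add_le) (auto dest: square_integrableD)
  also have "\<dots> < \<infinity>"
    using assms by (auto simp: square_integrable_iff_l2_energy ennreal_mult_less_top)
  finally show ?thesis using assms by (auto simp: square_integrable_iff_l2_energy)
qed

lemma square_integrable_mult_bounded:
  assumes u: "square_integrable u" and m: "m \<in> borel_measurable borel" "\<And>x. cmod (m x) \<le> B"
  shows "square_integrable (\<lambda>x. m x * u x)"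
proof -
  have "l2_energy (\<lambda>x. m x * u x) \<le> l2_energy (\<lambda>x. of_real B * u x)"
  proof (intro l2_energy_mono_AE AE_I2)
    fix x show "cmod (m x * u x) \<le> cmod (of_real B * u x)"
      using m(2)[of x] by (auto simp: norm_mult intro!: mult_right_mono)
  qed
  also have "\<dots> < \<infinity>"
    using u by (auto simp: l2_energy_cmult square_integrable_iff_l2_energy ennreal_mult_less_top)
  finally show ?thesis using u m by (auto simp: square_integrable_iff_l2_energy)
qed

lemma square_integrable_cmult: "square_integrable u \<Longrightarrow> square_integrable (\<lambda>x. c * u x)"
  by (rule square_integrable_mult_bounded[where B = "cmod c"]) auto

lemma square_integrable_scaleR: "square_integrable u \<Longrightarrow> square_integrable (\<lambda>x. c *\<^sub>R u x)"
  using square_integrable_cmult[of u "of_real c"] by (simp add: scaleR_conv_of_real)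

lemma square_integrable_uminus: "square_integrable u \<Longrightarrow> square_integrable (\<lambda>x. - u x)"
  using square_integrable_cmult[of u "-1"] by simp

lemma square_integrable_diff:
  "square_integrable u \<Longrightarrow> square_integrable v \<Longrightarrow> square_integrable (\<lambda>x. u x - v x)"
  using square_integrable_add[of u "\<lambda>x. - v x"] square_integrable_uminus[of v] by simp

lemma integrable_inner_square_integrable:
  assumes "square_integrable u" "square_integrable v"
  shows "integrable lborel (\<lambda>x. u x \<bullet> v x)"
proof (rule Bochner_Integration.integrable_bound)
  show "integrable lborel (\<lambda>x. (cmod (u x))\<^sup>2 + (cmod (v x))\<^sup>2)"
    using assms by (auto simp: square_integrable_def)
  show "(\<lambda>x. u x \<bullet> v x) \<in> borel_measurable lborel"
    using assms by (auto simp: square_integrable_def)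
  show "AE x in lborel. norm (u x \<bullet> v x) \<le> norm ((cmod (u x))\<^sup>2 + (cmod (v x))\<^sup>2)"
  proof (intro AE_I2)
    fix x
    have "\<bar>u x \<bullet> v x\<bar> \<le> cmod (u x) * cmod (v x)" by (rule Cauchy_Schwarz_ineq2)
    also have "\<dots> \<le> (cmod (u x))\<^sup>2 + (cmod (v x))\<^sup>2"
      using sum_squares_bound[of "cmod (u x)" "cmod (v x)"]
        mult_nonneg_nonneg[OF norm_ge_zero[of "u x"] norm_ge_zero[of "v x"]] by linarith
    finally show "norm (u x \<bullet> v x) \<le> norm ((cmod (u x))\<^sup>2 + (cmod (v x))\<^sup>2)" by simp
  qed
qed

lemma integral_inner_cong_AE:
  assumes "square_integrable u1" "square_integrable u2" "square_integrable v1" "square_integrable v2"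
    and "AE x in lborel. u1 x = u2 x" "AE x in lborel. v1 x = v2 x"
  shows "(LINT x|lborel. u1 x \<bullet> v1 x) = (LINT x|lborel. u2 x \<bullet> v2 x)"
proof (rule integral_cong_AE)
  show "AE x in lborel. u1 x \<bullet> v1 x = u2 x \<bullet> v2 x"
    using assms(5,6) by eventually_elim simp
qed (use assms in \<open>auto intro!: borel_measurable_inner dest: square_integrableD\<close>)

\<comment> \<open>The relation is partial, since only square-integrable Borel functions represent a
  class. Consequently \<open>rep_l2\<close> always returns a function that is Borel and
  square-integrable everywhere it is used.\<close>
quotient_type 'n l2 = "(real, 'n::finite) vec \<Rightarrow> complex" /
  partial: "\<lambda>u v. square_integrable u \<and> square_integrable v \<and> (AE x in lborel. u x = v x)"
proof (rule part_equivpI)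
  show "\<exists>u :: real ^ 'n \<Rightarrow> complex. square_integrable u \<and> square_integrable u \<and> (AE x in lborel. u x = u x)"
    by (intro exI[of _ "\<lambda>x. 0"]) simp
  show "symp (\<lambda>u v :: real ^ 'n \<Rightarrow> complex. square_integrable u \<and> square_integrable v \<and> (AE x in lborel. u x = v x))"
    by (intro sympI) (auto elim: eventually_mono)
  show "transp (\<lambda>u v :: real ^ 'n \<Rightarrow> complex. square_integrable u \<and> square_integrable v \<and> (AE x in lborel. u x = v x))"
    by (intro transpI) (auto elim: eventually_elim2)
qed

section \<open>Hilbert space structure and completeness\<close>

instantiation l2 :: (finite) real_vector
begin

lift_definition zero_l2 :: "'a l2" is "\<lambda>x. 0" by simp

lift_definition plus_l2 :: "'a l2 \<Rightarrow> 'a l2 \<Rightarrow> 'a l2" is "\<lambda>u v x. u x + v x"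
  by (auto intro: square_integrable_add elim: eventually_elim2)

lift_definition uminus_l2 :: "'a l2 \<Rightarrow> 'a l2" is "\<lambda>u x. - u x"
  by (auto intro: square_integrable_uminus)

lift_definition minus_l2 :: "'a l2 \<Rightarrow> 'a l2 \<Rightarrow> 'a l2" is "\<lambda>u v x. u x - v x"
  by (auto intro: square_integrable_diff elim: eventually_elim2)

lift_definition scaleR_l2 :: "real \<Rightarrow> 'a l2 \<Rightarrow> 'a l2" is "\<lambda>c u x. c *\<^sub>R u x"
  by (auto intro: square_integrable_scaleR elim: eventually_mono)

instance
proof
  fix x y z :: "'a l2" and a b :: real
  show "x + y + z = x + (y + z)"
    by transfer (auto intro!: square_integrable_add simp: add.assoc)
  show "x + y = y + x"
    by transfer (auto intro!: square_integrable_add simp: add.commute)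
  show "0 + x = x" by transfer auto
  show "- x + x = 0" by transfer auto
  show "x - y = x + - y"
    by transfer (auto intro!: square_integrable_add square_integrable_diff square_integrable_uminus)
  show "a *\<^sub>R (x + y) = a *\<^sub>R x + a *\<^sub>R y"
    by transfer (auto intro!: square_integrable_add square_integrable_scaleR simp: scaleR_right_distrib)
  show "(a + b) *\<^sub>R x = a *\<^sub>R x + b *\<^sub>R x"
    by transfer (auto intro!: square_integrable_add square_integrable_scaleR simp: scaleR_left_distrib)
  show "a *\<^sub>R b *\<^sub>R x = (a * b) *\<^sub>R x"
    by transfer (auto intro!: square_integrable_scaleR)
  show "1 *\<^sub>R x = x" by transfer auto
qed

end

instantiation l2 :: (finite) real_inner
begin

text \<open>On complex values the dot is the real inner product, so this is the real part of the
  Hermitian product. It induces the usual norm; complex scalars will act through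
  \<open>mult_l2\<close> with a constant multiplier.\<close>

lift_definition inner_l2 :: "'a l2 \<Rightarrow> 'a l2 \<Rightarrow> real" is "\<lambda>u v. LINT x|lborel. u x \<bullet> v x"
  by (auto intro: integral_inner_cong_AE)

definition norm_l2 :: "'a l2 \<Rightarrow> real" where "norm_l2 x = sqrt (x \<bullet> x)"

definition sgn_l2 :: "'a l2 \<Rightarrow> 'a l2" where "sgn_l2 x = x /\<^sub>R norm x"

definition dist_l2 :: "'a l2 \<Rightarrow> 'a l2 \<Rightarrow> real" where "dist_l2 x y = norm (x - y)"

definition uniformity_l2 :: "('a l2 \<times> 'a l2) filter" where
  "uniformity_l2 = (INF e\<in>{0 <..}. principal {(x, y). dist x y < e})"

definition open_l2 :: "'a l2 set \<Rightarrow> bool" where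
  "open_l2 U \<longleftrightarrow> (\<forall>x\<in>U. eventually (\<lambda>(x', y). x' = x \<longrightarrow> y \<in> U) uniformity)"

instance
proof
  fix x y z :: "'a l2" and a b :: real
  show "x \<bullet> y = y \<bullet> x" by transfer (simp add: inner_commute)
  show "(x + y) \<bullet> z = x \<bullet> z + y \<bullet> z"
    by transfer (auto simp: inner_add_left integrable_inner_square_integrable intro!: Bochner_Integration.integral_add)
  show "(a *\<^sub>R x) \<bullet> y = a * (x \<bullet> y)" by transfer simp
  show "0 \<le> x \<bullet> x" by transfer simp
  show "(x \<bullet> x = 0) = (x = 0)"
  proof transfer
    fix u :: "real ^ 'a \<Rightarrow> complex"
    assume u: "square_integrable u \<and> square_integrable u \<and> (AE x in lborel. u x = u x)"
    then have "((LINT x|lborel. u x \<bullet> u x) = 0) \<longleftrightarrow> (AE x in lborel. u x \<bullet> u x = 0)"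
      by (intro integral_nonneg_eq_0_iff_AE integrable_inner_square_integrable) auto
    then show "((LINT x|lborel. u x \<bullet> u x) = 0) \<longleftrightarrow>
        square_integrable u \<and> square_integrable (\<lambda>x::real^'a. 0::complex) \<and> (AE x in lborel. u x = 0)"
      using u by simp
  qed
  show "norm x = sqrt (x \<bullet> x)" by (rule norm_l2_def)
  show "sgn x = x /\<^sub>R norm x" by (rule sgn_l2_def)
  show "dist x y = norm (x - y)" by (rule dist_l2_def)
  show "uniformity = (INF e\<in>{0 <..}. principal {(x, y :: 'a l2). dist x y < e})"
    by (rule uniformity_l2_def)
  fix U :: "'a l2 set"
  show "open U = (\<forall>x\<in>U. \<forall>\<^sub>F (x', y) in uniformity. x' = x \<longrightarrow> y \<in> U)"
    by (rule open_l2_def)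
qed

end

lemma square_integrable_rep_l2 [simp]: "square_integrable (rep_l2 x)"
  using Quotient_rep_reflp[OF Quotient_l2] by blast

lemma borel_measurable_rep_l2 [measurable]: "rep_l2 x \<in> borel_measurable borel"
  by (rule square_integrableD) simp

lemma abs_rep_l2 [simp]: "abs_l2 (rep_l2 x) = x"
  by (rule Quotient_abs_rep[OF Quotient_l2])

lemma rep_abs_l2: "square_integrable u \<Longrightarrow> AE x in lborel. rep_l2 (abs_l2 u) x = u x"
  using Quotient_rep_abs[OF Quotient_l2, of u] by simp

lemma abs_l2_eq_iff:
  "square_integrable u \<Longrightarrow> square_integrable v \<Longrightarrow> abs_l2 u = abs_l2 v \<longleftrightarrow> (AE x in lborel. u x = v x)"
  using Quotient_rel[OF Quotient_l2, of u v] by auto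

lemma abs_l2_eqI:
  assumes "square_integrable u" "v \<in> borel_measurable borel" "AE x in lborel. v x = u x"
  shows "abs_l2 v = abs_l2 u"
proof -
  have "l2_energy v = l2_energy u" by (rule l2_energy_cong_AE) fact
  then have "square_integrable v" using assms by (simp add: square_integrable_iff_l2_energy)
  then show ?thesis using assms by (subst abs_l2_eq_iff)
qed

lemma abs_l2_0: "abs_l2 (\<lambda>x. 0) = 0" by (simp add: zero_l2_def)

lemma abs_l2_add:
  "square_integrable u \<Longrightarrow> square_integrable v \<Longrightarrow> abs_l2 (\<lambda>x. u x + v x) = abs_l2 u + abs_l2 v"
  by (subst plus_l2.abs_eq) auto

lemma abs_l2_diff:
  "square_integrable u \<Longrightarrow> square_integrable v \<Longrightarrow> abs_l2 (\<lambda>x. u x - v x) = abs_l2 u - abs_l2 v"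
  by (subst minus_l2.abs_eq) auto

lemma abs_l2_scaleR: "square_integrable u \<Longrightarrow> abs_l2 (\<lambda>x. c *\<^sub>R u x) = c *\<^sub>R abs_l2 u"
  by (subst scaleR_l2.abs_eq) auto

lemma inner_abs_l2:
  "square_integrable u \<Longrightarrow> square_integrable v \<Longrightarrow> abs_l2 u \<bullet> abs_l2 v = (LINT x|lborel. u x \<bullet> v x)"
  by (subst inner_l2.abs_eq) auto

lemma norm_abs_l2_squared:
  assumes "square_integrable u"
  shows "ennreal ((norm (abs_l2 u))\<^sup>2) = l2_energy u"
proof -
  have "(norm (abs_l2 u))\<^sup>2 = (LINT x|lborel. (cmod (u x))\<^sup>2)"
    using assms by (simp add: power2_norm_eq_inner inner_abs_l2)
  then show ?thesis using assms by (simp add: l2_energy_eq_integral)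
qed

lemma norm_abs_l2: "square_integrable u \<Longrightarrow> norm (abs_l2 u) = sqrt (enn2real (l2_energy u))"
  by (simp flip: norm_abs_l2_squared)

lemma norm_abs_l2_le:
  assumes "square_integrable u" "l2_energy u \<le> ennreal (c\<^sup>2)" "c \<ge> 0"
  shows "norm (abs_l2 u) \<le> c"
proof -
  have "ennreal ((norm (abs_l2 u))\<^sup>2) \<le> ennreal (c\<^sup>2)"
    using assms by (simp add: norm_abs_l2_squared)
  then have "(norm (abs_l2 u))\<^sup>2 \<le> c\<^sup>2" by simp
  then show ?thesis using assms(3) by (rule power2_le_imp_le)
qed

lemma norm_l2_squared: "ennreal ((norm x)\<^sup>2) = l2_energy (rep_l2 x)"
  using norm_abs_l2_squared[of "rep_l2 x"] by simp

lemma dist_l2_squared: "ennreal ((dist x y)\<^sup>2) = l2_energy (\<lambda>t. rep_l2 x t - rep_l2 y t)"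
proof -
  have "x - y = abs_l2 (\<lambda>t. rep_l2 x t - rep_l2 y t)" by (simp add: abs_l2_diff)
  then show ?thesis
    by (simp add: dist_norm norm_abs_l2_squared square_integrable_diff)
qed

text \<open>Bridge between convergence of classes in norm and the extended integrals in which the
  definition of \<open>fourier\<close> is phrased.\<close>

lemma tendsto_abs_l2_iff:
  assumes "\<And>n. square_integrable (u n)" "square_integrable v"
  shows "((\<lambda>n. abs_l2 (u n)) \<longlongrightarrow> abs_l2 v) F \<longleftrightarrow> ((\<lambda>n. l2_energy (\<lambda>x. u n x - v x)) \<longlongrightarrow> 0) F"
proof -
  have "((\<lambda>n. abs_l2 (u n)) \<longlongrightarrow> abs_l2 v) F \<longleftrightarrow> ((\<lambda>n. (norm (abs_l2 (u n) - abs_l2 v))\<^sup>2) \<longlongrightarrow> 0) F"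
    by (subst LIM_zero_iff[symmetric], subst tendsto_norm_zero_iff[symmetric]) simp
  also have "\<dots> \<longleftrightarrow> ((\<lambda>n. ennreal ((norm (abs_l2 (u n) - abs_l2 v))\<^sup>2)) \<longlongrightarrow> ennreal 0) F"
    by (subst tendsto_ennreal_iff) auto
  also have "(\<lambda>n. ennreal ((norm (abs_l2 (u n) - abs_l2 v))\<^sup>2)) = (\<lambda>n. l2_energy (\<lambda>x. u n x - v x))"
    using assms by (auto simp: fun_eq_iff abs_l2_diff[symmetric] norm_abs_l2_squared square_integrable_diff)
  finally show ?thesis by simp
qed

text \<open>Lower semicontinuity of the distance to \<open>g\<close> under convergence almost
  everywhere. It turns a Cauchy bound, valid for all late terms, into a bound for the limit.\<close>

lemma l2_energy_fatou:
  assumes meas: "\<And>n. f n \<in> borel_measurable borel" "g \<in> borel_measurable borel"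
    and lim: "AE x in lborel. (\<lambda>n. f n x) \<longlonglongrightarrow> h x"
    and bound: "\<forall>\<^sub>F n in sequentially. l2_energy (\<lambda>x. f n x - g x) \<le> c"
  shows "l2_energy (\<lambda>x. h x - g x) \<le> c"
proof -
  have "l2_energy (\<lambda>x. h x - g x) \<le> (\<integral>\<^sup>+x. liminf (\<lambda>n. ennreal ((cmod (f n x - g x))\<^sup>2)) \<partial>lborel)"
    unfolding l2_energy_def
  proof (rule nn_integral_mono_AE)
    show "AE x in lborel. ennreal ((cmod (h x - g x))\<^sup>2) \<le> liminf (\<lambda>n. ennreal ((cmod (f n x - g x))\<^sup>2))"
      using lim
    proof eventually_elim
      case (elim x)
      then have "(\<lambda>n. ennreal ((cmod (f n x - g x))\<^sup>2)) \<longlonglongrightarrow> ennreal ((cmod (h x - g x))\<^sup>2)"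
        by (intro tendsto_intros tendsto_ennrealI)
      then have "liminf (\<lambda>n. ennreal ((cmod (f n x - g x))\<^sup>2)) = ennreal ((cmod (h x - g x))\<^sup>2)"
        by (rule lim_imp_Liminf[rotated]) simp
      then show ?case by simp
    qed
  qed
  also have "\<dots> \<le> liminf (\<lambda>n. l2_energy (\<lambda>x. f n x - g x))"
    unfolding l2_energy_def using meas by (intro nn_integral_liminf) auto
  also have "\<dots> \<le> c"
    using bound by (auto intro!: Liminf_le)
  finally show ?thesis .
qed

text \<open>Expanding (2^{n/2} |d| - 2^{-n/2})^2 >= 0 gives |d| <= 2^n |d|^2 + 2^{-n}, so weighted
  squares control the plain series.\<close>

lemma summable_of_weighted_squares:
  fixes d :: "nat \<Rightarrow> complex"
  assumes "(\<Sum>n. ennreal (2 ^ n * (cmod (d n))\<^sup>2)) < \<infinity>"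
  shows "summable d"
proof -
  have "summable (\<lambda>n. 2 ^ n * (cmod (d n))\<^sup>2)"
    using assms by (intro summable_suminf_not_top) auto
  moreover have "summable (\<lambda>n. (1/2) ^ n :: real)" by (rule summable_geometric) simp
  ultimately have s: "summable (\<lambda>n. 2 ^ n * (cmod (d n))\<^sup>2 + (1/2) ^ n)" by (rule summable_add)
  show ?thesis
  proof (rule summable_norm_cancel, rule summable_comparison_test[OF _ s], intro exI[of _ 0] allI impI)
    fix n
    have "0 \<le> (sqrt (2 ^ n) * cmod (d n) - sqrt ((1/2) ^ n))\<^sup>2" by simp
    also have "\<dots> = 2 ^ n * (cmod (d n))\<^sup>2 + (1/2) ^ n - 2 * (sqrt (2 ^ n) * sqrt ((1/2) ^ n)) * cmod (d n)"
      by (simp add: power2_diff power_mult_distrib)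
    also have "sqrt (2 ^ n) * sqrt ((1/2) ^ n) = 1"
      by (simp flip: real_sqrt_mult power_mult_distrib)
    finally show "norm (norm (d n)) \<le> 2 ^ n * (cmod (d n))\<^sup>2 + (1/2) ^ n"
      using norm_ge_zero[of "d n"] unfolding real_norm_def abs_norm_cancel by linarith
  qed
qed

text \<open>Riesz-Fischer. Along a subsequence with distances below 2^{-k} the increments have
  energy at most 4^{-k}; even after weighting with 2^k the total is finite, so at almost every point
  the increments are summable. Fatou's lemma shows that the pointwise limit is also the limit in
  norm.\<close>

instance l2 :: (finite) banach
proof
  fix X :: "nat \<Rightarrow> 'a l2"
  assume X: "Cauchy X"
  have "\<exists>N. \<forall>m\<ge>N. \<forall>n\<ge>N. dist (X m) (X n) < (1/2) ^ k" for k
    using X unfolding Cauchy_def by auto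
  then obtain N where N: "\<And>k m n. m \<ge> N k \<Longrightarrow> n \<ge> N k \<Longrightarrow> dist (X m) (X n) < (1/2) ^ k"
    by metis
  \<comment> \<open>Adding \<open>k\<close> makes the indices strictly increasing, and summing all
    earlier thresholds makes \<open>M k\<close> at least \<open>N k\<close>.\<close>
  define M where "M k = k + (\<Sum>i\<le>k. N i)" for k
  have MN: "N k \<le> M j" if "k \<le> j" for k j
    using member_le_sum[of k "{..j}" N] that by (simp add: M_def)
  have "strict_mono M" by (intro strict_mono_Suc_iff[THEN iffD2]) (simp add: M_def)
  define f where "f k = rep_l2 (X (M k))" for k
  define d where "d k x = f (Suc k) x - f k x" for k x
  have [measurable]: "f k \<in> borel_measurable borel" for k by (simp add: f_def)
  have [measurable]: "d k \<in> borel_measurable borel" for k unfolding d_def by measurable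
  have ef: "l2_energy (\<lambda>x. f m x - f n x) \<le> ennreal (((1/2) ^ k)\<^sup>2)" if "m \<ge> k" "n \<ge> k" for m n k
    unfolding f_def dist_l2_squared[symmetric]
    by (intro ennreal_leI power_mono less_imp_le[OF N] MN that) auto
  have "(\<integral>\<^sup>+x. (\<Sum>n. ennreal (2 ^ n * (cmod (d n x))\<^sup>2)) \<partial>lborel)
      = (\<Sum>n. \<integral>\<^sup>+x. ennreal (2 ^ n * (cmod (d n x))\<^sup>2) \<partial>lborel)"
    by (rule nn_integral_suminf) simp
  also have "\<dots> = (\<Sum>n. ennreal (2 ^ n) * l2_energy (d n))"
    by (simp add: l2_energy_def ennreal_mult nn_integral_cmult)
  also have "\<dots> \<le> (\<Sum>n. ennreal ((1/2) ^ n))"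
  proof (intro suminf_le summableI)
    fix n
    have "ennreal (2 ^ n) * l2_energy (d n) \<le> ennreal (2 ^ n) * ennreal (((1/2) ^ n)\<^sup>2)"
      unfolding d_def by (intro mult_left_mono ef) auto
    also have "\<dots> = ennreal ((1/2) ^ n)"
      by (simp add: ennreal_mult[symmetric] power2_eq_square power_divide)
    finally show "ennreal (2 ^ n) * l2_energy (d n) \<le> ennreal ((1/2) ^ n)" .
  qed
  also have "\<dots> < \<infinity>" by (subst suminf_ennreal2) (auto intro: summable_geometric)
  finally have "AE x in lborel. (\<Sum>n. ennreal (2 ^ n * (cmod (d n x))\<^sup>2)) \<noteq> \<infinity>"
    by (intro nn_integral_PInf_AE) auto
  then have conv: "AE x in lborel. convergent (\<lambda>k. f k x)"
  proof eventually_elim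
    case (elim x)
    then have "summable (\<lambda>n. d n x)"
      by (intro summable_of_weighted_squares) (simp add: less_top)
    then have "convergent (\<lambda>n. \<Sum>i<n. d i x)" by (simp add: summable_iff_convergent)
    moreover have "(\<Sum>i<n. d i x) = f n x - f 0 x" for n
      unfolding d_def by (rule sum_lessThan_telescope)
    ultimately show ?case by (simp add: convergent_diff_const_right_iff)
  qed
  define g where "g x = lim (\<lambda>k. f k x)" for x
  have [measurable]: "g \<in> borel_measurable borel" unfolding g_def by measurable
  have lim: "AE x in lborel. (\<lambda>k. f k x) \<longlonglongrightarrow> g x"
    using conv by eventually_elim (simp add: g_def convergent_LIMSEQ_iff)
  have eg: "l2_energy (\<lambda>x. g x - f k x) \<le> ennreal (((1/2) ^ k)\<^sup>2)" for k
    by (rule l2_energy_fatou[OF _ _ lim]) (auto intro!: ef eventually_sequentiallyI[of k])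
  have "square_integrable (\<lambda>x. g x - f 0 x)"
    using eg[of 0] by (simp add: square_integrable_iff_l2_energy le_less_trans[of _ 1])
  moreover have sf: "square_integrable (f k)" for k by (simp add: f_def)
  ultimately have sg: "square_integrable g"
    using square_integrable_add[of "\<lambda>x. g x - f 0 x" "f 0"] by simp
  have "(\<lambda>k. norm (X (M k) - abs_l2 g)) \<longlonglongrightarrow> 0"
  proof (rule tendsto_sandwich[OF _ _ tendsto_const])
    show "\<forall>\<^sub>F k in sequentially. norm (X (M k) - abs_l2 g) \<le> (1/2) ^ k"
    proof (intro always_eventually allI)
      fix k
      have "X (M k) - abs_l2 g = abs_l2 (\<lambda>x. f k x - g x)"
        by (subst abs_l2_diff[OF sf sg]) (simp add: f_def)
      then show "norm (X (M k) - abs_l2 g) \<le> (1/2) ^ k"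
        using eg[of k] by (auto intro!: norm_abs_l2_le square_integrable_diff sf sg simp: l2_energy_minus_commute[of "f k"])
    qed
    show "(\<lambda>k. (1/2) ^ k :: real) \<longlonglongrightarrow> 0" by (rule LIMSEQ_power_zero) simp
  qed auto
  then have "(X \<circ> M) \<longlonglongrightarrow> abs_l2 g" by (simp add: o_def LIM_zero_iff tendsto_norm_zero_iff)
  then have "X \<longlonglongrightarrow> abs_l2 g"
    using Cauchy_converges_subseq[OF X \<open>strict_mono M\<close>] by blast
  then show "convergent X" by (auto simp: convergent_def)
qed

section \<open>Density of continuous functions with compact support\<close>

lemma nn_integral_power_dominated_convergence:
  fixes f :: "nat \<Rightarrow> 'a \<Rightarrow> complex"
  assumes p: "p > 0"
    and meas: "\<And>n. f n \<in> borel_measurable M" "h \<in> borel_measurable M"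
    and w: "w \<in> borel_measurable M" "(\<integral>\<^sup>+x. ennreal (w x) \<partial>M) < \<infinity>"
    and bound: "\<And>n. AE x in M. cmod (f n x - h x) ^ p \<le> w x"
    and lim: "AE x in M. (\<lambda>n. f n x) \<longlonglongrightarrow> h x"
  shows "(\<lambda>n. \<integral>\<^sup>+x. ennreal (cmod (f n x - h x) ^ p) \<partial>M) \<longlonglongrightarrow> 0"
proof -
  have "(\<lambda>n. \<integral>\<^sup>+x. ennreal (cmod (f n x - h x) ^ p) \<partial>M) \<longlonglongrightarrow> (\<integral>\<^sup>+x. 0 \<partial>M)"
  proof (rule nn_integral_dominated_convergence[where w = "\<lambda>x. ennreal (w x)"])
    show "AE x in M. ennreal (cmod (f j x - h x) ^ p) \<le> ennreal (w x)" for j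
      using bound[of j] by eventually_elim (rule ennreal_leI)
    show "AE x in M. (\<lambda>i. ennreal (cmod (f i x - h x) ^ p)) \<longlonglongrightarrow> 0"
      using lim
    proof eventually_elim
      case (elim x)
      then have "(\<lambda>i. ennreal (cmod (f i x - h x) ^ p)) \<longlonglongrightarrow> ennreal (cmod (h x - h x) ^ p)"
        by (intro tendsto_intros tendsto_ennrealI)
      moreover have "ennreal (cmod (h x - h x) ^ p) = 0" using p by simp
      ultimately show ?case by (simp only:)
    qed
  qed (use meas w in auto)
  then show ?thesis by simp
qed

lemma nn_integral_indicator_bounded_finite:
  fixes A :: "'a::euclidean_space set"
  assumes "bounded A"
  shows "(\<integral>\<^sup>+x. ennreal (c * indicator A x) \<partial>lborel) < \<infinity>"
proof -
  obtain r where r: "A \<subseteq> cball 0 r" using assms bounded_subset_ballD[of A 0] ball_subset_cball by blast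
  have "(\<integral>\<^sup>+x. ennreal (c * indicator A x) \<partial>lborel) \<le> (\<integral>\<^sup>+x. ennreal \<bar>c\<bar> * indicator (cball 0 r :: 'a set) x \<partial>lborel)"
  proof (rule nn_integral_mono)
    fix x :: 'a
    show "ennreal (c * indicator A x) \<le> ennreal \<bar>c\<bar> * indicator (cball 0 r) x"
      using r by (cases "x \<in> A") (auto intro: ennreal_leI)
  qed
  also have "\<dots> = ennreal \<bar>c\<bar> * emeasure lborel (cball 0 r :: 'a set)"
    by (simp add: nn_integral_cmult_indicator)
  also have "\<dots> < \<infinity>"
    using emeasure_bounded_finite[of "cball 0 r :: 'a set"] by (simp add: ennreal_mult_less_top)
  finally show ?thesis .
qed

definition continuous_compact_support :: "(real ^ 'n \<Rightarrow> complex) \<Rightarrow> bool" where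
  "continuous_compact_support g \<longleftrightarrow> continuous_on UNIV g \<and> (\<exists>r. \<forall>x. x \<notin> cball 0 r \<longrightarrow> g x = 0)"

lemma continuous_compact_support_bounded:
  assumes "continuous_compact_support g"
  obtains B r where "B > 0" "\<And>x. cmod (g x) \<le> B" "\<And>x. x \<notin> cball 0 r \<Longrightarrow> g x = 0"
proof -
  obtain r where r: "\<And>x. x \<notin> cball 0 r \<Longrightarrow> g x = 0"
    using assms by (auto simp: continuous_compact_support_def)
  have "bounded (g ` cball 0 r)"
    using assms unfolding continuous_compact_support_def
    by (intro compact_imp_bounded compact_continuous_image) (auto intro: continuous_on_subset)
  then obtain B where B: "B > 0" "\<And>x. x \<in> cball 0 r \<Longrightarrow> cmod (g x) \<le> B"
    unfolding bounded_pos by auto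
  have "cmod (g x) \<le> B" for x
    using B r[of x] by (cases "x \<in> cball 0 r") auto
  then show ?thesis using that B r by blast
qed

lemma continuous_compact_support_measurable:
  "continuous_compact_support g \<Longrightarrow> g \<in> borel_measurable borel"
  by (auto simp: continuous_compact_support_def intro: borel_measurable_continuous_onI)

lemma bounded_support_integrable:
  fixes g :: "'a::euclidean_space \<Rightarrow> 'b::{banach, second_countable_topology}"
  assumes "g \<in> borel_measurable borel" "\<And>x. norm (g x) \<le> B" "\<And>x. x \<notin> cball 0 r \<Longrightarrow> g x = 0"
  shows "integrable lborel g"
proof (rule Bochner_Integration.integrable_bound)
  show "integrable lborel (\<lambda>x :: 'a. B * indicator (cball 0 r) x)"
    using emeasure_bounded_finite[of "cball 0 r :: 'a set"] by (intro integrable_mult_right integrable_real_indicator) auto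
  show "AE x in lborel. norm (g x) \<le> norm (B * indicator (cball 0 r) x)"
    using assms(2,3) by (intro AE_I2) (auto simp: indicator_def intro: order_trans[OF _ abs_ge_self])
qed (use assms in auto)

lemma bounded_support_square_integrable:
  assumes "g \<in> borel_measurable borel" "\<And>x. cmod (g x) \<le> B" "\<And>x. x \<notin> cball 0 r \<Longrightarrow> g x = 0"
  shows "square_integrable g"
  unfolding square_integrable_def
proof
  show "integrable lborel (\<lambda>x. (cmod (g x))\<^sup>2)"
    by (rule bounded_support_integrable[where B = "B\<^sup>2" and r = r])
       (use assms in \<open>auto intro!: power_mono\<close>)
qed (use assms in auto)

lemma continuous_compact_support_square_integrable:
  "continuous_compact_support g \<Longrightarrow> square_integrable g"
  by (rule continuous_compact_support_bounded, assumption, rule bounded_support_square_integrable)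
     (auto intro: continuous_compact_support_measurable)

lemma continuous_compact_support_integrable:
  "continuous_compact_support g \<Longrightarrow> integrable lborel g"
  by (rule continuous_compact_support_bounded, assumption, rule bounded_support_integrable)
     (auto intro: continuous_compact_support_measurable)

text \<open>For the Fourier transform, $L^1$ convergence gives pointwise and $L^2$ convergence gives isometric limits.\<close>

lemma square_integrable_approx_bounded_support:
  assumes u: "square_integrable u" and e: "e > 0"
  obtains v and k :: nat where "v \<in> borel_measurable borel" "\<And>x. cmod (v x) \<le> real k"
    "\<And>x. x \<notin> cball 0 (real k) \<Longrightarrow> v x = 0" "l2_energy (\<lambda>x. v x - u x) < e"
    "integrable lborel u \<longrightarrow> (\<integral>\<^sup>+x. ennreal (cmod (v x - u x)) \<partial>lborel) < e"
proof -
  \<comment> \<open>Cutting off in space and in value at the same level makes \<open>v k x\<close>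
    eventually equal to \<open>u x\<close>, while the error is 0 or \<open>- u x\<close> and hence
    dominated by \<open>u\<close> itself, for the first and the second power alike. One
    \<open>k\<close> thus serves both norms.\<close>
  define v where "v k x = (if norm x \<le> real k \<and> cmod (u x) \<le> real k then u x else 0)" for k :: nat and x
  have [measurable]: "u \<in> borel_measurable borel" using u by (rule square_integrableD)
  have m [measurable]: "v k \<in> borel_measurable borel" for k unfolding v_def by measurable
  have lim: "AE x in lborel. (\<lambda>k. v k x) \<longlonglongrightarrow> u x"
  proof (intro AE_I2 tendsto_eventually)
    fix x
    obtain K :: nat where K: "max (norm x) (cmod (u x)) \<le> real K" using real_arch_simple by blast
    show "\<forall>\<^sub>F k in sequentially. v k x = u x"
      by (rule eventually_sequentiallyI[of K]) (use K in \<open>auto simp: v_def\<close>)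
  qed
  have conv: "(\<lambda>k. \<integral>\<^sup>+x. ennreal (cmod (v k x - u x) ^ p) \<partial>lborel) \<longlonglongrightarrow> 0"
    if "p > 0" "(\<integral>\<^sup>+x. ennreal (cmod (u x) ^ p) \<partial>lborel) < \<infinity>" for p
    by (rule nn_integral_power_dominated_convergence[OF that(1) _ _ _ that(2) _ lim])
       (use that(1) in \<open>auto simp: v_def\<close>)
  have "\<forall>\<^sub>F k in sequentially. l2_energy (\<lambda>x. v k x - u x) < e"
    using conv[of 2] u e unfolding square_integrable_iff_l2_energy l2_energy_def
    by (intro order_tendstoD) auto
  moreover have "\<forall>\<^sub>F k in sequentially. integrable lborel u \<longrightarrow> (\<integral>\<^sup>+x. ennreal (cmod (v k x - u x)) \<partial>lborel) < e"
  proof (cases "integrable lborel u")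
    case True
    then have "\<forall>\<^sub>F k in sequentially. (\<integral>\<^sup>+x. ennreal (cmod (v k x - u x)) \<partial>lborel) < e"
      using conv[of 1] e by (intro order_tendstoD) (auto simp: integrable_iff_bounded)
    then show ?thesis by eventually_elim simp
  qed simp
  ultimately have "\<forall>\<^sub>F k in sequentially. l2_energy (\<lambda>x. v k x - u x) < e \<and>
      (integrable lborel u \<longrightarrow> (\<integral>\<^sup>+x. ennreal (cmod (v k x - u x)) \<partial>lborel) < e)"
    by (rule eventually_conj)
  then obtain k where k: "l2_energy (\<lambda>x. v k x - u x) < e"
      "integrable lborel u \<longrightarrow> (\<integral>\<^sup>+x. ennreal (cmod (v k x - u x)) \<partial>lborel) < e"
    using eventually_happens'[OF sequentially_bot] by blast
  show ?thesis by (rule that[OF m _ _ k]) (auto simp: v_def)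
qed

text \<open>Lebesgue measurable functions are limits almost everywhere of continuous ones.\<close>

lemma bounded_support_approx_continuous:
  assumes v: "v \<in> borel_measurable borel" "\<And>x. cmod (v x) \<le> real k" "\<And>x. x \<notin> cball 0 (real k) \<Longrightarrow> v x = 0"
    and e: "e > 0"
  obtains g where "continuous_compact_support g" "l2_energy (\<lambda>x. g x - v x) < e"
    "(\<integral>\<^sup>+x. ennreal (cmod (g x - v x)) \<partial>lborel) < e"
proof -
  have "v measurable_on UNIV"
    using v(1) by (intro lebesgue_measurable_imp_measurable_on) (auto intro: measurable_completion)
  then obtain N g where N: "negligible N" and g: "\<And>n. continuous_on UNIV (g n)"
    and lim: "\<And>x. x \<notin> N \<Longrightarrow> (\<lambda>n. g n x) \<longlonglongrightarrow> v x"
    unfolding measurable_on_def by auto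
  define K where "K = real k + 1"
  have K: "K > 0" "real k \<le> K" by (auto simp: K_def)
  \<comment> \<open>The continuous approximants \<open>g n\<close> need neither be bounded nor have
    compact support. \<open>cut\<close> equals 1 on the ball of radius \<open>k\<close> and vanishes
    outside that of radius \<open>K = k + 1\<close>; \<open>c\<close> retracts the plane onto the
    disc of radius \<open>K\<close>. Both act trivially on \<open>v\<close>, so the pointwise limit
    survives, and all errors are at most \<open>2 * K\<close> on one fixed ball.\<close>
  define cut where "cut x = max 0 (min 1 (K - norm x))" for x :: "real ^ 'a"
  define c where "c z = (K / max K (cmod z)) *\<^sub>R z" for z
  define h where "h n x = cut x *\<^sub>R c (g n x)" for n x
  have cc: "continuous_on UNIV c" unfolding c_def using K by (intro continuous_intros) auto
  have cbound: "cmod (c z) \<le> K" for z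
  proof -
    have "cmod (c z) = K * (cmod z / max K (cmod z))" using K by (simp add: c_def)
    also have "\<dots> \<le> K * 1" using K by (intro mult_left_mono) (auto simp: divide_le_eq_1)
    finally show ?thesis by simp
  qed
  have ch: "continuous_on UNIV (h n)" for n
    unfolding h_def cut_def by (intro continuous_intros continuous_on_compose2[OF cc g]) auto
  have h0: "h n x = 0" if "x \<notin> cball 0 K" for n x using that by (simp add: h_def cut_def)
  have hb: "cmod (h n x) \<le> K" for n x
  proof -
    have "cmod (h n x) = cut x * cmod (c (g n x))" by (simp add: h_def cut_def)
    also have "\<dots> \<le> 1 * K" using K cbound by (intro mult_mono) (auto simp: cut_def)
    finally show ?thesis by simp
  qed
  have hc: "continuous_compact_support (h n)" for n
    unfolding continuous_compact_support_def using ch h0 by blast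
  have conv: "(\<lambda>n. \<integral>\<^sup>+x. ennreal (cmod (h n x - v x) ^ p) \<partial>lborel) \<longlonglongrightarrow> 0" if p: "p > 0" for p
  proof (rule nn_integral_power_dominated_convergence[OF p, where w = "\<lambda>x. (2 * K) ^ p * indicator (cball 0 K) x"])
    show "(\<integral>\<^sup>+x. ennreal ((2 * K) ^ p * indicator (cball 0 K) (x :: real ^ 'a)) \<partial>lborel) < \<infinity>"
      by (rule nn_integral_indicator_bounded_finite) simp
    show "(\<lambda>x :: real ^ 'a. (2 * K) ^ p * indicator (cball 0 K) x) \<in> borel_measurable lborel"
      by (intro borel_measurable_times borel_measurable_const borel_measurable_indicator) (simp add: borel_closed)
    show "AE x in lborel. cmod (h n x - v x) ^ p \<le> (2 * K) ^ p * indicator (cball 0 K) x" for n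
    proof (intro AE_I2)
      fix x :: "real ^ 'a"
      show "cmod (h n x - v x) ^ p \<le> (2 * K) ^ p * indicator (cball 0 K) x"
      proof (cases "x \<in> cball 0 K")
        case True
        have "cmod (h n x - v x) \<le> cmod (h n x) + cmod (v x)" by (rule norm_triangle_ineq4)
        also have "\<dots> \<le> 2 * K" using hb[of n x] v(2)[of x] K by linarith
        finally have "cmod (h n x - v x) ^ p \<le> (2 * K) ^ p" by (intro power_mono) auto
        then show ?thesis using True by simp
      next
        case False
        then have "x \<notin> cball 0 (real k)" using K by auto
        then show ?thesis using h0[OF False] v(3) False p by (simp add: zero_power)
      qed
    qed
    have "AE x in lebesgue. x \<notin> N"
      using N by (intro AE_not_in) (simp add: negligible_iff_null_sets)
    then have "AE x in lborel. x \<notin> N" by (simp add: AE_completion_iff)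
    then show "AE x in lborel. (\<lambda>n. h n x) \<longlonglongrightarrow> v x"
    proof eventually_elim
      case (elim x)
      have "isCont c (v x)" using cc by (simp add: continuous_on_eq_continuous_at)
      then have "(\<lambda>n. h n x) \<longlonglongrightarrow> cut x *\<^sub>R c (v x)"
        unfolding h_def by (intro tendsto_intros isCont_tendsto_compose[OF _ lim[OF elim]])
      moreover have "cut x *\<^sub>R c (v x) = v x"
      proof (cases "x \<in> cball 0 (real k)")
        case True
        then have "cut x = 1" by (simp add: cut_def K_def)
        moreover have "max K (cmod (v x)) = K" using v(2)[of x] K by simp
        ultimately show ?thesis using K by (simp add: c_def)
      qed (simp add: v(3) c_def)
      ultimately show ?case by simp
    qed
  qed (use v hc in \<open>auto intro: continuous_compact_support_measurable\<close>)
  have "\<forall>\<^sub>F n in sequentially. l2_energy (\<lambda>x. h n x - v x) < e"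
    using conv[of 2] e unfolding l2_energy_def by (intro order_tendstoD) auto
  moreover have "\<forall>\<^sub>F n in sequentially. (\<integral>\<^sup>+x. ennreal (cmod (h n x - v x)) \<partial>lborel) < e"
    using conv[of 1] e by (intro order_tendstoD) auto
  ultimately have "\<forall>\<^sub>F n in sequentially. l2_energy (\<lambda>x. h n x - v x) < e \<and>
      (\<integral>\<^sup>+x. ennreal (cmod (h n x - v x)) \<partial>lborel) < e"
    by (rule eventually_conj)
  then obtain n where n: "l2_energy (\<lambda>x. h n x - v x) < e"
      "(\<integral>\<^sup>+x. ennreal (cmod (h n x - v x)) \<partial>lborel) < e"
    using eventually_happens'[OF sequentially_bot] by blast
  show ?thesis by (rule that[OF hc n])
qed

lemma square_integrable_approx_continuous:
  assumes u: "square_integrable u" and e: "e > 0"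
  obtains g where "continuous_compact_support g" "norm (abs_l2 g - abs_l2 u) < e"
    "integrable lborel u \<longrightarrow> (\<integral>\<^sup>+x. ennreal (cmod (g x - u x)) \<partial>lborel) < ennreal e"
proof -
  \<comment> \<open>Half of \<open>e\<close> goes to each of the two approximations; the square is
    there because an energy is a squared norm.\<close>
  define d where "d = min (ennreal ((e / 2)\<^sup>2)) (ennreal (e / 2))"
  have d: "0 < d" "d \<le> ennreal ((e / 2)\<^sup>2)" "d \<le> ennreal (e / 2)" using e by (auto simp: d_def)
  obtain v and k :: nat where v: "v \<in> borel_measurable borel" "\<And>x. cmod (v x) \<le> real k"
    "\<And>x. x \<notin> cball 0 (real k) \<Longrightarrow> v x = 0" "l2_energy (\<lambda>x. v x - u x) < d"
    "integrable lborel u \<longrightarrow> (\<integral>\<^sup>+x. ennreal (cmod (v x - u x)) \<partial>lborel) < d"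
    by (rule square_integrable_approx_bounded_support[OF u d(1)], rule that)
  obtain g where g: "continuous_compact_support g" "l2_energy (\<lambda>x. g x - v x) < d"
    "(\<integral>\<^sup>+x. ennreal (cmod (g x - v x)) \<partial>lborel) < d"
    by (rule bounded_support_approx_continuous[of v k], rule v(1), rule v(2), erule v(3), rule d(1), rule that)
  have sv: "square_integrable v" by (rule bounded_support_square_integrable) (use v in auto)
  have sg: "square_integrable g" by (rule continuous_compact_support_square_integrable[OF g(1)])
  have less: "norm (abs_l2 a - abs_l2 b) < e / 2"
    if "l2_energy (\<lambda>x. a x - b x) < d" "square_integrable a" "square_integrable b" for a b :: "real ^ 'a \<Rightarrow> complex"
  proof -
    have "ennreal ((norm (abs_l2 a - abs_l2 b))\<^sup>2) < ennreal ((e / 2)\<^sup>2)"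
      using that d(2) by (simp add: norm_abs_l2_squared square_integrable_diff flip: abs_l2_diff)
    then have "(norm (abs_l2 a - abs_l2 b))\<^sup>2 < (e / 2)\<^sup>2" by (simp add: ennreal_less_iff)
    then show ?thesis by (rule power2_less_imp_less) (use e in simp)
  qed
  show ?thesis
  proof (rule that[OF g(1)])
    have "norm (abs_l2 g - abs_l2 u) \<le> norm (abs_l2 g - abs_l2 v) + norm (abs_l2 v - abs_l2 u)"
      using norm_triangle_ineq[of "abs_l2 g - abs_l2 v" "abs_l2 v - abs_l2 u"] by simp
    also have "\<dots> < e" using less[OF g(2) sg sv] less[OF v(4) sv u] by simp
    finally show "norm (abs_l2 g - abs_l2 u) < e" .
    show "integrable lborel u \<longrightarrow> (\<integral>\<^sup>+x. ennreal (cmod (g x - u x)) \<partial>lborel) < ennreal e"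
    proof
      assume i: "integrable lborel u"
      have "(\<integral>\<^sup>+x. ennreal (cmod (g x - u x)) \<partial>lborel)
          \<le> (\<integral>\<^sup>+x. (ennreal (cmod (g x - v x)) + ennreal (cmod (v x - u x))) \<partial>lborel)"
      proof (rule nn_integral_mono)
        fix x
        have "cmod (g x - u x) \<le> cmod (g x - v x) + cmod (v x - u x)"
          using norm_triangle_ineq[of "g x - v x" "v x - u x"] by simp
        then show "ennreal (cmod (g x - u x)) \<le> ennreal (cmod (g x - v x)) + ennreal (cmod (v x - u x))"
          by (simp flip: ennreal_plus)
      qed
      also have "\<dots> = (\<integral>\<^sup>+x. ennreal (cmod (g x - v x)) \<partial>lborel) + (\<integral>\<^sup>+x. ennreal (cmod (v x - u x)) \<partial>lborel)"
        using sg sv u by (intro nn_integral_add) (auto dest!: square_integrableD)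
      also have "\<dots> < ennreal (e / 2) + ennreal (e / 2)"
        using g(3) v(5) i d(3) by (intro add_strict_mono) (auto intro: less_le_trans)
      also have "\<dots> = ennreal e" using e by (simp flip: ennreal_plus)
      finally show "(\<integral>\<^sup>+x. ennreal (cmod (g x - u x)) \<partial>lborel) < ennreal e" .
    qed
  qed
qed

section \<open>Plancherel's theorem and Fourier inversion\<close>

text \<open>The transform as an integral, with a value at every frequency, meaningful for integrable
  \<open>f\<close>. In contrast \<open>fourier\<close> is determined only up to null sets.\<close>

definition fourier_int :: "(real ^ 'n \<Rightarrow> complex) \<Rightarrow> real ^ 'n \<Rightarrow> complex" where
  "fourier_int f \<xi> =
     (2 * pi) powr (- real CARD('n) / 2) *\<^sub>R (LINT x|lborel. cis (- (x \<bullet> \<xi>)) * f x)"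

lemma fourier_trunc_eq_fourier_int:
  "fourier_trunc R u = fourier_int (\<lambda>x. indicator (cball 0 R) x *\<^sub>R u x)"
  unfolding fourier_trunc_def fourier_int_def set_lebesgue_integral_def
  by (simp add: fun_eq_iff)

lemma borel_measurable_cis [measurable]: "cis \<in> borel_measurable borel"
  by (intro borel_measurable_continuous_onI) (auto simp: cis_conv_exp intro!: continuous_intros)

lemma integrable_cis_mult:
  fixes f :: "'a::euclidean_space \<Rightarrow> complex"
  assumes "integrable lborel f"
  shows "integrable lborel (\<lambda>x. cis (- (x \<bullet> \<xi>)) * f x)"
  by (rule Bochner_Integration.integrable_bound[OF assms]) (use assms in \<open>auto simp: norm_mult\<close>)

lemma fourier_int_measurable [measurable]:
  assumes "integrable lborel f"
  shows "fourier_int f \<in> borel_measurable borel"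
proof -
  have [measurable]: "f \<in> borel_measurable borel" using assms by auto
  have "(\<lambda>\<xi>. LINT x|lborel. cis (- (x \<bullet> \<xi>)) * f x) \<in> borel_measurable borel"
    by (rule lborel.borel_measurable_lebesgue_integral) measurable
  then show ?thesis unfolding fourier_int_def by measurable
qed

lemma norm_fourier_int_le:
  fixes f :: "real ^ 'n \<Rightarrow> complex"
  assumes "integrable lborel f"
  shows "cmod (fourier_int f \<xi>) \<le> (2 * pi) powr (- real CARD('n) / 2) * (LINT x|lborel. cmod (f x))"
proof -
  have "cmod (LINT x|lborel. cis (- (x \<bullet> \<xi>)) * f x) \<le> (LINT x|lborel. cmod (cis (- (x \<bullet> \<xi>)) * f x))"
    by (rule integral_norm_bound)
  also have "\<dots> = (LINT x|lborel. cmod (f x))" by (simp add: norm_mult)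
  finally show ?thesis unfolding fourier_int_def by (simp add: mult_left_mono)
qed

lemma fourier_int_diff:
  "integrable lborel f \<Longrightarrow> integrable lborel g \<Longrightarrow>
    fourier_int (\<lambda>x. f x - g x) \<xi> = fourier_int f \<xi> - fourier_int g \<xi>"
  unfolding fourier_int_def
  by (simp add: right_diff_distrib scaleR_diff_right integrable_cis_mult)

lemma fourier_int_cnj: "fourier_int (\<lambda>x. cnj (f x)) \<xi> = cnj (fourier_int f (- \<xi>))"
proof -
  have "(LINT x|lborel. cis (- (x \<bullet> \<xi>)) * cnj (f x)) = (LINT x|lborel. cnj (cis (- (x \<bullet> - \<xi>)) * f x))"
    by (simp add: cis_cnj)
  also have "\<dots> = cnj (LINT x|lborel. cis (- (x \<bullet> - \<xi>)) * f x)" by (rule Bochner_Integration.integral_cnj)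
  finally show ?thesis unfolding fourier_int_def by simp
qed

lemma lborel_integral_affine:
  fixes f :: "'a::euclidean_space \<Rightarrow> 'b::{banach, second_countable_topology}"
  assumes [measurable]: "f \<in> borel_measurable borel" and c: "c \<noteq> 0"
  shows "(LINT x|lborel. f x) = \<bar>c\<bar> ^ DIM('a) *\<^sub>R (LINT x|lborel. f (t + c *\<^sub>R x))"
  by (subst lborel_affine[OF c, of t]) (simp add: integral_density integral_distr)

lemma nn_integral_lborel_affine:
  fixes f :: "'a::euclidean_space \<Rightarrow> ennreal"
  assumes [measurable]: "f \<in> borel_measurable borel" and c: "c \<noteq> 0"
  shows "(\<integral>\<^sup>+x. f x \<partial>lborel) = ennreal (\<bar>c\<bar> ^ DIM('a)) * (\<integral>\<^sup>+x. f (t + c *\<^sub>R x) \<partial>lborel)"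
  by (subst lborel_affine[OF c, of t]) (simp add: nn_integral_density nn_integral_distr nn_integral_cmult)

lemma lborel_integral_uminus:
  fixes f :: "'a::euclidean_space \<Rightarrow> 'b::{banach, second_countable_topology}"
  assumes "f \<in> borel_measurable borel"
  shows "(LINT x|lborel. f (- x)) = (LINT x|lborel. f x)"
  using lborel_integral_affine[OF assms, of "-1" 0] by simp

lemma nn_integral_lborel_uminus:
  fixes f :: "'a::euclidean_space \<Rightarrow> ennreal"
  assumes "f \<in> borel_measurable borel"
  shows "(\<integral>\<^sup>+x. f (- x) \<partial>lborel) = (\<integral>\<^sup>+x. f x \<partial>lborel)"
  using nn_integral_lborel_affine[OF assms, of "-1" 0] by simp

text \<open>Fubini's theorem for a kernel that is symmetric in \<open>x\<close> and \<xi>. Its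
  modulus is |f(x)| |g(\<xi>)|, which is integrable on the product.\<close>

lemma fourier_int_multiplication_formula:
  assumes f: "integrable lborel f" and g: "integrable lborel g"
  shows "(LINT \<xi>|lborel. fourier_int f \<xi> * g \<xi>) = (LINT x|lborel. f x * fourier_int g x)"
proof -
  have [measurable]: "f \<in> borel_measurable borel" "g \<in> borel_measurable borel" using f g by auto
  have "integrable (lborel \<Otimes>\<^sub>M lborel) (\<lambda>(x, \<xi>). cis (- (x \<bullet> \<xi>)) * f x * g \<xi>)"
  proof (rule lborel_pair.Fubini_integrable)
    show "integrable lborel (\<lambda>x. LINT \<xi>|lborel. norm (case (x, \<xi>) of (x, \<xi>) \<Rightarrow> cis (- (x \<bullet> \<xi>)) * f x * g \<xi>))"
      using f by (simp add: norm_mult)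
    show "AE x in lborel. integrable lborel (\<lambda>\<xi>. case (x, \<xi>) of (x, \<xi>) \<Rightarrow> cis (- (x \<bullet> \<xi>)) * f x * g \<xi>)"
    proof (intro AE_I2)
      fix x
      have "integrable lborel (\<lambda>\<xi>. f x * (cis (- (\<xi> \<bullet> x)) * g \<xi>))"
        by (intro integrable_mult_right integrable_cis_mult g)
      then show "integrable lborel (\<lambda>\<xi>. case (x, \<xi>) of (x, \<xi>) \<Rightarrow> cis (- (x \<bullet> \<xi>)) * f x * g \<xi>)"
        by (simp add: inner_commute mult_ac)
    qed
  qed measurable
  then have fub: "(LINT \<xi>|lborel. LINT x|lborel. cis (- (x \<bullet> \<xi>)) * f x * g \<xi>) =
      (LINT x|lborel. LINT \<xi>|lborel. cis (- (x \<bullet> \<xi>)) * f x * g \<xi>)"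
    by (rule lborel_pair.Fubini_integral)
  have l: "(LINT x|lborel. cis (- (x \<bullet> \<xi>)) * f x * g \<xi>) = (LINT x|lborel. cis (- (x \<bullet> \<xi>)) * f x) * g \<xi>" for \<xi>
    by simp
  have r: "(LINT \<xi>|lborel. cis (- (x \<bullet> \<xi>)) * f x * g \<xi>) = f x * (LINT \<xi>|lborel. cis (- (\<xi> \<bullet> x)) * g \<xi>)" for x
  proof -
    have "(LINT \<xi>|lborel. cis (- (x \<bullet> \<xi>)) * f x * g \<xi>) = (LINT \<xi>|lborel. f x * (cis (- (\<xi> \<bullet> x)) * g \<xi>))"
      by (simp add: inner_commute mult_ac)
    then show ?thesis by simp
  qed
  show ?thesis
    unfolding fourier_int_def using fub unfolding l r by simp
qed

text \<open>Lebesgue measure is the image of a product of one-dimensional ones. This serves twice: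
  for the Gaussian, and for the integrability of the Sobolev weight.\<close>

lemma lborel_integral_prod_Basis:
  fixes f :: "'a::euclidean_space \<Rightarrow> real \<Rightarrow> 'b::{real_normed_field, banach, second_countable_topology}"
  assumes f: "\<And>b. b \<in> Basis \<Longrightarrow> integrable lborel (f b)"
  shows "(LINT x|lborel. (\<Prod>b\<in>Basis. f b (x \<bullet> b))) = (\<Prod>b\<in>Basis. LINT t|lborel. f b t)"
    and "integrable lborel (\<lambda>x. \<Prod>b\<in>Basis. f b (x \<bullet> b))"
proof -
  interpret product_sigma_finite "\<lambda>b :: 'a. lborel :: real measure" ..
  have T [measurable]: "(\<lambda>g. \<Sum>b\<in>Basis. g b *\<^sub>R b) \<in> (\<Pi>\<^sub>M b\<in>(Basis :: 'a set). lborel) \<rightarrow>\<^sub>M borel"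
    by measurable
  have m: "(\<lambda>x. \<Prod>b\<in>Basis. f b (x \<bullet> b)) \<in> borel_measurable borel"
  proof (rule borel_measurable_prod)
    fix b :: 'a assume b: "b \<in> Basis"
    have "(\<lambda>x. x \<bullet> b) \<in> borel_measurable borel" by measurable
    moreover have "f b \<in> borel_measurable borel" using f[OF b] by auto
    ultimately show "(\<lambda>x. f b (x \<bullet> b)) \<in> borel_measurable borel" by (rule measurable_compose)
  qed
  have e: "(\<Prod>b\<in>Basis. f b ((\<Sum>c\<in>Basis. g c *\<^sub>R c) \<bullet> b)) = (\<Prod>b\<in>Basis. f b (g b))" for g
    by (intro prod.cong) auto
  have "(LINT x|lborel. (\<Prod>b\<in>Basis. f b (x \<bullet> b))) =
      (LINT g|(\<Pi>\<^sub>M b\<in>(Basis :: 'a set). lborel). (\<Prod>b\<in>Basis. f b (g b)))"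
    by (subst lborel_eq, subst integral_distr[OF T m]) (simp add: e)
  also have "\<dots> = (\<Prod>b\<in>Basis. LINT t|lborel. f b t)"
    by (rule product_integral_prod) (use f in auto)
  finally show "(LINT x|lborel. (\<Prod>b\<in>Basis. f b (x \<bullet> b))) = (\<Prod>b\<in>Basis. LINT t|lborel. f b t)" .
  have "integrable (\<Pi>\<^sub>M b\<in>(Basis :: 'a set). lborel) (\<lambda>g. \<Prod>b\<in>Basis. f b (g b))"
    by (rule product_integrable_prod) (use f in auto)
  then show "integrable lborel (\<lambda>x. \<Prod>b\<in>Basis. f b (x \<bullet> b))"
    by (subst lborel_eq, subst integrable_distr_eq[OF T m]) (simp add: e)
qed

section \<open>Gaussians and the regularized Plancherel identity\<close>

lemma norm_squared_eq_sum_Basis: "(norm x)\<^sup>2 = (\<Sum>b\<in>Basis. (x \<bullet> b)\<^sup>2)" for x :: "'a::euclidean_space"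
  unfolding power2_norm_eq_inner by (subst euclidean_inner) (simp add: power2_eq_square)

lemma prod_exp_Basis:
  "(\<Prod>b\<in>Basis. exp (- (x \<bullet> b)\<^sup>2 / 2)) = exp (- (norm x)\<^sup>2 / 2)" for x :: "'a::euclidean_space"
proof -
  have "(\<Prod>b\<in>Basis. exp (- (x \<bullet> b)\<^sup>2 / 2)) = exp (\<Sum>b\<in>Basis. - (x \<bullet> b)\<^sup>2 / 2)"
    by (rule exp_sum[OF finite_Basis, symmetric])
  also have "(\<Sum>b\<in>Basis. - (x \<bullet> b)\<^sup>2 / 2) = - (norm x)\<^sup>2 / 2"
    by (simp only: norm_squared_eq_sum_Basis sum_divide_distrib[symmetric] sum_negf)
  finally show ?thesis .
qed

text \<open>The density of the standard normal law on R^N. As a product of one-dimensional densities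
  it inherits its transform from the characteristic function of the normal distribution.\<close>

definition gauss :: "real ^ 'n \<Rightarrow> real" where
  "gauss x = (2 * pi) powr (- real CARD('n) / 2) * exp (- (norm x)\<^sup>2 / 2)"

lemma gauss_nonneg: "gauss x \<ge> 0"
  by (simp add: gauss_def)

lemma gauss_measurable [measurable]: "gauss \<in> borel_measurable borel"
  unfolding gauss_def by measurable

lemma gauss_eq_prod: "gauss x = (\<Prod>b\<in>Basis. std_normal_density (x \<bullet> b))" for x :: "real ^ 'n"
proof -
  have "(\<Prod>b\<in>Basis. std_normal_density (x \<bullet> b)) =
      (\<Prod>b\<in>(Basis :: (real ^ 'n) set). 1 / sqrt (2 * pi)) * (\<Prod>b\<in>Basis. exp (- (x \<bullet> b)\<^sup>2 / 2))"
    by (simp only: std_normal_density_def prod.distrib)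
  also have "\<dots> = (1 / sqrt (2 * pi)) ^ CARD('n) * exp (- (norm x)\<^sup>2 / 2)"
    by (simp only: prod_constant DIM_cart DIM_real mult_1_right prod_exp_Basis)
  finally have p: "(\<Prod>b\<in>Basis. std_normal_density (x \<bullet> b)) = (1 / sqrt (2 * pi)) ^ CARD('n) * exp (- (norm x)\<^sup>2 / 2)" .
  have "1 / sqrt (2 * pi) = (2 * pi) powr - (1 / 2)"
    unfolding powr_minus by (subst powr_half_sqrt) (auto simp: divide_inverse)
  then have "(1 / sqrt (2 * pi)) ^ CARD('n) = ((2 * pi) powr - (1 / 2)) powr real CARD('n)"
    by (simp only: powr_realpow powr_gt_zero pi_neq_zero) (simp add: powr_realpow)
  also have "\<dots> = (2 * pi) powr (- real CARD('n) / 2)" by (simp add: powr_powr)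
  finally show ?thesis unfolding p gauss_def by (simp only:)
qed

lemma integral_cis_std_normal_density:
  "(LINT t|lborel. cis (- (t * s)) * complex_of_real (std_normal_density t)) = complex_of_real (exp (- s\<^sup>2 / 2))"
proof -
  have "char std_normal_distribution (- s) = (LINT t|lborel. std_normal_density t *\<^sub>R iexp (- s * t))"
    unfolding char_def by (subst integral_density) (auto simp: normal_density_nonneg)
  also have "\<dots> = (LINT t|lborel. cis (- (t * s)) * complex_of_real (std_normal_density t))"
    by (intro Bochner_Integration.integral_cong) (auto simp: cis_conv_exp scaleR_conv_of_real mult_ac)
  finally show ?thesis by (simp add: char_std_normal_distribution)
qed

lemma integrable_cis_std_normal_density:
  "integrable lborel (\<lambda>t. cis (- (t * s)) * complex_of_real (std_normal_density t))"
proof -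
  have "integrable lborel (\<lambda>t. complex_of_real (std_normal_density t))" by simp
  then show ?thesis using integrable_cis_mult[of "\<lambda>t. complex_of_real (std_normal_density t)" s] by simp
qed

lemma cis_inner_gauss_eq_prod:
  "cis (- (x \<bullet> \<xi>)) * complex_of_real (gauss x) =
    (\<Prod>b\<in>Basis. cis (- ((x \<bullet> b) * (\<xi> \<bullet> b))) * complex_of_real (std_normal_density (x \<bullet> b)))"
proof -
  have "cis (- (x \<bullet> \<xi>)) = (\<Prod>b\<in>Basis. cis (- ((x \<bullet> b) * (\<xi> \<bullet> b))))"
    unfolding cis_conv_exp exp_sum[OF finite_Basis, symmetric]
    by (subst euclidean_inner) (simp add: sum_distrib_left sum_negf)
  then show ?thesis by (simp add: gauss_eq_prod prod.distrib)
qed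

lemma integrable_gauss: "integrable lborel gauss"
  unfolding gauss_eq_prod[abs_def] by (intro lborel_integral_prod_Basis(2)) simp

lemma integral_cis_gauss:
  "(LINT x|lborel. cis (- (x \<bullet> \<xi>)) * complex_of_real (gauss x)) = complex_of_real (exp (- (norm \<xi>)\<^sup>2 / 2))"
proof -
  have "(LINT x|lborel. cis (- (x \<bullet> \<xi>)) * complex_of_real (gauss x)) =
      (\<Prod>b\<in>Basis. LINT t|lborel. cis (- (t * (\<xi> \<bullet> b))) * complex_of_real (std_normal_density t))"
    unfolding cis_inner_gauss_eq_prod
    by (rule lborel_integral_prod_Basis(1)) (rule integrable_cis_std_normal_density)
  also have "\<dots> = complex_of_real (\<Prod>b\<in>Basis. exp (- (\<xi> \<bullet> b)\<^sup>2 / 2))"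
    by (simp only: integral_cis_std_normal_density of_real_prod)
  finally show ?thesis unfolding prod_exp_Basis .
qed

lemma integral_gauss: "(LINT x|lborel. gauss (x :: real ^ 'n)) = 1"
proof -
  have "complex_of_real (LINT x|lborel. gauss (x :: real ^ 'n)) = (LINT x|lborel. complex_of_real (gauss (x :: real ^ 'n)))"
    by (rule Bochner_Integration.integral_complex_of_real[symmetric])
  also have "\<dots> = 1" using integral_cis_gauss[where \<xi> = "0 :: real ^ 'n"] by simp
  finally show ?thesis unfolding of_real_eq_1_iff .
qed

lemma borel_measurable_cnj [measurable]: "cnj \<in> borel_measurable borel"
  by (intro borel_measurable_continuous_onI continuous_intros)

text \<open>A wide Gaussian has a narrow transform. The additional factor (2 pi)^{-N/2} in front is
  exactly what makes the right side a probability density of width \<epsilon>, that is, an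
  approximate identity.\<close>

lemma integral_cis_gauss_scaled:
  fixes w :: "real ^ 'n"
  assumes e: "\<epsilon> > 0"
  shows "(2 * pi) powr (- real CARD('n) / 2) *\<^sub>R
      fourier_int (\<lambda>\<xi>. complex_of_real (exp (- (norm (\<epsilon> *\<^sub>R \<xi>))\<^sup>2 / 2))) w =
    complex_of_real (gauss ((1 / \<epsilon>) *\<^sub>R w) / \<epsilon> ^ CARD('n))"
proof -
  define c where "c = (2 * pi) powr (- real CARD('n) / 2)"
  have c: "c > 0" by (simp add: c_def)
  let ?F = "\<lambda>\<xi> :: real ^ 'n. cis (- (\<xi> \<bullet> ((1 / \<epsilon>) *\<^sub>R w))) * complex_of_real (gauss \<xi>)"
  have g: "complex_of_real (gauss (\<epsilon> *\<^sub>R \<xi>)) = c *\<^sub>R complex_of_real (exp (- (norm (\<epsilon> *\<^sub>R \<xi>))\<^sup>2 / 2))" for \<xi> :: "real ^ 'n"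
    by (simp add: gauss_def c_def scaleR_conv_of_real)
  have i: "\<epsilon> *\<^sub>R \<xi> \<bullet> ((1 / \<epsilon>) *\<^sub>R w) = \<xi> \<bullet> w" for \<xi>
    using e by simp
  have "complex_of_real (exp (- (norm ((1 / \<epsilon>) *\<^sub>R w))\<^sup>2 / 2)) = (LINT \<xi>|lborel. ?F \<xi>)"
    by (rule integral_cis_gauss[symmetric])
  also have "\<dots> = \<bar>\<epsilon>\<bar> ^ DIM(real ^ 'n) *\<^sub>R (LINT \<xi>|lborel. ?F (0 + \<epsilon> *\<^sub>R \<xi>))"
    by (rule lborel_integral_affine, measurable) (use e in simp)
  also have "(LINT \<xi>|lborel. ?F (0 + \<epsilon> *\<^sub>R \<xi>)) =
      (LINT \<xi>|lborel. c *\<^sub>R (cis (- (\<xi> \<bullet> w)) * complex_of_real (exp (- (norm (\<epsilon> *\<^sub>R \<xi>))\<^sup>2 / 2))))"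
    by (simp only: g add_0 i mult_scaleR_right)
  also have "\<dots> = fourier_int (\<lambda>\<xi>. complex_of_real (exp (- (norm (\<epsilon> *\<^sub>R \<xi>))\<^sup>2 / 2))) w"
    unfolding fourier_int_def c_def by simp
  finally have "complex_of_real (exp (- (norm ((1 / \<epsilon>) *\<^sub>R w))\<^sup>2 / 2)) =
      \<epsilon> ^ CARD('n) *\<^sub>R fourier_int (\<lambda>\<xi>. complex_of_real (exp (- (norm (\<epsilon> *\<^sub>R \<xi>))\<^sup>2 / 2))) w"
    using e by (simp only: DIM_cart DIM_real mult_1_right abs_of_pos)
  then have eq: "fourier_int (\<lambda>\<xi>. complex_of_real (exp (- (norm (\<epsilon> *\<^sub>R \<xi>))\<^sup>2 / 2))) w =
      complex_of_real (exp (- (norm ((1 / \<epsilon>) *\<^sub>R w))\<^sup>2 / 2) / \<epsilon> ^ CARD('n))"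
    using e by (simp add: scaleR_conv_of_real)
  show ?thesis
    unfolding eq by (simp add: gauss_def c_def scaleR_conv_of_real)
qed

lemma integrable_exp_norm_scaled:
  assumes e: "\<epsilon> > 0"
  shows "integrable lborel (\<lambda>\<xi> :: real ^ 'n. exp (- (norm (\<epsilon> *\<^sub>R \<xi>))\<^sup>2 / 2))"
proof -
  define c where "c = (2 * pi) powr (- real CARD('n) / 2)"
  have c: "c > 0" by (simp add: c_def)
  have gc: "gauss x = c * exp (- (norm x)\<^sup>2 / 2)" for x :: "real ^ 'n"
    by (simp only: gauss_def c_def)
  have "integrable (density (distr lborel borel (\<lambda>x. 0 + \<epsilon> *\<^sub>R x)) (\<lambda>_. ennreal (\<bar>\<epsilon>\<bar> ^ DIM(real ^ 'n)))) (gauss :: real ^ 'n \<Rightarrow> real)"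
    using e integrable_gauss[where 'a = 'n] by (subst lborel_affine[symmetric]) auto
  then have "integrable lborel (\<lambda>\<xi> :: real ^ 'n. \<bar>\<epsilon>\<bar> ^ DIM(real ^ 'n) *\<^sub>R gauss (\<epsilon> *\<^sub>R \<xi>))"
    by (simp add: integrable_density integrable_distr_eq)
  then have "integrable lborel (\<lambda>\<xi> :: real ^ 'n. (1 / (\<epsilon> ^ CARD('n) * c)) * (\<bar>\<epsilon>\<bar> ^ DIM(real ^ 'n) *\<^sub>R gauss (\<epsilon> *\<^sub>R \<xi>)))"
    by (rule integrable_mult_right)
  also have "(\<lambda>\<xi> :: real ^ 'n. (1 / (\<epsilon> ^ CARD('n) * c)) * (\<bar>\<epsilon>\<bar> ^ DIM(real ^ 'n) *\<^sub>R gauss (\<epsilon> *\<^sub>R \<xi>))) =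
      (\<lambda>\<xi>. exp (- (norm (\<epsilon> *\<^sub>R \<xi>))\<^sup>2 / 2))"
    using e c by (simp add: fun_eq_iff gc)
  finally show ?thesis .
qed

text \<open>Inserting a Gaussian makes the Plancherel integral absolutely convergent; two applications of
  the multiplication formula move it into a mollifier on the other side.\<close>

lemma plancherel_regularized:
  fixes f :: "real ^ 'n \<Rightarrow> complex"
  assumes f: "integrable lborel f" and e: "\<epsilon> > 0"
  shows "(LINT \<xi>|lborel. fourier_int f \<xi> * (cnj (fourier_int f \<xi>) * complex_of_real (exp (- (norm (\<epsilon> *\<^sub>R \<xi>))\<^sup>2 / 2)))) =
    (LINT x|lborel. f x * (LINT z|lborel. cnj (f (x + \<epsilon> *\<^sub>R z)) * complex_of_real (gauss z)))"
    and "integrable lborel (\<lambda>\<xi>. (cmod (fourier_int f \<xi>))\<^sup>2 * exp (- (norm (\<epsilon> *\<^sub>R \<xi>))\<^sup>2 / 2))"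
proof -
  define c where "c = (2 * pi) powr (- real CARD('n) / 2)"
  define B where "B = c * (LINT x|lborel. cmod (f x))"
  define h where "h \<xi> = complex_of_real (exp (- (norm (\<epsilon> *\<^sub>R \<xi>))\<^sup>2 / 2))" for \<xi> :: "real ^ 'n"
  have [measurable]: "f \<in> borel_measurable borel" using f by auto
  have [measurable]: "fourier_int f \<in> borel_measurable borel" by (rule fourier_int_measurable[OF f])
  have [measurable]: "h \<in> borel_measurable borel" unfolding h_def by measurable
  have B: "cmod (fourier_int f \<xi>) \<le> B" for \<xi> unfolding B_def c_def by (rule norm_fourier_int_le[OF f])
  have ih: "integrable lborel h"
    unfolding h_def by (rule integrable_of_real) (rule integrable_exp_norm_scaled[OF e])
  have i1: "integrable lborel (\<lambda>\<xi>. cnj (fourier_int f \<xi>) * h \<xi>)"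
  proof (rule Bochner_Integration.integrable_bound)
    show "integrable lborel (\<lambda>\<xi>. B *\<^sub>R h \<xi>)" using ih by simp
    show "AE \<xi> in lborel. norm (cnj (fourier_int f \<xi>) * h \<xi>) \<le> norm (B *\<^sub>R h \<xi>)"
      using B by (intro AE_I2) (auto simp: norm_mult intro!: mult_right_mono order_trans[OF _ abs_ge_self])
  qed measurable
  show "integrable lborel (\<lambda>\<xi>. (cmod (fourier_int f \<xi>))\<^sup>2 * exp (- (norm (\<epsilon> *\<^sub>R \<xi>))\<^sup>2 / 2))"
  proof (rule Bochner_Integration.integrable_bound)
    show "integrable lborel (\<lambda>\<xi> :: real ^ 'n. B\<^sup>2 * exp (- (norm (\<epsilon> *\<^sub>R \<xi>))\<^sup>2 / 2))"
      by (intro integrable_mult_right integrable_exp_norm_scaled[OF e])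
    show "AE \<xi> in lborel. norm ((cmod (fourier_int f \<xi>))\<^sup>2 * exp (- (norm (\<epsilon> *\<^sub>R \<xi>))\<^sup>2 / 2))
        \<le> norm (B\<^sup>2 * exp (- (norm (\<epsilon> *\<^sub>R \<xi>))\<^sup>2 / 2))"
      using B by (intro AE_I2) (simp add: abs_mult power_mono)
  qed measurable
  \<comment> \<open>For fixed \<open>x\<close>, the Gaussian times the character e^{i \<xi> x} has
    as its transform the narrow kernel centred at \<open>x\<close>. The multiplication formula for
    \<open>cnj f\<close> therefore gives an average of \<open>cnj f\<close> around \<open>x\<close>,
    and substituting y = x + \<epsilon> z normalizes the kernel to \<open>gauss z\<close>.\<close>
  have inner: "fourier_int (\<lambda>\<xi>. cnj (fourier_int f \<xi>) * h \<xi>) x =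
      (LINT z|lborel. cnj (f (x + \<epsilon> *\<^sub>R z)) * complex_of_real (gauss z))" for x
  proof -
    define \<psi> where "\<psi> \<xi> = cis (\<xi> \<bullet> x) * h \<xi>" for \<xi>
    have i\<psi>: "integrable lborel \<psi>"
      using integrable_cis_mult[OF ih, of "- x"] by (simp add: \<psi>_def[abs_def])
    have F\<psi>: "c *\<^sub>R fourier_int \<psi> y = complex_of_real (gauss ((1 / \<epsilon>) *\<^sub>R (y - x)) / \<epsilon> ^ CARD('n))" for y
    proof -
      have "cis (- (\<xi> \<bullet> y)) * \<psi> \<xi> = cis (- (\<xi> \<bullet> (y - x))) * h \<xi>" for \<xi>
        by (simp add: \<psi>_def inner_diff_right cis_mult mult.assoc[symmetric])
      then have "fourier_int \<psi> y = fourier_int h (y - x)" by (simp only: fourier_int_def)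
      then show ?thesis
        unfolding c_def h_def[abs_def] using integral_cis_gauss_scaled[OF e, of "y - x"] by (simp only:)
    qed
    have icf: "integrable lborel (\<lambda>x. cnj (f x))" using f by simp
    have "fourier_int (\<lambda>\<xi>. cnj (fourier_int f \<xi>) * h \<xi>) x =
        c *\<^sub>R (LINT \<xi>|lborel. cis (- (\<xi> \<bullet> x)) * (cnj (fourier_int f \<xi>) * h \<xi>))"
      by (simp only: fourier_int_def c_def)
    also have "(LINT \<xi>|lborel. cis (- (\<xi> \<bullet> x)) * (cnj (fourier_int f \<xi>) * h \<xi>)) =
        (LINT \<xi>|lborel. fourier_int (\<lambda>x. cnj (f x)) (- \<xi>) * \<psi> (- \<xi>))"
      by (intro Bochner_Integration.integral_cong refl) (simp add: fourier_int_cnj \<psi>_def h_def)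
    also have "\<dots> = (LINT \<xi>|lborel. fourier_int (\<lambda>x. cnj (f x)) \<xi> * \<psi> \<xi>)"
      using fourier_int_measurable[OF icf] i\<psi>
      by (intro lborel_integral_uminus[where f = "\<lambda>\<xi>. fourier_int (\<lambda>x. cnj (f x)) \<xi> * \<psi> \<xi>"]) auto
    also have "\<dots> = (LINT y|lborel. cnj (f y) * fourier_int \<psi> y)"
      by (rule fourier_int_multiplication_formula[OF icf i\<psi>])
    also have "c *\<^sub>R (LINT y|lborel. cnj (f y) * fourier_int \<psi> y) = (LINT y|lborel. cnj (f y) * (c *\<^sub>R fourier_int \<psi> y))"
      by simp
    also have "\<dots> = (LINT y|lborel. cnj (f y) * complex_of_real (gauss ((1 / \<epsilon>) *\<^sub>R (y - x)) / \<epsilon> ^ CARD('n)))"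
      by (simp only: F\<psi>)
    also have "\<dots> = \<bar>\<epsilon>\<bar> ^ DIM(real ^ 'n) *\<^sub>R (LINT z|lborel. cnj (f (x + \<epsilon> *\<^sub>R z)) *
        complex_of_real (gauss ((1 / \<epsilon>) *\<^sub>R ((x + \<epsilon> *\<^sub>R z) - x)) / \<epsilon> ^ CARD('n)))"
      by (rule lborel_integral_affine, measurable) (use e in simp)
    also have "\<dots> = (LINT z|lborel. \<bar>\<epsilon>\<bar> ^ DIM(real ^ 'n) *\<^sub>R (cnj (f (x + \<epsilon> *\<^sub>R z)) *
        complex_of_real (gauss ((1 / \<epsilon>) *\<^sub>R ((x + \<epsilon> *\<^sub>R z) - x)) / \<epsilon> ^ CARD('n))))"
      by (rule integral_scaleR_right[symmetric])
    also have "\<dots> = (LINT z|lborel. cnj (f (x + \<epsilon> *\<^sub>R z)) * complex_of_real (gauss z))"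
      using e by (intro Bochner_Integration.integral_cong refl) (simp add: scaleR_conv_of_real[where 'a = complex])
    finally show ?thesis .
  qed
  show "(LINT \<xi>|lborel. fourier_int f \<xi> * (cnj (fourier_int f \<xi>) * complex_of_real (exp (- (norm (\<epsilon> *\<^sub>R \<xi>))\<^sup>2 / 2)))) =
    (LINT x|lborel. f x * (LINT z|lborel. cnj (f (x + \<epsilon> *\<^sub>R z)) * complex_of_real (gauss z)))"
    using fourier_int_multiplication_formula[OF f i1] unfolding inner unfolding h_def .
qed

text \<open>Let the width tend to 0 in the regularized identity. On the physical side the averages
  of \<open>cnj f\<close> converge by continuity, bounded by the supremum of \<open>f\<close>, so
  dominated convergence applies.\<close>

lemma plancherel_continuous:
  fixes f :: "real ^ 'n \<Rightarrow> complex"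
  assumes f: "continuous_compact_support f"
  shows "l2_energy (fourier_int f) = l2_energy f"
proof -
  have int: "integrable lborel f" by (rule continuous_compact_support_integrable[OF f])
  have sq: "square_integrable f" by (rule continuous_compact_support_square_integrable[OF f])
  have [measurable]: "f \<in> borel_measurable borel" by (rule continuous_compact_support_measurable[OF f])
  have [measurable]: "fourier_int f \<in> borel_measurable borel" by (rule fourier_int_measurable[OF int])
  obtain B r where B: "B > 0" "\<And>x. cmod (f x) \<le> B" "\<And>x. x \<notin> cball 0 r \<Longrightarrow> f x = 0"
    by (rule continuous_compact_support_bounded[OF f], rule that)
  define e where "e k = inverse (real (Suc k))" for k
  have e: "e k > 0" for k by (simp add: e_def)
  have e0: "e \<longlonglongrightarrow> 0" unfolding e_def[abs_def] by (rule LIMSEQ_inverse_real_of_nat)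
  define w where "w k \<xi> = (cmod (fourier_int f \<xi>))\<^sup>2 * exp (- (norm (e k *\<^sub>R \<xi>))\<^sup>2 / 2)" for k \<xi>
  define G where "G k x = (LINT z|lborel. cnj (f (x + e k *\<^sub>R z)) * complex_of_real (gauss z))" for k x
  have [measurable]: "G k \<in> borel_measurable borel" for k
    unfolding G_def[abs_def] by (rule lborel.borel_measurable_lebesgue_integral) measurable
  have iBg: "integrable lborel (\<lambda>z :: real ^ 'n. B * gauss z)" by (intro integrable_mult_right integrable_gauss)
  have bnd: "cmod (cnj (f y) * complex_of_real (gauss z)) \<le> B * gauss z" for y and z :: "real ^ 'n"
    using B(2)[of y] gauss_nonneg[of z] by (simp add: norm_mult mult_right_mono)
  have GB: "cmod (G k x) \<le> B" for k x
  proof -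
    have "cmod (G k x) \<le> (LINT z|lborel. B * gauss (z :: real ^ 'n))"
      unfolding G_def
    proof (rule Bochner_Integration.integral_norm_bound_integral)
      show "integrable lborel (\<lambda>z. cnj (f (x + e k *\<^sub>R z)) * complex_of_real (gauss z))"
        by (rule Bochner_Integration.integrable_bound[OF iBg], measurable)
           (intro AE_I2 order_trans[OF bnd], simp)
    qed (use iBg bnd in auto)
    then show ?thesis by (simp add: integral_gauss)
  qed
  have Glim: "(\<lambda>k. G k x) \<longlonglongrightarrow> cnj (f x)" for x
  proof -
    have "(\<lambda>k. G k x) \<longlonglongrightarrow> (LINT z|lborel. cnj (f x) * complex_of_real (gauss (z :: real ^ 'n)))"
      unfolding G_def
    proof (rule integral_dominated_convergence[OF _ _ iBg])
      show "AE z in lborel. (\<lambda>k. cnj (f (x + e k *\<^sub>R z)) * complex_of_real (gauss z)) \<longlonglongrightarrow> cnj (f x) * complex_of_real (gauss z)"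
      proof (intro AE_I2 tendsto_intros)
        fix z
        have "isCont f x" using f by (auto simp: continuous_compact_support_def continuous_on_eq_continuous_at)
        moreover have "(\<lambda>k. x + e k *\<^sub>R z) \<longlonglongrightarrow> x"
          using tendsto_add[OF tendsto_const tendsto_scaleR[OF e0 tendsto_const], of x z] by simp
        ultimately show "(\<lambda>k. f (x + e k *\<^sub>R z)) \<longlonglongrightarrow> f x" by (rule isCont_tendsto_compose)
      qed
    qed (measurable, intro AE_I2 bnd)
    moreover have "(LINT z|lborel. cnj (f x) * complex_of_real (gauss (z :: real ^ 'n))) = cnj (f x)"
      by (simp add: integral_gauss)
    ultimately show ?thesis by (simp only:)
  qed
  have wG: "(LINT x|lborel. f x * G k x) = complex_of_real (LINT \<xi>|lborel. w k \<xi>)" for k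
  proof -
    have "(LINT x|lborel. f x * G k x) = (LINT \<xi>|lborel. fourier_int f \<xi> * (cnj (fourier_int f \<xi>) *
        complex_of_real (exp (- (norm (e k *\<^sub>R \<xi>))\<^sup>2 / 2))))"
      unfolding G_def by (rule plancherel_regularized(1)[OF int e, symmetric])
    also have "\<dots> = (LINT \<xi>|lborel. complex_of_real (w k \<xi>))"
      unfolding w_def of_real_mult complex_norm_square mult.assoc ..
    finally show ?thesis by simp
  qed
  have "(\<lambda>k. LINT x|lborel. f x * G k x) \<longlonglongrightarrow> (LINT x|lborel. f x * cnj (f x))"
  proof (rule integral_dominated_convergence[where w = "\<lambda>x. B * cmod (f x)"])
    show "integrable lborel (\<lambda>x. B * cmod (f x))" using int by simp
    show "AE x in lborel. (\<lambda>k. f x * G k x) \<longlonglongrightarrow> f x * cnj (f x)"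
      by (intro AE_I2 tendsto_intros Glim)
    show "AE x in lborel. norm (f x * G k x) \<le> B * cmod (f x)" for k
      using GB[of k] by (intro AE_I2) (simp add: norm_mult mult.commute[of B] mult_left_mono)
  qed measurable
  moreover have "(LINT x|lborel. f x * cnj (f x)) = complex_of_real (LINT x|lborel. (cmod (f x))\<^sup>2)"
    unfolding complex_norm_square[symmetric] by (rule Bochner_Integration.integral_complex_of_real)
  ultimately have "(\<lambda>k. complex_of_real (LINT \<xi>|lborel. w k \<xi>)) \<longlonglongrightarrow> complex_of_real (LINT x|lborel. (cmod (f x))\<^sup>2)"
    by (simp only: wG)
  then have "(\<lambda>k. LINT \<xi>|lborel. w k \<xi>) \<longlonglongrightarrow> (LINT x|lborel. (cmod (f x))\<^sup>2)"
    by (simp only: tendsto_of_real_iff)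
  then have "(\<lambda>k. ennreal (LINT \<xi>|lborel. w k \<xi>)) \<longlonglongrightarrow> ennreal (LINT x|lborel. (cmod (f x))\<^sup>2)"
    by (rule tendsto_ennrealI)
  moreover have "ennreal (LINT x|lborel. (cmod (f x))\<^sup>2) = l2_energy f"
    using sq by (simp add: l2_energy_eq_integral)
  moreover have "ennreal (LINT \<xi>|lborel. w k \<xi>) = (\<integral>\<^sup>+\<xi>. ennreal (w k \<xi>) \<partial>lborel)" for k
    unfolding w_def by (rule nn_integral_eq_integral[symmetric, OF plancherel_regularized(2)[OF int e]]) auto
  ultimately have 1: "(\<lambda>k. \<integral>\<^sup>+\<xi>. ennreal (w k \<xi>) \<partial>lborel) \<longlonglongrightarrow> l2_energy f"
    by (simp only:)
  \<comment> \<open>On the frequency side nothing is known yet about square integrability of the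
    transform, so no dominating function is at hand. The Gaussian factors increase to 1 as
    \<open>e k\<close> decreases, and monotone convergence does without one.\<close>
  have 2: "(\<lambda>k. \<integral>\<^sup>+\<xi>. ennreal (w k \<xi>) \<partial>lborel) \<longlonglongrightarrow> l2_energy (fourier_int f)"
    unfolding l2_energy_def
  proof (rule nn_integral_LIMSEQ)
    show "incseq (\<lambda>k \<xi>. ennreal (w k \<xi>))"
    proof (intro incseq_SucI le_funI ennreal_leI)
      fix k and \<xi> :: "real ^ 'n"
      have "e (Suc k) \<le> e k" by (simp add: e_def field_simps)
      then have "norm (e (Suc k) *\<^sub>R \<xi>) \<le> norm (e k *\<^sub>R \<xi>)"
        using e[of k] e[of "Suc k"] by (simp add: mult_right_mono)
      then have "(norm (e (Suc k) *\<^sub>R \<xi>))\<^sup>2 \<le> (norm (e k *\<^sub>R \<xi>))\<^sup>2" by (intro power_mono) auto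
      then have "exp (- (norm (e k *\<^sub>R \<xi>))\<^sup>2 / 2) \<le> exp (- (norm (e (Suc k) *\<^sub>R \<xi>))\<^sup>2 / 2)" by simp
      then show "w k \<xi> \<le> w (Suc k) \<xi>"
        unfolding w_def by (rule mult_left_mono) simp
    qed
    show "(\<lambda>\<xi>. ennreal (w k \<xi>)) \<in> borel_measurable lborel" for k unfolding w_def by measurable
    fix \<xi> :: "real ^ 'n"
    have "(\<lambda>k. w k \<xi>) \<longlonglongrightarrow> (cmod (fourier_int f \<xi>))\<^sup>2 * exp (- (norm (0 *\<^sub>R \<xi>))\<^sup>2 / 2)"
      unfolding w_def by (intro tendsto_intros e0) auto
    then have "(\<lambda>k. w k \<xi>) \<longlonglongrightarrow> (cmod (fourier_int f \<xi>))\<^sup>2" by simp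
    then show "(\<lambda>k. ennreal (w k \<xi>)) \<longlonglongrightarrow> ennreal ((cmod (fourier_int f \<xi>))\<^sup>2)"
      by (rule tendsto_ennrealI)
  qed
  show ?thesis by (rule LIMSEQ_unique[OF 2 1])
qed

lemma LIMSEQ_norm_diff_le:
  fixes X :: "nat \<Rightarrow> 'a::real_normed_vector"
  assumes "\<And>k. norm (X k - L) \<le> e k" and e: "e \<longlonglongrightarrow> 0"
  shows "X \<longlonglongrightarrow> L"
proof -
  have "(\<lambda>k. X k - L) \<longlonglongrightarrow> 0"
    by (rule Lim_null_comparison[OF _ e]) (simp add: assms(1))
  then show ?thesis by (rule LIM_zero_cancel)
qed

lemma continuous_compact_support_diff:
  assumes "continuous_compact_support f" "continuous_compact_support g"
  shows "continuous_compact_support (\<lambda>x. f x - g x)"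
proof -
  obtain r s where rs: "\<And>x. x \<notin> cball 0 r \<Longrightarrow> f x = 0" "\<And>x. x \<notin> cball 0 s \<Longrightarrow> g x = 0"
    using assms unfolding continuous_compact_support_def by blast
  have "f x - g x = 0" if "x \<notin> cball 0 (max r s)" for x
    using rs[of x] that by simp
  then show ?thesis
    using assms unfolding continuous_compact_support_def by (blast intro: continuous_on_diff)
qed

lemma fourier_int_isometry_continuous:
  assumes f: "continuous_compact_support f"
  shows "square_integrable (fourier_int f)" and "norm (abs_l2 (fourier_int f)) = norm (abs_l2 f)"
proof -
  have sq: "square_integrable f" by (rule continuous_compact_support_square_integrable[OF f])
  have int: "integrable lborel f" by (rule continuous_compact_support_integrable[OF f])
  show s: "square_integrable (fourier_int f)"
    using sq fourier_int_measurable[OF int] by (simp add: square_integrable_iff_l2_energy plancherel_continuous[OF f])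
  show "norm (abs_l2 (fourier_int f)) = norm (abs_l2 f)"
    by (simp add: norm_abs_l2 s sq plancherel_continuous[OF f])
qed

text \<open>The limit in L^2 of the transforms of \<open>g k\<close> has to be recognized as the
  integral \<open>fourier_int f\<close>. The same \<open>g k\<close> converge in L^1, so their
  transforms converge at every frequency, and Fatou's lemma converts the mutual distances into
  distances to that pointwise limit.\<close>

lemma fourier_int_isometry:
  fixes f :: "real ^ 'n \<Rightarrow> complex"
  assumes f: "integrable lborel f" and sf: "square_integrable f"
  shows "square_integrable (fourier_int f)" and "norm (abs_l2 (fourier_int f)) = norm (abs_l2 f)"
proof -
  define c where "c = (2 * pi) powr (- real CARD('n) / 2)"
  define e where "e k = inverse (real (Suc k))" for k
  have e: "e k > 0" for k by (simp add: e_def)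
  have e0: "e \<longlonglongrightarrow> 0" unfolding e_def[abs_def] by (rule LIMSEQ_inverse_real_of_nat)
  have edec: "e m \<le> e k" if "k \<le> m" for m k using that by (simp add: e_def field_simps)
  have "\<exists>g. continuous_compact_support g \<and> norm (abs_l2 g - abs_l2 f) < e k \<and>
      (\<integral>\<^sup>+x. ennreal (cmod (g x - f x)) \<partial>lborel) < ennreal (e k)" for k
    by (rule square_integrable_approx_continuous[OF sf e[of k]]) (use f in blast)
  then obtain g where g: "\<And>k. continuous_compact_support (g k)"
    and g2: "\<And>k. norm (abs_l2 (g k) - abs_l2 f) < e k"
    and g1: "\<And>k. (\<integral>\<^sup>+x. ennreal (cmod (g k x - f x)) \<partial>lborel) < ennreal (e k)"
    by metis
  have ig: "integrable lborel (g k)" for k by (rule continuous_compact_support_integrable[OF g])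
  have sg: "square_integrable (g k)" for k by (rule continuous_compact_support_square_integrable[OF g])
  have Fg: "square_integrable (fourier_int (g k))" for k by (rule fourier_int_isometry_continuous(1)[OF g])
  have pointwise: "(\<lambda>k. fourier_int (g k) \<xi>) \<longlonglongrightarrow> fourier_int f \<xi>" for \<xi>
  proof (rule LIMSEQ_norm_diff_le)
    show "norm (fourier_int (g k) \<xi> - fourier_int f \<xi>) \<le> c * e k" for k
    proof -
      have "ennreal (LINT x|lborel. cmod (g k x - f x)) = (\<integral>\<^sup>+x. ennreal (cmod (g k x - f x)) \<partial>lborel)"
        using ig[of k] f by (intro nn_integral_eq_integral[symmetric]) auto
      then have "ennreal (LINT x|lborel. cmod (g k x - f x)) \<le> ennreal (e k)"
        using g1[of k] by (simp add: less_imp_le)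
      then have "(LINT x|lborel. cmod (g k x - f x)) \<le> e k" using e[of k] by (simp add: ennreal_le_iff)
      moreover have "norm (fourier_int (g k) \<xi> - fourier_int f \<xi>) \<le> c * (LINT x|lborel. cmod (g k x - f x))"
        unfolding c_def fourier_int_diff[OF ig f, symmetric]
        using ig[of k] f by (intro norm_fourier_int_le) auto
      ultimately show "norm (fourier_int (g k) \<xi> - fourier_int f \<xi>) \<le> c * e k"
        by (smt (verit) c_def mult_left_mono powr_ge_zero)
    qed
    show "(\<lambda>k. c * e k) \<longlonglongrightarrow> 0" using tendsto_mult[OF tendsto_const e0, of c] by simp
  qed
  have bound: "l2_energy (\<lambda>\<xi>. fourier_int f \<xi> - fourier_int (g k) \<xi>) \<le> ennreal ((2 * e k)\<^sup>2)" for k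
  proof (rule l2_energy_fatou)
    show "fourier_int (g n) \<in> borel_measurable borel" for n by (rule fourier_int_measurable[OF ig])
    then show "fourier_int (g k) \<in> borel_measurable borel" .
    show "AE \<xi> in lborel. (\<lambda>n. fourier_int (g n) \<xi>) \<longlonglongrightarrow> fourier_int f \<xi>" by (simp add: pointwise)
    show "\<forall>\<^sub>F m in sequentially. l2_energy (\<lambda>\<xi>. fourier_int (g m) \<xi> - fourier_int (g k) \<xi>) \<le> ennreal ((2 * e k)\<^sup>2)"
    proof (rule eventually_sequentiallyI[of k])
      fix m assume m: "k \<le> m"
      have "l2_energy (\<lambda>\<xi>. fourier_int (g m) \<xi> - fourier_int (g k) \<xi>) = l2_energy (fourier_int (\<lambda>x. g m x - g k x))"
        by (simp add: fourier_int_diff[OF ig ig, abs_def])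
      also have "\<dots> = ennreal ((norm (abs_l2 (g m) - abs_l2 (g k)))\<^sup>2)"
        by (simp add: plancherel_continuous continuous_compact_support_diff g norm_abs_l2_squared square_integrable_diff sg
            flip: abs_l2_diff)
      also have "\<dots> \<le> ennreal ((2 * e k)\<^sup>2)"
      proof (intro ennreal_leI power_mono norm_ge_zero)
        have "norm (abs_l2 (g m) - abs_l2 (g k)) \<le> norm (abs_l2 (g m) - abs_l2 f) + norm (abs_l2 (g k) - abs_l2 f)"
          using norm_triangle_ineq4[of "abs_l2 (g m) - abs_l2 f" "abs_l2 (g k) - abs_l2 f"] by simp
        then show "norm (abs_l2 (g m) - abs_l2 (g k)) \<le> 2 * e k"
          using g2[of m] g2[of k] edec[OF m] by linarith
      qed
      finally show "l2_energy (\<lambda>\<xi>. fourier_int (g m) \<xi> - fourier_int (g k) \<xi>) \<le> ennreal ((2 * e k)\<^sup>2)" .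
    qed
  qed
  have "square_integrable (\<lambda>\<xi>. fourier_int f \<xi> - fourier_int (g 0) \<xi>)"
    unfolding square_integrable_iff_l2_energy
    using bound[of 0] fourier_int_measurable[OF f] fourier_int_measurable[OF ig[of 0]]
    by (auto intro: le_less_trans)
  then show sF: "square_integrable (fourier_int f)"
    using square_integrable_add[OF _ Fg[of 0], of "\<lambda>\<xi>. fourier_int f \<xi> - fourier_int (g 0) \<xi>"] by simp
  have "norm (abs_l2 (fourier_int (g k)) - abs_l2 (fourier_int f)) \<le> 2 * e k" for k
  proof -
    have "norm (abs_l2 (\<lambda>\<xi>. fourier_int f \<xi> - fourier_int (g k) \<xi>)) \<le> 2 * e k"
      using bound[of k] e[of k] by (intro norm_abs_l2_le square_integrable_diff sF Fg) auto
    then show ?thesis by (simp add: abs_l2_diff sF Fg norm_minus_commute)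
  qed
  moreover have "(\<lambda>k. 2 * e k) \<longlonglongrightarrow> 0" using tendsto_mult[OF tendsto_const e0, of 2] by simp
  ultimately have "(\<lambda>k. abs_l2 (fourier_int (g k))) \<longlonglongrightarrow> abs_l2 (fourier_int f)"
    by (rule LIMSEQ_norm_diff_le)
  then have "(\<lambda>k. norm (abs_l2 (g k))) \<longlonglongrightarrow> norm (abs_l2 (fourier_int f))"
    unfolding fourier_int_isometry_continuous(2)[OF g, symmetric] by (rule tendsto_norm)
  moreover have "(\<lambda>k. abs_l2 (g k)) \<longlonglongrightarrow> abs_l2 f"
    by (rule LIMSEQ_norm_diff_le[OF less_imp_le[OF g2] e0])
  then have "(\<lambda>k. norm (abs_l2 (g k))) \<longlonglongrightarrow> norm (abs_l2 f)" by (rule tendsto_norm)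
  ultimately show "norm (abs_l2 (fourier_int f)) = norm (abs_l2 f)" by (rule LIMSEQ_unique)
qed

section \<open>The Fourier transform on all of L^2\<close>

definition truncation :: "real \<Rightarrow> (real ^ 'n \<Rightarrow> complex) \<Rightarrow> real ^ 'n \<Rightarrow> complex" where
  "truncation R u x = indicator (cball 0 R) x *\<^sub>R u x"

lemma fourier_trunc_eq: "fourier_trunc R u = fourier_int (truncation R u)"
  by (simp add: fourier_trunc_eq_fourier_int truncation_def[abs_def])

lemma square_integrable_truncation:
  assumes "square_integrable u" shows "square_integrable (truncation R u)"
proof -
  have "square_integrable (\<lambda>x. complex_of_real (indicator (cball 0 R) x) * u x)"
    by (rule square_integrable_mult_bounded[OF assms, where B = 1]) (auto simp: indicator_def)
  then show ?thesis by (simp add: truncation_def[abs_def] scaleR_conv_of_real)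
qed

lemma integrable_truncation:
  assumes "square_integrable u" shows "integrable lborel (truncation R u)"
proof (rule Bochner_Integration.integrable_bound)
  have m: "truncation R u \<in> borel_measurable borel"
    by (rule square_integrableD[OF square_integrable_truncation[OF assms]])
  then show "truncation R u \<in> borel_measurable lborel" by simp
  show "integrable lborel (\<lambda>x :: real ^ 'a. indicator (cball 0 R) x + (cmod (u x))\<^sup>2)"
    using assms emeasure_bounded_finite[of "cball 0 R :: (real ^ 'a) set"]
    by (intro Bochner_Integration.integrable_add integrable_real_indicator) (auto simp: square_integrable_def)
  show "AE x in lborel. norm (truncation R u x) \<le> norm (indicator (cball 0 R) x + (cmod (u x))\<^sup>2)"
  proof (intro AE_I2)
    fix x
    have "cmod (u x) \<le> 1 + (cmod (u x))\<^sup>2"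
      using sum_squares_bound[of "cmod (u x)" 1] norm_ge_zero[of "u x"]
      unfolding power_one mult_1_right by linarith
    then show "norm (truncation R u x) \<le> norm (indicator (cball 0 R) x + (cmod (u x))\<^sup>2)"
      by (cases "x \<in> cball 0 R") (auto simp: truncation_def)
  qed
qed

lemma tendsto_truncation:
  assumes u: "square_integrable u"
  shows "((\<lambda>R. abs_l2 (truncation R u)) \<longlongrightarrow> abs_l2 u) at_top"
proof (subst tendsto_abs_l2_iff[OF square_integrable_truncation[OF u] u], rule tendsto_at_topI_sequentially)
  fix X :: "nat \<Rightarrow> real" assume X: "filterlim X at_top sequentially"
  show "(\<lambda>n. l2_energy (\<lambda>x. truncation (X n) u x - u x)) \<longlonglongrightarrow> 0"
    unfolding l2_energy_def
  proof (rule nn_integral_power_dominated_convergence[where w = "\<lambda>x. (cmod (u x))\<^sup>2"])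
    show "truncation (X n) u \<in> borel_measurable lborel" for n
      using square_integrableD[OF square_integrable_truncation[OF u]] by simp
    show "(\<integral>\<^sup>+x. ennreal ((cmod (u x))\<^sup>2) \<partial>lborel) < \<infinity>"
      using u by (simp add: square_integrable_iff_l2_energy l2_energy_def)
    show "AE x in lborel. (cmod (truncation (X n) u x - u x))\<^sup>2 \<le> (cmod (u x))\<^sup>2" for n
      by (intro AE_I2) (simp add: truncation_def indicator_def)
    show "AE x in lborel. (\<lambda>n. truncation (X n) u x) \<longlonglongrightarrow> u x"
    proof (intro AE_I2 tendsto_eventually)
      fix x :: "real ^ 'a"
      have "\<forall>\<^sub>F n in sequentially. norm x \<le> X n" using X by (simp add: filterlim_at_top)
      then show "\<forall>\<^sub>F n in sequentially. truncation (X n) u x = u x"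
        by eventually_elim (simp add: truncation_def)
    qed
  qed (use u in \<open>auto dest: square_integrableD\<close>)
qed

lemma fourier_int_truncation:
  assumes "square_integrable u"
  shows "square_integrable (fourier_trunc R u)"
    and "norm (abs_l2 (fourier_trunc R u) - abs_l2 (fourier_trunc S u)) = norm (abs_l2 (truncation R u) - abs_l2 (truncation S u))"
proof -
  note i = integrable_truncation[OF assms] and s = square_integrable_truncation[OF assms]
  show sF: "square_integrable (fourier_trunc R u)" for R
    unfolding fourier_trunc_eq by (rule fourier_int_isometry(1)[OF i s])
  have "abs_l2 (fourier_trunc R u) - abs_l2 (fourier_trunc S u) = abs_l2 (fourier_int (\<lambda>x. truncation R u x - truncation S u x))"
    unfolding abs_l2_diff[OF sF sF, symmetric] unfolding fourier_trunc_eq fourier_int_diff[OF i i] ..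
  also have "norm \<dots> = norm (abs_l2 (\<lambda>x. truncation R u x - truncation S u x))"
    by (intro fourier_int_isometry(2) Bochner_Integration.integrable_diff square_integrable_diff i s)
  finally show "norm (abs_l2 (fourier_trunc R u) - abs_l2 (fourier_trunc S u)) = norm (abs_l2 (truncation R u) - abs_l2 (truncation S u))"
    by (simp add: abs_l2_diff s)
qed

text \<open>Transforms of truncations have the same mutual distances as the truncations themselves,
  and those converge to \<open>u\<close>.\<close>

lemma fourier_limit_exists:
  assumes u: "square_integrable u"
  shows "\<exists>V. ((\<lambda>R. abs_l2 (fourier_trunc R u)) \<longlongrightarrow> V) at_top"
proof -
  define a where "a R = abs_l2 (truncation R u)" for R
  define b where "b R = abs_l2 (fourier_trunc R u)" for R
  have ab: "norm (b R - b S) = norm (a R - a S)" for R S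
    unfolding a_def b_def by (rule fourier_int_truncation(2)[OF u])
  have a: "(a \<longlongrightarrow> abs_l2 u) at_top" unfolding a_def[abs_def] by (rule tendsto_truncation[OF u])
  have an: "(\<lambda>n. a (real n)) \<longlonglongrightarrow> abs_l2 u"
    by (rule filterlim_compose[OF a filterlim_real_sequentially])
  then have "Cauchy (\<lambda>n. a (real n))" by (rule LIMSEQ_imp_Cauchy)
  then have "Cauchy (\<lambda>n. b (real n))" unfolding Cauchy_def dist_norm ab .
  then obtain V where V: "(\<lambda>n. b (real n)) \<longlonglongrightarrow> V" by (auto simp: Cauchy_convergent_iff convergent_def)
  \<comment> \<open>Completeness was used along integer radii only. Letting the second radius tend
    to infinity transfers the equality of distances to the limit, which gives convergence along all
    real \<open>R\<close>.\<close>
  have "norm (b R - V) = norm (a R - abs_l2 u)" for R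
  proof (rule LIMSEQ_unique)
    show "(\<lambda>n. norm (b R - b (real n))) \<longlonglongrightarrow> norm (b R - V)" by (intro tendsto_intros V)
    show "(\<lambda>n. norm (b R - b (real n))) \<longlonglongrightarrow> norm (a R - abs_l2 u)"
      unfolding ab by (intro tendsto_intros an)
  qed
  moreover have "((\<lambda>R. norm (a R - abs_l2 u)) \<longlongrightarrow> 0) at_top"
    using a by (simp add: LIM_zero_iff tendsto_norm_zero_iff)
  ultimately have "((\<lambda>R. norm (b R - V)) \<longlongrightarrow> 0) at_top" by (simp only:)
  then have "(b \<longlongrightarrow> V) at_top" by (simp only: tendsto_norm_zero_iff LIM_zero_iff)
  then show ?thesis unfolding b_def[abs_def] by blast
qed

text \<open>This justifies the \<open>SOME\<close> in \<open>fourier\<close>: its defining property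
  is convergence of classes, and any representative of the limit class is a witness.\<close>

lemma fourier_square_integrable_tendsto:
  assumes u: "square_integrable u"
  shows "square_integrable (fourier u)"
    and "((\<lambda>R. abs_l2 (fourier_trunc R u)) \<longlongrightarrow> abs_l2 (fourier u)) at_top"
proof -
  let ?P = "\<lambda>v. square_integrable v \<and>
     ((\<lambda>R. \<integral>\<^sup>+\<xi>. ennreal ((cmod (v \<xi> - fourier_trunc R u \<xi>))\<^sup>2) \<partial>lborel) \<longlongrightarrow> 0) at_top"
  have iff: "?P v \<longleftrightarrow> square_integrable v \<and> ((\<lambda>R. abs_l2 (fourier_trunc R u)) \<longlongrightarrow> abs_l2 v) at_top" for v
    using tendsto_abs_l2_iff[of "\<lambda>R. fourier_trunc R u" v at_top, OF fourier_int_truncation(1)[OF u]]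
    by (auto simp: l2_energy_def norm_minus_commute)
  obtain V where "((\<lambda>R. abs_l2 (fourier_trunc R u)) \<longlongrightarrow> V) at_top"
    using fourier_limit_exists[OF u] by blast
  then have "?P (rep_l2 V)" unfolding iff by simp
  then have "?P (fourier u)" unfolding fourier_def by (rule someI[where P = ?P])
  then show "square_integrable (fourier u)" "((\<lambda>R. abs_l2 (fourier_trunc R u)) \<longlongrightarrow> abs_l2 (fourier u)) at_top"
    unfolding iff by blast+
qed

text \<open>Through this uniqueness of limits, each rule for \<open>fourier\<close> is inherited
  from the same rule for the truncated integrals.\<close>

lemma abs_fourier_eqI:
  assumes "square_integrable u" "((\<lambda>R. abs_l2 (fourier_trunc R u)) \<longlongrightarrow> y) at_top"
  shows "abs_l2 (fourier u) = y"
  by (rule tendsto_unique[OF _ fourier_square_integrable_tendsto(2)[OF assms(1)] assms(2)]) simp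

text \<open>The equality is literal and not just almost everywhere. Truncated transforms are
  integrals, hence agree at every frequency, and \<open>SOME\<close> is then applied to the same
  predicate.\<close>

lemma fourier_cong_AE:
  assumes "square_integrable u" "square_integrable v" "AE x in lborel. u x = v x"
  shows "fourier u = fourier v"
proof -
  have [measurable]: "truncation R u \<in> borel_measurable borel" "truncation R v \<in> borel_measurable borel" for R
    using assms by (auto intro: square_integrableD square_integrable_truncation)
  have "fourier_trunc R u = fourier_trunc R v" for R
    unfolding fourier_trunc_eq fourier_int_def
  proof (intro ext arg_cong[where f = "scaleR _"] integral_cong_AE)
    fix \<xi>
    show "AE x in lborel. cis (- (x \<bullet> \<xi>)) * truncation R u x = cis (- (x \<bullet> \<xi>)) * truncation R v x"
      using assms(3) by eventually_elim (simp add: truncation_def)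
  qed measurable
  then show ?thesis unfolding fourier_def by simp
qed

lemma fourier_trunc_add:
  assumes "square_integrable u" "square_integrable v"
  shows "fourier_trunc R (\<lambda>x. u x + v x) \<xi> = fourier_trunc R u \<xi> + fourier_trunc R v \<xi>"
proof -
  have "truncation R (\<lambda>x. u x + v x) = (\<lambda>x. truncation R u x + truncation R v x)"
    by (simp add: fun_eq_iff truncation_def scaleR_add_right)
  then show ?thesis
    using integrable_truncation[OF assms(1), of R] integrable_truncation[OF assms(2), of R]
    by (simp add: fourier_trunc_eq fourier_int_def integrable_cis_mult distrib_left scaleR_add_right)
qed

lemma fourier_trunc_cmult: "fourier_trunc R (\<lambda>x. c * u x) \<xi> = c * fourier_trunc R u \<xi>"
proof -
  have "(\<lambda>x. cis (- (x \<bullet> \<xi>)) * truncation R (\<lambda>x. c * u x) x) = (\<lambda>x. c * (cis (- (x \<bullet> \<xi>)) * truncation R u x))"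
    by (simp add: fun_eq_iff truncation_def mult_ac)
  then show ?thesis by (simp add: fourier_trunc_eq fourier_int_def)
qed

definition fourier_l2 :: "'n::finite l2 \<Rightarrow> 'n l2" where
  "fourier_l2 x = abs_l2 (fourier (rep_l2 x))"

definition reflect_l2 :: "'n::finite l2 \<Rightarrow> 'n l2" where
  "reflect_l2 x = abs_l2 (\<lambda>t. rep_l2 x (- t))"

text \<open>One operator for complex scalars, the free group and the multipliers of (1 -
  Delta)^{-1}. It is meaningful for bounded measurable \<open>m\<close>, where the product stays
  square-integrable.\<close>

definition mult_l2 :: "(real ^ 'n \<Rightarrow> complex) \<Rightarrow> 'n l2 \<Rightarrow> 'n l2" where
  "mult_l2 m x = abs_l2 (\<lambda>\<xi>. m \<xi> * rep_l2 x \<xi>)"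

lemma fourier_l2_abs:
  assumes u: "square_integrable u"
  shows "fourier_l2 (abs_l2 u) = abs_l2 (fourier u)"
  unfolding fourier_l2_def fourier_cong_AE[OF square_integrable_rep_l2 u rep_abs_l2[OF u]] ..

lemma norm_fourier_l2: "norm (fourier_l2 x) = norm x"
proof -
  let ?u = "rep_l2 x"
  have "((\<lambda>R. norm (abs_l2 (fourier_trunc R ?u))) \<longlongrightarrow> norm (fourier_l2 x)) at_top"
    unfolding fourier_l2_def by (intro tendsto_norm fourier_square_integrable_tendsto) simp
  moreover have "norm (abs_l2 (fourier_trunc R ?u)) = norm (abs_l2 (truncation R ?u))" for R
    unfolding fourier_trunc_eq by (intro fourier_int_isometry integrable_truncation square_integrable_truncation) auto
  moreover have "((\<lambda>R. norm (abs_l2 (truncation R ?u))) \<longlongrightarrow> norm (abs_l2 ?u)) at_top"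
    by (intro tendsto_norm tendsto_truncation) simp
  ultimately show ?thesis using tendsto_unique[OF trivial_limit_at_top_linorder] by (simp only: abs_rep_l2) blast
qed

lemma abs_fourier_add:
  assumes u: "square_integrable u" and v: "square_integrable v"
  shows "abs_l2 (fourier (\<lambda>x. u x + v x)) = abs_l2 (fourier u) + abs_l2 (fourier v)"
proof (rule abs_fourier_eqI)
  have eq: "abs_l2 (fourier_trunc R (\<lambda>x. u x + v x)) = abs_l2 (fourier_trunc R u) + abs_l2 (fourier_trunc R v)" for R
    unfolding abs_l2_add[OF fourier_int_truncation(1)[OF u] fourier_int_truncation(1)[OF v], symmetric]
      fourier_trunc_add[OF u v, symmetric] ..
  show "((\<lambda>R. abs_l2 (fourier_trunc R (\<lambda>x. u x + v x))) \<longlongrightarrow> abs_l2 (fourier u) + abs_l2 (fourier v)) at_top"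
    unfolding eq by (intro tendsto_add fourier_square_integrable_tendsto u v)
qed (rule square_integrable_add[OF u v])

lemma mult_l2_abs:
  assumes m: "m \<in> borel_measurable borel" "\<And>\<xi>. cmod (m \<xi>) \<le> B" and u: "square_integrable u"
  shows "mult_l2 m (abs_l2 u) = abs_l2 (\<lambda>\<xi>. m \<xi> * u \<xi>)"
  unfolding mult_l2_def
proof (rule abs_l2_eqI)
  show "square_integrable (\<lambda>\<xi>. m \<xi> * u \<xi>)" by (rule square_integrable_mult_bounded[OF u m])
  show "AE \<xi> in lborel. m \<xi> * rep_l2 (abs_l2 u) \<xi> = m \<xi> * u \<xi>"
    using rep_abs_l2[OF u] by eventually_elim simp
qed (use m(1) in measurable)

lemma norm_mult_l2_le:
  assumes m: "m \<in> borel_measurable borel" "\<And>\<xi>. cmod (m \<xi>) \<le> B"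
  shows "norm (mult_l2 m x) \<le> B * norm x"
proof -
  have B: "B \<ge> 0" using order_trans[OF norm_ge_zero m(2)] .
  have "l2_energy (\<lambda>\<xi>. m \<xi> * rep_l2 x \<xi>) \<le> l2_energy (\<lambda>\<xi>. of_real B * rep_l2 x \<xi>)"
    by (intro l2_energy_mono_AE AE_I2) (use m(2) B in \<open>auto simp: norm_mult intro!: mult_right_mono\<close>)
  also have "\<dots> = ennreal (B\<^sup>2) * ennreal ((norm x)\<^sup>2)"
    by (simp add: l2_energy_cmult norm_l2_squared)
  also have "\<dots> = ennreal ((B * norm x)\<^sup>2)"
    by (simp add: power_mult_distrib ennreal_mult)
  finally show ?thesis
    unfolding mult_l2_def using B
    by (intro norm_abs_l2_le square_integrable_mult_bounded[OF _ m]) auto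
qed

lemma bounded_linear_mult_l2:
  assumes m: "m \<in> borel_measurable borel" "\<And>\<xi>. cmod (m \<xi>) \<le> B"
  shows "bounded_linear (mult_l2 m)"
proof
  have s: "square_integrable (\<lambda>\<xi>. m \<xi> * rep_l2 x \<xi>)" for x
    by (rule square_integrable_mult_bounded[OF _ m]) simp
  show "mult_l2 m (x + y) = mult_l2 m x + mult_l2 m y" for x y
  proof -
    have "mult_l2 m (abs_l2 (\<lambda>\<xi>. rep_l2 x \<xi> + rep_l2 y \<xi>)) = abs_l2 (\<lambda>\<xi>. m \<xi> * rep_l2 x \<xi> + m \<xi> * rep_l2 y \<xi>)"
      by (subst mult_l2_abs[OF m]) (auto intro: square_integrable_add simp: distrib_left)
    then show ?thesis by (simp add: abs_l2_add s mult_l2_def[symmetric])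
  qed
  show "mult_l2 m (r *\<^sub>R x) = r *\<^sub>R mult_l2 m x" for r x
  proof -
    have "mult_l2 m (abs_l2 (\<lambda>\<xi>. r *\<^sub>R rep_l2 x \<xi>)) = abs_l2 (\<lambda>\<xi>. r *\<^sub>R (m \<xi> * rep_l2 x \<xi>))"
      by (subst mult_l2_abs[OF m]) (auto intro: square_integrable_scaleR)
    then show ?thesis by (simp add: abs_l2_scaleR s mult_l2_def[symmetric])
  qed
  show "\<exists>K. \<forall>x. norm (mult_l2 m x) \<le> norm x * K"
    using norm_mult_l2_le[OF m] by (metis mult.commute)
qed

lemma abs_fourier_cmult:
  assumes u: "square_integrable u"
  shows "abs_l2 (fourier (\<lambda>x. c * u x)) = mult_l2 (\<lambda>_. c) (abs_l2 (fourier u))"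
proof (rule abs_fourier_eqI)
  have bl: "bounded_linear (mult_l2 (\<lambda>_. c))" by (rule bounded_linear_mult_l2[where B = "cmod c"]) auto
  have eq: "abs_l2 (fourier_trunc R (\<lambda>x. c * u x)) = mult_l2 (\<lambda>_. c) (abs_l2 (fourier_trunc R u))" for R
    using mult_l2_abs[OF _ _ fourier_int_truncation(1)[OF u], of "\<lambda>_. c" "cmod c"]
    by (simp add: fourier_trunc_cmult[abs_def])
  show "((\<lambda>R. abs_l2 (fourier_trunc R (\<lambda>x. c * u x))) \<longlongrightarrow> mult_l2 (\<lambda>_. c) (abs_l2 (fourier u))) at_top"
    unfolding eq by (intro bounded_linear.tendsto[OF bl] fourier_square_integrable_tendsto u)
qed (rule square_integrable_cmult[OF u])

lemma bounded_linear_fourier_l2: "bounded_linear (fourier_l2 :: 'n::finite l2 \<Rightarrow> 'n l2)"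
proof
  fix x y :: "'n l2" and r :: real
  have "fourier_l2 (abs_l2 (\<lambda>t. rep_l2 x t + rep_l2 y t)) = fourier_l2 x + fourier_l2 y"
    by (subst fourier_l2_abs) (auto simp: square_integrable_add abs_fourier_add fourier_l2_def)
  then show "fourier_l2 (x + y) = fourier_l2 x + fourier_l2 y" by (simp add: abs_l2_add)
  have "fourier_l2 (abs_l2 (\<lambda>t. r *\<^sub>R rep_l2 x t)) = mult_l2 (\<lambda>_. of_real r) (fourier_l2 x)"
    by (subst fourier_l2_abs)
       (auto simp: square_integrable_cmult scaleR_conv_of_real[where 'a = complex] abs_fourier_cmult fourier_l2_def)
  moreover have "mult_l2 (\<lambda>_. of_real r) y = r *\<^sub>R y" for y :: "'n l2"
    unfolding mult_l2_def by (simp add: abs_l2_scaleR flip: scaleR_conv_of_real)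
  ultimately show "fourier_l2 (r *\<^sub>R x) = r *\<^sub>R fourier_l2 x" by (simp add: abs_l2_scaleR)
next
  show "\<exists>K. \<forall>x. norm (fourier_l2 x) \<le> norm x * K"
    by (intro exI[of _ 1]) (simp add: norm_fourier_l2)
qed

text \<open>On the intersection of L^1 and L^2 the limit definition and the integral agree: the
  isometry applied to the difference of \<open>u\<close> and its truncation controls the
  error.\<close>

lemma abs_fourier_integrable:
  assumes u: "square_integrable u" and i: "integrable lborel u"
  shows "abs_l2 (fourier u) = abs_l2 (fourier_int u)"
proof (rule abs_fourier_eqI[OF u])
  note sF = fourier_int_isometry(1)[OF i u]
  have "norm (abs_l2 (fourier_trunc R u) - abs_l2 (fourier_int u)) = norm (abs_l2 (truncation R u) - abs_l2 u)" for R
  proof -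
    note t = integrable_truncation[OF u, of R] square_integrable_truncation[OF u, of R]
    have "abs_l2 (fourier_trunc R u) - abs_l2 (fourier_int u) = abs_l2 (fourier_int (\<lambda>x. truncation R u x - u x))"
      unfolding abs_l2_diff[OF fourier_int_truncation(1)[OF u] sF, symmetric] unfolding fourier_trunc_eq fourier_int_diff[OF t(1) i] ..
    also have "norm \<dots> = norm (abs_l2 (\<lambda>x. truncation R u x - u x))"
      by (intro fourier_int_isometry(2) Bochner_Integration.integrable_diff square_integrable_diff i u t)
    finally show ?thesis by (simp add: abs_l2_diff t u)
  qed
  moreover have "((\<lambda>R. norm (abs_l2 (truncation R u) - abs_l2 u)) \<longlongrightarrow> 0) at_top"
    using tendsto_truncation[OF u] by (simp only: tendsto_norm_zero_iff LIM_zero_iff)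
  ultimately have "((\<lambda>R. norm (abs_l2 (fourier_trunc R u) - abs_l2 (fourier_int u))) \<longlongrightarrow> 0) at_top"
    by (simp only:)
  then show "((\<lambda>R. abs_l2 (fourier_trunc R u)) \<longlongrightarrow> abs_l2 (fourier_int u)) at_top"
    by (simp only: tendsto_norm_zero_iff LIM_zero_iff)
qed

section \<open>Reflection and Fourier inversion\<close>

lemma AE_lborel_uminus:
  fixes P :: "'a::euclidean_space \<Rightarrow> bool"
  assumes [measurable]: "Measurable.pred borel P" and AE: "AE x in lborel. P x"
  shows "AE x in lborel. P (- x)"
proof -
  have "(\<integral>\<^sup>+x. (if P x then 0 else 1 :: ennreal) \<partial>lborel) = 0"
    using AE by (subst nn_integral_0_iff_AE) auto
  moreover have "(\<integral>\<^sup>+x. (if P (- x) then 0 else 1 :: ennreal) \<partial>lborel) = (\<integral>\<^sup>+x. (if P x then 0 else 1) \<partial>lborel)"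
    by (rule nn_integral_lborel_uminus) measurable
  ultimately have "(\<integral>\<^sup>+x. (if P (- x) then 0 else 1 :: ennreal) \<partial>lborel) = 0" by simp
  then have "AE x in lborel. (if P (- x) then 0 else 1 :: ennreal) = 0"
    by (subst (asm) nn_integral_0_iff_AE) auto
  then show ?thesis by eventually_elim (simp split: if_splits)
qed

lemma l2_energy_reflect: "u \<in> borel_measurable borel \<Longrightarrow> l2_energy (\<lambda>x. u (- x)) = l2_energy u"
  unfolding l2_energy_def by (rule nn_integral_lborel_uminus) measurable

lemma square_integrable_reflect: "square_integrable u \<Longrightarrow> square_integrable (\<lambda>x. u (- x))"
  by (auto simp: square_integrable_iff_l2_energy l2_energy_reflect)

lemma reflect_l2_abs:
  assumes u: "square_integrable u"
  shows "reflect_l2 (abs_l2 u) = abs_l2 (\<lambda>x. u (- x))"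
  unfolding reflect_l2_def
proof (rule abs_l2_eqI[OF square_integrable_reflect[OF u]])
  have [measurable]: "u \<in> borel_measurable borel" by (rule square_integrableD[OF u])
  show "AE x in lborel. rep_l2 (abs_l2 u) (- x) = u (- x)"
    by (rule AE_lborel_uminus[OF _ rep_abs_l2[OF u]]) measurable
  show "(\<lambda>t. rep_l2 (abs_l2 u) (- t)) \<in> borel_measurable borel" by measurable
qed

lemma norm_reflect_l2: "norm (reflect_l2 x) = norm x"
proof -
  have "norm (reflect_l2 x) = sqrt (enn2real (l2_energy (rep_l2 x)))"
    unfolding reflect_l2_def by (subst norm_abs_l2) (auto intro: square_integrable_reflect simp: l2_energy_reflect)
  then show ?thesis using norm_abs_l2[of "rep_l2 x"] by simp
qed

lemma bounded_linear_reflect_l2: "bounded_linear (reflect_l2 :: 'n::finite l2 \<Rightarrow> 'n l2)"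
proof
  fix x y :: "'n l2" and r :: real
  have "reflect_l2 (abs_l2 (\<lambda>t. rep_l2 x t + rep_l2 y t)) = reflect_l2 x + reflect_l2 y"
    by (subst reflect_l2_abs) (auto simp: square_integrable_add square_integrable_reflect abs_l2_add reflect_l2_def)
  then show "reflect_l2 (x + y) = reflect_l2 x + reflect_l2 y" by (simp add: abs_l2_add)
  have "reflect_l2 (abs_l2 (\<lambda>t. r *\<^sub>R rep_l2 x t)) = r *\<^sub>R reflect_l2 x"
    by (subst reflect_l2_abs) (auto simp: square_integrable_scaleR square_integrable_reflect abs_l2_scaleR reflect_l2_def)
  then show "reflect_l2 (r *\<^sub>R x) = r *\<^sub>R reflect_l2 x" by (simp add: abs_l2_scaleR)
next
  show "\<exists>K. \<forall>x. norm (reflect_l2 x) \<le> norm x * K"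
    by (intro exI[of _ 1]) (simp add: norm_reflect_l2)
qed

text \<open>An identity between continuous expressions need only be checked where all the integrals
  converge absolutely.\<close>

lemma l2_dense_induct:
  assumes "closed {x. P x}" "\<And>g. continuous_compact_support g \<Longrightarrow> P (abs_l2 g)"
  shows "P x"
proof -
  have "x \<in> closure {x. P x}"
    unfolding closure_approachable
  proof (intro allI impI)
    fix e :: real assume e: "e > 0"
    obtain g where "continuous_compact_support g" "norm (abs_l2 g - abs_l2 (rep_l2 x)) < e"
      using square_integrable_approx_continuous[OF square_integrable_rep_l2 e] by blast
    then show "\<exists>y\<in>{x. P x}. dist y x < e" using assms(2) by (auto simp: dist_norm)
  qed
  then show ?thesis using assms(1) by simp
qed

text \<open>Together with the isometry property this adjoint formula yields Fourier inversion.\<close>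

lemma inner_fourier_l2: "fourier_l2 x \<bullet> y = x \<bullet> reflect_l2 (fourier_l2 y)"
proof -
  note F = bounded_linear_fourier_l2 and R = bounded_linear_reflect_l2
  \<comment> \<open>On the dense class both transforms are integrals. The multiplication formula for
    \<open>f\<close> and \<open>cnj g\<close> moves the transform across, and conjugating a
    transform reflects its argument, which is the source of \<open>reflect_l2\<close>.\<close>
  have key: "fourier_l2 (abs_l2 f) \<bullet> abs_l2 g = abs_l2 f \<bullet> reflect_l2 (fourier_l2 (abs_l2 g))"
    if f: "continuous_compact_support f" and g: "continuous_compact_support g" for f g :: "real ^ 'a \<Rightarrow> complex"
  proof -
    note sf = continuous_compact_support_square_integrable[OF f] and sg = continuous_compact_support_square_integrable[OF g]
    note i_f = continuous_compact_support_integrable[OF f] and ig = continuous_compact_support_integrable[OF g]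
    note sFf = fourier_int_isometry(1)[OF i_f sf] and sFg = fourier_int_isometry(1)[OF ig sg]
    have icg: "integrable lborel (\<lambda>x. cnj (g x))" using ig by simp
    have m: "f \<in> borel_measurable borel" "g \<in> borel_measurable borel"
      using sf sg by (auto dest: square_integrableD)
    have ip: "integrable lborel (\<lambda>x. u x * cnj (v x))" if u: "square_integrable u" and v: "square_integrable v" for u v :: "real ^ 'a \<Rightarrow> complex"
    proof (rule Bochner_Integration.integrable_bound)
      show "integrable lborel (\<lambda>x. (cmod (u x))\<^sup>2 + (cmod (v x))\<^sup>2)"
        using u v by (auto simp: square_integrable_def)
      have [measurable]: "u \<in> borel_measurable borel" "v \<in> borel_measurable borel"
        using u v by (auto dest: square_integrableD)
      show "(\<lambda>x. u x * cnj (v x)) \<in> borel_measurable lborel" by measurable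
      show "AE x in lborel. norm (u x * cnj (v x)) \<le> norm ((cmod (u x))\<^sup>2 + (cmod (v x))\<^sup>2)"
      proof (intro AE_I2)
        fix x
        have "cmod (u x) * cmod (v x) \<le> (cmod (u x))\<^sup>2 + (cmod (v x))\<^sup>2"
          using sum_squares_bound[of "cmod (u x)" "cmod (v x)"]
            mult_nonneg_nonneg[OF norm_ge_zero[of "u x"] norm_ge_zero[of "v x"]] by linarith
        then show "norm (u x * cnj (v x)) \<le> norm ((cmod (u x))\<^sup>2 + (cmod (v x))\<^sup>2)" by (simp add: norm_mult)
      qed
    qed
    have inn: "a \<bullet> b = Re (a * cnj b)" for a b :: complex by (simp add: inner_complex_def)
    have "fourier_l2 (abs_l2 f) \<bullet> abs_l2 g = abs_l2 (fourier_int f) \<bullet> abs_l2 g"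
      by (simp only: fourier_l2_abs[OF sf] abs_fourier_integrable[OF sf i_f])
    also have "\<dots> = (LINT x|lborel. fourier_int f x \<bullet> g x)" by (rule inner_abs_l2[OF sFf sg])
    also have "\<dots> = Re (LINT x|lborel. fourier_int f x * cnj (g x))"
      unfolding inn by (rule integral_Re[OF ip[OF sFf sg]])
    also have "(LINT x|lborel. fourier_int f x * cnj (g x)) = (LINT x|lborel. f x * fourier_int (\<lambda>x. cnj (g x)) x)"
      by (rule fourier_int_multiplication_formula[OF i_f icg])
    also have "\<dots> = (LINT x|lborel. f x * cnj (fourier_int g (- x)))" by (simp only: fourier_int_cnj)
    also have "Re \<dots> = (LINT x|lborel. f x \<bullet> fourier_int g (- x))"
      unfolding inn by (rule integral_Re[OF ip[OF sf square_integrable_reflect[OF sFg]], symmetric])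
    also have "\<dots> = abs_l2 f \<bullet> abs_l2 (\<lambda>x. fourier_int g (- x))"
      by (rule inner_abs_l2[OF sf square_integrable_reflect[OF sFg], symmetric])
    also have "\<dots> = abs_l2 f \<bullet> reflect_l2 (fourier_l2 (abs_l2 g))"
      by (simp only: fourier_l2_abs[OF sg] abs_fourier_integrable[OF sg ig] reflect_l2_abs[OF sFg])
    finally show ?thesis .
  qed
  have F_cont: "continuous_on UNIV (fourier_l2 :: 'a l2 \<Rightarrow> 'a l2)"
    by (rule bounded_linear.continuous_on[OF F continuous_on_id])
  have RF_cont: "continuous_on UNIV (\<lambda>y :: 'a l2. reflect_l2 (fourier_l2 y))"
    by (rule bounded_linear.continuous_on[OF R F_cont])
  have 1: "fourier_l2 x \<bullet> abs_l2 g = x \<bullet> reflect_l2 (fourier_l2 (abs_l2 g))"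
    if g: "continuous_compact_support g" for g
  proof (rule l2_dense_induct[where x = x and P = "\<lambda>x. fourier_l2 x \<bullet> abs_l2 g = x \<bullet> reflect_l2 (fourier_l2 (abs_l2 g))"])
    show "closed {x. fourier_l2 x \<bullet> abs_l2 g = x \<bullet> reflect_l2 (fourier_l2 (abs_l2 g))}"
      by (rule closed_Collect_eq) (intro continuous_on_inner continuous_on_const continuous_on_id F_cont)+
  qed (rule key[OF _ g])
  show ?thesis
  proof (rule l2_dense_induct[where x = y and P = "\<lambda>y. fourier_l2 x \<bullet> y = x \<bullet> reflect_l2 (fourier_l2 y)"])
    show "closed {y. fourier_l2 x \<bullet> y = x \<bullet> reflect_l2 (fourier_l2 y)}"
      by (rule closed_Collect_eq) (intro continuous_on_inner continuous_on_const continuous_on_id RF_cont)+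
  qed (rule 1)
qed

lemma inner_fourier_l2_fourier_l2: "fourier_l2 x \<bullet> fourier_l2 y = x \<bullet> y"
proof -
  have "fourier_l2 (x + y) = fourier_l2 x + fourier_l2 y"
    by (rule linear_add[OF bounded_linear.linear[OF bounded_linear_fourier_l2]])
  then show ?thesis
    using norm_fourier_l2[of "x + y"] by (simp add: dot_norm norm_fourier_l2)
qed

text \<open>With F the transform and T = R F, where R is reflection, the adjoint formula and the
  preserved inner product give <y, T F x> = <F y, F x> = <y, x> for every y, so T is a left inverse
  of F.\<close>

theorem fourier_l2_inversion:
  fixes x :: "'b::finite l2"
  shows "reflect_l2 (fourier_l2 (fourier_l2 x)) = x" "fourier_l2 (reflect_l2 (fourier_l2 x)) = x"
proof -
  have 1: "reflect_l2 (fourier_l2 (fourier_l2 x)) = x" for x :: "'b l2"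
  proof -
    have "y \<bullet> reflect_l2 (fourier_l2 (fourier_l2 x)) = y \<bullet> x" for y
      by (simp only: inner_fourier_l2[symmetric] inner_fourier_l2_fourier_l2)
    then show ?thesis by (rule vector_eq_ldot[THEN iffD1, OF allI])
  qed
  show "reflect_l2 (fourier_l2 (fourier_l2 x)) = x" by (rule 1)
  let ?T = "\<lambda>x. reflect_l2 (fourier_l2 x)"
  \<comment> \<open>A left inverse need not be a right inverse in infinite dimension; here T is
    itself isometric, hence injective, and T F T = T yields F T = 1.\<close>
  have "?T (fourier_l2 (?T x)) = ?T x" by (rule 1)
  then have "norm (?T (fourier_l2 (?T x) - x)) = 0"
    by (simp add: linear_diff[OF bounded_linear.linear[OF bounded_linear_fourier_l2]]
        linear_diff[OF bounded_linear.linear[OF bounded_linear_reflect_l2]])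
  then show "fourier_l2 (?T x) = x" by (simp add: norm_reflect_l2 norm_fourier_l2)
qed

section \<open>Sobolev spaces above the critical order are algebras\<close>

text \<open>Young's inequality for L^2 with L^1. Writing A b as (A sqrt b) sqrt b, Cauchy-Schwarz in
  \<zeta> leaves one factor of the L^1 norm outside; Tonelli and translation invariance give the
  second one.\<close>

lemma nn_integral_convolution_square_le:
  fixes A b :: "'a::euclidean_space \<Rightarrow> real"
  assumes [measurable]: "A \<in> borel_measurable borel" "b \<in> borel_measurable borel"
    and nonneg: "\<And>x. A x \<ge> 0" "\<And>x. b x \<ge> 0"
  shows "(\<integral>\<^sup>+\<xi>. (\<integral>\<^sup>+\<zeta>. ennreal (A (\<xi> - \<zeta>) * b \<zeta>) \<partial>lborel)\<^sup>2 \<partial>lborel) \<le>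
    (\<integral>\<^sup>+\<zeta>. ennreal (b \<zeta>) \<partial>lborel)\<^sup>2 * (\<integral>\<^sup>+\<xi>. ennreal ((A \<xi>)\<^sup>2) \<partial>lborel)"
proof -
  define S where "S = (\<integral>\<^sup>+\<zeta>. ennreal (b \<zeta>) \<partial>lborel)"
  define T where "T = (\<integral>\<^sup>+\<xi>. ennreal ((A \<xi>)\<^sup>2) \<partial>lborel)"
  have cs: "(\<integral>\<^sup>+\<zeta>. ennreal (A (\<xi> - \<zeta>) * b \<zeta>) \<partial>lborel)\<^sup>2 \<le>
      (\<integral>\<^sup>+\<zeta>. ennreal ((A (\<xi> - \<zeta>))\<^sup>2 * b \<zeta>) \<partial>lborel) * S" for \<xi>
  proof -
    have "(\<integral>\<^sup>+\<zeta>. ennreal (A (\<xi> - \<zeta>) * sqrt (b \<zeta>)) * ennreal (sqrt (b \<zeta>)) \<partial>lborel)\<^sup>2 \<le>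
      (\<integral>\<^sup>+\<zeta>. (ennreal (A (\<xi> - \<zeta>) * sqrt (b \<zeta>)))\<^sup>2 \<partial>lborel) * (\<integral>\<^sup>+\<zeta>. (ennreal (sqrt (b \<zeta>)))\<^sup>2 \<partial>lborel)"
      by (rule Cauchy_Schwarz_nn_integral) measurable
    moreover have "ennreal (A (\<xi> - \<zeta>) * sqrt (b \<zeta>)) * ennreal (sqrt (b \<zeta>)) = ennreal (A (\<xi> - \<zeta>) * b \<zeta>)" for \<zeta>
      using nonneg by (simp add: ennreal_mult[symmetric] mult.assoc)
    moreover have "(ennreal (A (\<xi> - \<zeta>) * sqrt (b \<zeta>)))\<^sup>2 = ennreal ((A (\<xi> - \<zeta>))\<^sup>2 * b \<zeta>)" for \<zeta>
      using nonneg by (simp add: ennreal_power power_mult_distrib)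
    moreover have "(ennreal (sqrt (b \<zeta>)))\<^sup>2 = ennreal (b \<zeta>)" for \<zeta>
      using nonneg by (simp add: ennreal_power)
    ultimately show ?thesis unfolding S_def by (simp only:)
  qed
  have shift: "(\<integral>\<^sup>+\<xi>. ennreal ((A (\<xi> - \<zeta>))\<^sup>2) \<partial>lborel) = T" for \<zeta>
    unfolding T_def using nn_integral_lborel_affine[of "\<lambda>\<xi>. ennreal ((A (\<xi> - \<zeta>))\<^sup>2)" 1 \<zeta>] by simp
  have "(\<integral>\<^sup>+\<xi>. (\<integral>\<^sup>+\<zeta>. ennreal (A (\<xi> - \<zeta>) * b \<zeta>) \<partial>lborel)\<^sup>2 \<partial>lborel)
      \<le> (\<integral>\<^sup>+\<xi>. (\<integral>\<^sup>+\<zeta>. ennreal ((A (\<xi> - \<zeta>))\<^sup>2 * b \<zeta>) \<partial>lborel) * S \<partial>lborel)"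
    by (intro nn_integral_mono cs)
  also have "\<dots> = (\<integral>\<^sup>+\<xi>. (\<integral>\<^sup>+\<zeta>. ennreal ((A (\<xi> - \<zeta>))\<^sup>2 * b \<zeta>) \<partial>lborel) \<partial>lborel) * S"
    by (rule nn_integral_multc) measurable
  also have "(\<integral>\<^sup>+\<xi>. (\<integral>\<^sup>+\<zeta>. ennreal ((A (\<xi> - \<zeta>))\<^sup>2 * b \<zeta>) \<partial>lborel) \<partial>lborel) =
      (\<integral>\<^sup>+\<zeta>. (\<integral>\<^sup>+\<xi>. ennreal ((A (\<xi> - \<zeta>))\<^sup>2 * b \<zeta>) \<partial>lborel) \<partial>lborel)"
    by (rule lborel_pair.Fubini') measurable
  also have "\<dots> = (\<integral>\<^sup>+\<zeta>. T * ennreal (b \<zeta>) \<partial>lborel)"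
    using nonneg by (simp add: ennreal_mult nn_integral_multc shift)
  also have "\<dots> = T * S" unfolding S_def by (rule nn_integral_cmult) measurable
  finally show ?thesis unfolding S_def T_def by (simp add: power2_eq_square mult_ac)
qed

section \<open>Convolution and its Fourier transform\<close>

definition lconvolution :: "(real ^ 'n \<Rightarrow> complex) \<Rightarrow> (real ^ 'n \<Rightarrow> complex) \<Rightarrow> real ^ 'n \<Rightarrow> complex" where
  "lconvolution f g \<xi> = (LINT \<zeta>|lborel. f (\<xi> - \<zeta>) * g \<zeta>)"

lemma convolution_measurable:
  assumes [measurable]: "f \<in> borel_measurable borel" "g \<in> borel_measurable borel"
  shows "lconvolution f g \<in> borel_measurable borel"
  unfolding lconvolution_def[abs_def] by (rule lborel.borel_measurable_lebesgue_integral) measurable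

text \<open>The unimodular factor \<open>c\<close> allows two uses: the constant 1 for integrability
  of the convolution and a character for its transform.\<close>

lemma integrable_convolution_kernel:
  fixes f g :: "real ^ 'n \<Rightarrow> complex"
  assumes f: "integrable lborel f" and g: "integrable lborel g"
    and c: "c \<in> borel_measurable borel" "\<And>\<xi>. cmod (c \<xi>) = 1"
  shows "integrable (lborel \<Otimes>\<^sub>M lborel) (\<lambda>(\<zeta>, \<xi>). c \<xi> * f (\<xi> - \<zeta>) * g \<zeta>)"
proof -
  have [measurable]: "f \<in> borel_measurable borel" "g \<in> borel_measurable borel" "c \<in> borel_measurable borel"
    using f g c by auto
  have shift: "integrable lborel (\<lambda>\<xi>. f (\<xi> - \<zeta>))" for \<zeta>
  proof -
    have "integrable (distr lborel borel ((+) (- \<zeta>))) f" using f by (simp add: lborel_distr_plus)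
    then show ?thesis by (subst (asm) integrable_distr_eq) auto
  qed
  have si: "(LINT \<xi>|lborel. cmod (f (\<xi> - \<zeta>))) = (LINT \<xi>|lborel. cmod (f \<xi>))" for \<zeta>
    using lborel_integral_affine[of "\<lambda>\<xi>. cmod (f (\<xi> - \<zeta>))" 1 \<zeta>] by simp
  show ?thesis
  proof (rule lborel_pair.Fubini_integrable)
    show "integrable lborel (\<lambda>\<zeta>. LINT \<xi>|lborel. norm (case (\<zeta>, \<xi>) of (\<zeta>, \<xi>) \<Rightarrow> c \<xi> * f (\<xi> - \<zeta>) * g \<zeta>))"
      using g by (simp add: norm_mult c si)
    show "AE \<zeta> in lborel. integrable lborel (\<lambda>\<xi>. case (\<zeta>, \<xi>) of (\<zeta>, \<xi>) \<Rightarrow> c \<xi> * f (\<xi> - \<zeta>) * g \<zeta>)"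
    proof (intro AE_I2)
      fix \<zeta>
      have "integrable lborel (\<lambda>\<xi>. c \<xi> * f (\<xi> - \<zeta>))"
        by (rule Bochner_Integration.integrable_bound[OF shift[of \<zeta>]]) (auto simp: norm_mult c)
      then show "integrable lborel (\<lambda>\<xi>. case (\<zeta>, \<xi>) of (\<zeta>, \<xi>) \<Rightarrow> c \<xi> * f (\<xi> - \<zeta>) * g \<zeta>)" by simp
    qed
  qed measurable
qed

lemma integrable_convolution:
  assumes f: "integrable lborel f" and g: "integrable lborel g"
  shows "integrable lborel (lconvolution f g)"
proof -
  have "integrable (lborel \<Otimes>\<^sub>M lborel) (\<lambda>(\<zeta>, \<xi>). f (\<xi> - \<zeta>) * g \<zeta>)"
    using integrable_convolution_kernel[OF f g, of "\<lambda>_. 1"] by simp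
  then have "integrable (lborel \<Otimes>\<^sub>M lborel) (\<lambda>(\<xi>, \<zeta>). f (\<xi> - \<zeta>) * g \<zeta>)"
    by (subst (asm) lborel_pair.integrable_product_swap_iff[symmetric]) (simp add: case_prod_beta')
  from lborel_pair.integrable_fst'[OF this] show ?thesis
    by (simp add: lconvolution_def[abs_def])
qed

text \<open>A character is multiplicative, so after Fubini and a translation the double integral
  factors. The constant appears because the unitary normalization enters once on the left and twice
  on the right.\<close>

lemma fourier_int_convolution:
  fixes f g :: "real ^ 'n \<Rightarrow> complex"
  assumes f: "integrable lborel f" and g: "integrable lborel g"
  shows "(2 * pi) powr (- real CARD('n) / 2) *\<^sub>R fourier_int (lconvolution f g) y = fourier_int f y * fourier_int g y"
proof -
  have [measurable]: "f \<in> borel_measurable borel" "g \<in> borel_measurable borel" using f g by auto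
  let ?c = "\<lambda>\<xi>. cis (- (\<xi> \<bullet> y))"
  have "(LINT \<xi>|lborel. ?c \<xi> * lconvolution f g \<xi>) = (LINT \<xi>|lborel. LINT \<zeta>|lborel. ?c \<xi> * f (\<xi> - \<zeta>) * g \<zeta>)"
    by (simp add: lconvolution_def mult.assoc)
  also have "\<dots> = (LINT \<zeta>|lborel. LINT \<xi>|lborel. ?c \<xi> * f (\<xi> - \<zeta>) * g \<zeta>)"
    by (rule lborel_pair.Fubini_integral[OF integrable_convolution_kernel[OF f g]]) auto
  also have "\<dots> = (LINT \<zeta>|lborel. (LINT \<xi>|lborel. ?c \<xi> * f \<xi>) * (?c \<zeta> * g \<zeta>))"
  proof (rule Bochner_Integration.integral_cong[OF refl])
    fix \<zeta>
    have "(LINT \<xi>|lborel. ?c \<xi> * f (\<xi> - \<zeta>)) = (LINT \<xi>|lborel. ?c (\<zeta> + \<xi>) * f \<xi>)"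
      using lborel_integral_affine[of "\<lambda>\<xi>. ?c \<xi> * f (\<xi> - \<zeta>)" 1 \<zeta>] by simp
    also have "?c (\<zeta> + \<xi>) = ?c \<zeta> * ?c \<xi>" for \<xi>
      by (simp add: inner_add_left cis_mult)
    then have "(LINT \<xi>|lborel. ?c (\<zeta> + \<xi>) * f \<xi>) = (LINT \<xi>|lborel. ?c \<zeta> * (?c \<xi> * f \<xi>))"
      by (simp only: mult.assoc)
    also have "\<dots> = ?c \<zeta> * (LINT \<xi>|lborel. ?c \<xi> * f \<xi>)" by (rule integral_mult_right_zero)
    finally have e: "(LINT \<xi>|lborel. ?c \<xi> * f (\<xi> - \<zeta>)) = ?c \<zeta> * (LINT \<xi>|lborel. ?c \<xi> * f \<xi>)" .
    have "(LINT \<xi>|lborel. ?c \<xi> * f (\<xi> - \<zeta>) * g \<zeta>) = (LINT \<xi>|lborel. ?c \<xi> * f (\<xi> - \<zeta>)) * g \<zeta>"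
      by (rule integral_mult_left_zero)
    then show "(LINT \<xi>|lborel. ?c \<xi> * f (\<xi> - \<zeta>) * g \<zeta>) = (LINT \<xi>|lborel. ?c \<xi> * f \<xi>) * (?c \<zeta> * g \<zeta>)"
      unfolding e by (simp only: mult_ac)
  qed
  finally have "(LINT \<xi>|lborel. ?c \<xi> * lconvolution f g \<xi>) = (LINT \<xi>|lborel. ?c \<xi> * f \<xi>) * (LINT \<zeta>|lborel. ?c \<zeta> * g \<zeta>)"
    by simp
  then show ?thesis by (simp add: fourier_int_def)
qed

text \<open>Where the defining integral does not converge absolutely, the convolution is 0 by
  convention and the bound is trivial, so no integrability is asked for.\<close>

lemma norm_convolution_le:
  fixes f g :: "real ^ 'n \<Rightarrow> complex"
  assumes "f \<in> borel_measurable borel" "g \<in> borel_measurable borel"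
  shows "ennreal (cmod (lconvolution f g \<xi>)) \<le> (\<integral>\<^sup>+\<zeta>. ennreal (cmod (f (\<xi> - \<zeta>)) * cmod (g \<zeta>)) \<partial>lborel)"
proof (cases "integrable lborel (\<lambda>\<zeta>. f (\<xi> - \<zeta>) * g \<zeta>)")
  case True
  then show ?thesis unfolding lconvolution_def using integral_norm_bound_ennreal[OF True] by (simp add: norm_mult)
qed (simp add: lconvolution_def not_integrable_integral_eq)

text \<open>The function is at most 1 on [-1, 1] and at most |t|^{-2s} outside, and 2s > 1 makes
  both tails integrable.\<close>

lemma integrable_one_plus_square_powr:
  fixes s :: real
  assumes s: "s > 1 / 2"
  shows "integrable lborel (\<lambda>t :: real. (1 + t\<^sup>2) powr - s)"
proof -
  define f where "f t = (if t \<in> {1..} then t powr (- 2 * s) else 0)" for t :: real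
  have [measurable]: "f \<in> borel_measurable borel" unfolding f_def by measurable
  have "((\<lambda>t. t powr (- 2 * s)) has_integral - (1 powr (- 2 * s + 1)) / (- 2 * s + 1)) {1..}"
    using s by (intro has_integral_powr_to_inf) auto
  then have "(f has_integral - (1 powr (- 2 * s + 1)) / (- 2 * s + 1)) UNIV"
    unfolding f_def by (subst has_integral_restrict_UNIV)
  then have "(\<integral>\<^sup>+t. ennreal (f t) \<partial>lborel) = ennreal (- (1 powr (- 2 * s + 1)) / (- 2 * s + 1))"
  proof (rule nn_integral_has_integral_lborel[rotated -1])
    show "0 \<le> f t" for t by (simp add: f_def)
  qed fact
  then have fi: "integrable lborel f"
    by (intro integrableI_bounded) (auto simp: f_def)
  have fi': "integrable lborel (\<lambda>t. f (- t))"
    using lborel_integrable_real_affine[OF fi, of "-1" 0] by simp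
  have "integrable lborel (\<lambda>t. indicator {-1..1} t + (f t + f (- t)) :: real)"
    by (intro Bochner_Integration.integrable_add fi fi' integrable_real_indicator) auto
  then show ?thesis
  proof (rule Bochner_Integration.integrable_bound)
    show "AE t in lborel. norm ((1 + t\<^sup>2) powr - s) \<le> norm (indicator {-1..1} t + (f t + f (- t)) :: real)"
    proof (intro AE_I2)
      fix t :: real
      have f0: "f t \<ge> 0" for t by (simp add: f_def)
      show "norm ((1 + t\<^sup>2) powr - s) \<le> norm (indicator {-1..1} t + (f t + f (- t)) :: real)"
      proof (cases "t \<in> {-1..1}")
        case True
        have "(1 + t\<^sup>2) powr - s \<le> (1 + t\<^sup>2) powr 0" using s by (intro powr_mono) auto
        also have "\<dots> = 1" by (simp add: add_nonneg_eq_0_iff)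
        finally show ?thesis using True f0[of t] f0[of "- t"] by simp
      next
        case False
        then have "\<bar>t\<bar> \<ge> 1" by auto
        have "(1 + t\<^sup>2) powr - s \<le> (\<bar>t\<bar>\<^sup>2) powr - s"
        proof (rule powr_mono2')
          show "0 < \<bar>t\<bar>\<^sup>2" using \<open>\<bar>t\<bar> \<ge> 1\<close> by (intro zero_less_power) linarith
        qed (use s in auto)
        also have "\<dots> = \<bar>t\<bar> powr (- 2 * s)"
          using \<open>\<bar>t\<bar> \<ge> 1\<close> powr_powr[of "\<bar>t\<bar>" 2 "- s"] by (simp add: powr_numeral)
        also have "\<dots> \<le> f t + f (- t)"
        proof (cases "t \<ge> 1")
          case True
          then have "f t = \<bar>t\<bar> powr (- 2 * s)" by (simp add: f_def)
          then show ?thesis using f0[of "- t"] by simp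
        next
          case f: False
          then have "f (- t) = \<bar>t\<bar> powr (- 2 * s)" using \<open>\<bar>t\<bar> \<ge> 1\<close> by (simp add: f_def)
          then show ?thesis using f0[of t] by simp
        qed
        finally show ?thesis using False f0[of t] f0[of "- t"] by simp
      qed
    qed
  qed measurable
qed

text \<open>Here q > N/2 enters. The exponent is shared equally among the N coordinates, each
  getting s = q/N > 1/2; in its own factor |\<xi>|^2 may be lowered to the square of one coordinate,
  and the bound becomes a product of one-dimensional integrable functions.\<close>

lemma integrable_inverse_one_plus_norm_squared:
  assumes q: "real q > real CARD('n) / 2"
  shows "integrable lborel (\<lambda>\<xi> :: real ^ 'n. inverse ((1 + (norm \<xi>)\<^sup>2) ^ q))"
proof -
  define s where "s = real q / real CARD('n)"
  have s: "s > 1 / 2" using q by (simp add: s_def field_simps)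
  have "integrable lborel (\<lambda>\<xi> :: real ^ 'n. \<Prod>b\<in>Basis. (1 + (\<xi> \<bullet> b)\<^sup>2) powr - s)"
    by (rule lborel_integral_prod_Basis(2)) (rule integrable_one_plus_square_powr[OF s])
  then show ?thesis
  proof (rule Bochner_Integration.integrable_bound)
    show "AE \<xi> :: real ^ 'n in lborel. norm (inverse ((1 + (norm \<xi>)\<^sup>2) ^ q)) \<le> norm (\<Prod>b\<in>Basis. (1 + (\<xi> \<bullet> b)\<^sup>2) powr - s)"
    proof (intro AE_I2)
      fix \<xi> :: "real ^ 'n"
      have p: "1 + (norm \<xi>)\<^sup>2 > 0" by (simp add: add_pos_nonneg)
      have "inverse ((1 + (norm \<xi>)\<^sup>2) ^ q) = (1 + (norm \<xi>)\<^sup>2) powr - real q"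
        using p by (simp add: powr_minus powr_realpow)
      also have "\<dots> = ((1 + (norm \<xi>)\<^sup>2) powr - s) powr real CARD('n)"
        by (simp add: powr_powr s_def)
      also have "\<dots> = ((1 + (norm \<xi>)\<^sup>2) powr - s) ^ CARD('n)"
        using p by (subst powr_realpow) auto
      also have "\<dots> = (\<Prod>b\<in>(Basis :: (real ^ 'n) set). (1 + (norm \<xi>)\<^sup>2) powr - s)"
        by (simp only: prod_constant DIM_cart DIM_real mult_1_right)
      also have "\<dots> \<le> (\<Prod>b\<in>Basis. (1 + (\<xi> \<bullet> b)\<^sup>2) powr - s)"
      proof (rule prod_mono)
        fix b :: "real ^ 'n" assume b: "b \<in> Basis"
        have "\<bar>\<xi> \<bullet> b\<bar> \<le> norm \<xi>" by (rule Basis_le_norm[OF b])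
        then have "(\<xi> \<bullet> b)\<^sup>2 \<le> (norm \<xi>)\<^sup>2" by (simp add: abs_le_square_iff[symmetric])
        then show "0 \<le> (1 + (norm \<xi>)\<^sup>2) powr - s \<and> (1 + (norm \<xi>)\<^sup>2) powr - s \<le> (1 + (\<xi> \<bullet> b)\<^sup>2) powr - s"
          using s by (auto intro!: powr_mono2' simp: add_pos_nonneg)
      qed
      finally show "norm (inverse ((1 + (norm \<xi>)\<^sup>2) ^ q)) \<le> norm (\<Prod>b\<in>Basis. (1 + (\<xi> \<bullet> b)\<^sup>2) powr - s)"
        by (simp add: prod_nonneg)
    qed
  qed measurable
qed

section \<open>Weighted transforms as coordinates on Sobolev spaces\<close>

definition bessel_weight :: "nat \<Rightarrow> real ^ 'n \<Rightarrow> real" where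
  "bessel_weight q \<xi> = sqrt (1 + (norm \<xi>)\<^sup>2) ^ q"

lemma bessel_weight_ge_1: "bessel_weight q \<xi> \<ge> 1"
  unfolding bessel_weight_def by (intro one_le_power) simp

lemma bessel_weight_pos: "bessel_weight q \<xi> > 0"
  using bessel_weight_ge_1[of q \<xi>] by linarith

lemma bessel_weight_measurable [measurable]: "bessel_weight q \<in> borel_measurable borel"
  unfolding bessel_weight_def[abs_def] by measurable

lemma bessel_weight_uminus: "bessel_weight q (- \<xi>) = bessel_weight q \<xi>"
  by (simp add: bessel_weight_def)

lemma bessel_weight_squared: "(bessel_weight q \<xi>)\<^sup>2 = (1 + (norm \<xi>)\<^sup>2) ^ q"
proof -
  have "(bessel_weight q \<xi>)\<^sup>2 = ((sqrt (1 + (norm \<xi>)\<^sup>2))\<^sup>2) ^ q"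
    unfolding bessel_weight_def by (simp only: power_mult[symmetric] mult.commute)
  then show ?thesis by (simp add: add_nonneg_nonneg)
qed

text \<open>sqrt (1 + |x|^2) is subadditive, and (a + b)^q <= (2 max(a, b))^q <= 2^q (a^q + b^q).
  The inequality distributes the weight of a convolution over its two factors.\<close>

lemma bessel_weight_add_le:
  "bessel_weight q (x + y) \<le> 2 ^ q * (bessel_weight q x + bessel_weight q y)"
proof -
  let ?s = "\<lambda>x :: real ^ 'a. sqrt (1 + (norm x)\<^sup>2)"
  have s: "?s x \<ge> 0" "norm x \<le> ?s x" for x :: "real ^ 'a" by (auto intro: real_le_rsqrt)
  have "?s (x + y) \<le> ?s x + ?s y"
  proof (rule real_le_lsqrt)
    have "(norm (x + y))\<^sup>2 \<le> (norm x + norm y)\<^sup>2" by (intro power_mono norm_triangle_ineq) auto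
    moreover have "norm x * norm y \<le> ?s x * ?s y" by (intro mult_mono s) auto
    moreover have "(?s x)\<^sup>2 = 1 + (norm x)\<^sup>2" "(?s y)\<^sup>2 = 1 + (norm y)\<^sup>2" by (auto simp: add_nonneg_nonneg)
    ultimately show "1 + (norm (x + y))\<^sup>2 \<le> (?s x + ?s y)\<^sup>2"
      by (simp only: power2_sum)
  qed (use s in \<open>auto intro: add_nonneg_nonneg\<close>)
  also have "\<dots> \<le> 2 * max (?s x) (?s y)" by linarith
  finally have "?s (x + y) ^ q \<le> (2 * max (?s x) (?s y)) ^ q" by (rule power_mono) (rule s)
  also have "\<dots> = 2 ^ q * max (?s x) (?s y) ^ q" by (rule power_mult_distrib)
  also have "max (?s x) (?s y) ^ q \<le> ?s x ^ q + ?s y ^ q"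
    using s zero_le_power[OF s(1), of x q] zero_le_power[OF s(1), of y q] by (auto simp: max_def)
  finally show ?thesis unfolding bessel_weight_def by simp
qed

lemma bessel_energy_eq: "bessel_energy (int q) g = l2_energy (\<lambda>\<xi>. complex_of_real (bessel_weight q \<xi>) * g \<xi>)"
  unfolding bessel_energy_def l2_energy_def norm_mult power_mult_distrib
  by (simp add: bessel_weight_squared)

text \<open>The isometry of $H^q$ onto $L^2$ given by the weighted Fourier transform, and its inverse.\<close>

definition bessel_l2 :: "nat \<Rightarrow> (real ^ 'n \<Rightarrow> complex) \<Rightarrow> 'n::finite l2" where
  "bessel_l2 q u = abs_l2 (\<lambda>\<xi>. complex_of_real (bessel_weight q \<xi>) * fourier u \<xi>)"

definition sobolev_rep :: "nat \<Rightarrow> 'n::finite l2 \<Rightarrow> real ^ 'n \<Rightarrow> complex" where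
  "sobolev_rep q x = inverse_fourier (\<lambda>\<xi>. complex_of_real (inverse (bessel_weight q \<xi>)) * rep_l2 x \<xi>)"

lemma square_integrable_fourier: "square_integrable u \<Longrightarrow> square_integrable (fourier u)"
  by (rule fourier_square_integrable_tendsto(1))

lemma sobolev_iff:
  "u \<in> sobolev q \<longleftrightarrow> square_integrable u \<and> square_integrable (\<lambda>\<xi>. complex_of_real (bessel_weight q \<xi>) * fourier u \<xi>)"
proof -
  have "(\<lambda>\<xi>. complex_of_real (bessel_weight q \<xi>) * fourier u \<xi>) \<in> borel_measurable borel" if "square_integrable u"
    using square_integrableD[OF square_integrable_fourier[OF that]] by measurable
  then show ?thesis by (auto simp: sobolev_def bessel_energy_eq square_integrable_iff_l2_energy)
qed

lemma sobolevD: "u \<in> sobolev q \<Longrightarrow> square_integrable u"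
  by (simp add: sobolev_iff)

lemma sobolev_weighted: "u \<in> sobolev q \<Longrightarrow> square_integrable (\<lambda>\<xi>. complex_of_real (bessel_weight q \<xi>) * fourier u \<xi>)"
  by (simp add: sobolev_iff)

lemma sobolev_norm_eq: "u \<in> sobolev q \<Longrightarrow> sobolev_norm q u = norm (bessel_l2 q u)"
  unfolding sobolev_norm_def bessel_l2_def by (simp add: bessel_energy_eq norm_abs_l2 sobolev_weighted)

text \<open>Since \<open>fourier u\<close> is known only up to null sets, membership and coordinate
  are always computed from a convenient version \<open>g\<close> of the transform.\<close>

lemma sobolev_bessel_l2I:
  assumes u: "square_integrable u" and g: "square_integrable (\<lambda>\<xi>. complex_of_real (bessel_weight q \<xi>) * g \<xi>)"
    and eq: "AE \<xi> in lborel. fourier u \<xi> = g \<xi>"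
  shows "u \<in> sobolev q" and "bessel_l2 q u = abs_l2 (\<lambda>\<xi>. complex_of_real (bessel_weight q \<xi>) * g \<xi>)"
proof -
  let ?w = "\<lambda>g \<xi>. complex_of_real (bessel_weight q \<xi>) * g \<xi>"
  have AE: "AE \<xi> in lborel. ?w (fourier u) \<xi> = ?w g \<xi>" using eq by eventually_elim simp
  have m: "?w (fourier u) \<in> borel_measurable borel"
    using square_integrableD[OF square_integrable_fourier[OF u]] by measurable
  show "u \<in> sobolev q"
    using u m g l2_energy_cong_AE[OF AE] by (simp add: sobolev_iff square_integrable_iff_l2_energy)
  show "bessel_l2 q u = abs_l2 (?w g)"
    unfolding bessel_l2_def by (rule abs_l2_eqI[OF g m AE])
qed

lemma sobolev_cong_AE:
  assumes u: "u \<in> sobolev q" and v: "v \<in> borel_measurable borel" and eq: "AE x in lborel. v x = u x"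
  shows "v \<in> sobolev q" and "bessel_l2 q v = bessel_l2 q u"
proof -
  have sv: "square_integrable v"
    using sobolevD[OF u] v l2_energy_cong_AE[OF eq] by (simp add: square_integrable_iff_l2_energy)
  have "fourier v = fourier u" by (rule fourier_cong_AE[OF sv sobolevD[OF u] eq])
  then show "v \<in> sobolev q" "bessel_l2 q v = bessel_l2 q u"
    using u sv by (simp_all add: sobolev_iff bessel_l2_def)
qed

lemma fourier_add_AE:
  assumes "square_integrable u" "square_integrable v"
  shows "AE \<xi> in lborel. fourier (\<lambda>x. u x + v x) \<xi> = fourier u \<xi> + fourier v \<xi>"
  using abs_fourier_add[OF assms]
  by (simp add: abs_l2_eq_iff square_integrable_add square_integrable_fourier assms flip: abs_l2_add)

lemma fourier_cmult_AE:
  assumes "square_integrable u"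
  shows "AE \<xi> in lborel. fourier (\<lambda>x. c * u x) \<xi> = c * fourier u \<xi>"
proof -
  have "abs_l2 (fourier (\<lambda>x. c * u x)) = abs_l2 (\<lambda>\<xi>. c * fourier u \<xi>)"
    unfolding abs_fourier_cmult[OF assms]
    by (rule mult_l2_abs[where B = "cmod c"]) (auto intro: square_integrable_fourier assms)
  then show ?thesis
    by (simp add: abs_l2_eq_iff square_integrable_cmult square_integrable_fourier assms)
qed

lemma sobolev_add:
  assumes u: "u \<in> sobolev q" and v: "v \<in> sobolev q"
  shows "(\<lambda>x. u x + v x) \<in> sobolev q" and "bessel_l2 q (\<lambda>x. u x + v x) = bessel_l2 q u + bessel_l2 q v"
proof -
  note su = sobolevD[OF u] and sv = sobolevD[OF v] and wu = sobolev_weighted[OF u] and wv = sobolev_weighted[OF v]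
  have w: "square_integrable (\<lambda>\<xi>. complex_of_real (bessel_weight q \<xi>) * (fourier u \<xi> + fourier v \<xi>))"
    using square_integrable_add[OF wu wv] by (simp add: distrib_left)
  note * = sobolev_bessel_l2I[OF square_integrable_add[OF su sv] w fourier_add_AE[OF su sv]]
  show "(\<lambda>x. u x + v x) \<in> sobolev q" by (rule *)
  show "bessel_l2 q (\<lambda>x. u x + v x) = bessel_l2 q u + bessel_l2 q v"
    unfolding *(2) by (simp add: distrib_left abs_l2_add wu wv bessel_l2_def)
qed

lemma sobolev_cmult:
  assumes u: "u \<in> sobolev q"
  shows "(\<lambda>x. c * u x) \<in> sobolev q" and "bessel_l2 q (\<lambda>x. c * u x) = mult_l2 (\<lambda>_. c) (bessel_l2 q u)"
proof -
  note su = sobolevD[OF u] and wu = sobolev_weighted[OF u]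
  have eq: "complex_of_real (bessel_weight q \<xi>) * (c * fourier u \<xi>) = c * (complex_of_real (bessel_weight q \<xi>) * fourier u \<xi>)" for \<xi>
    by simp
  have w: "square_integrable (\<lambda>\<xi>. complex_of_real (bessel_weight q \<xi>) * (c * fourier u \<xi>))"
    unfolding eq by (rule square_integrable_cmult[OF wu])
  note * = sobolev_bessel_l2I[OF square_integrable_cmult[OF su] w fourier_cmult_AE[OF su]]
  show "(\<lambda>x. c * u x) \<in> sobolev q" by (rule *)
  show "bessel_l2 q (\<lambda>x. c * u x) = mult_l2 (\<lambda>_. c) (bessel_l2 q u)"
    unfolding *(2) eq unfolding bessel_l2_def by (rule mult_l2_abs[where B = "cmod c", symmetric]) (auto intro: wu)
qed

lemma mult_l2_of_real: "mult_l2 (\<lambda>_. complex_of_real r) x = r *\<^sub>R x"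
  unfolding mult_l2_def by (simp add: abs_l2_scaleR flip: scaleR_conv_of_real)

lemma sobolev_scaleR:
  assumes u: "u \<in> sobolev q"
  shows "(\<lambda>x. r *\<^sub>R u x) \<in> sobolev q" and "bessel_l2 q (\<lambda>x. r *\<^sub>R u x) = r *\<^sub>R bessel_l2 q u"
  using sobolev_cmult[OF u, of "of_real r"] by (simp_all add: mult_l2_of_real scaleR_conv_of_real[where 'a = complex])

lemma sobolev_diff:
  assumes u: "u \<in> sobolev q" and v: "v \<in> sobolev q"
  shows "(\<lambda>x. u x - v x) \<in> sobolev q" and "bessel_l2 q (\<lambda>x. u x - v x) = bessel_l2 q u - bessel_l2 q v"
  using sobolev_add[OF u sobolev_scaleR(1)[OF v, of "-1"]] sobolev_scaleR(2)[OF v, of "-1"] by simp_all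

lemma sobolev_0: "(\<lambda>x :: real ^ 'n. 0) \<in> sobolev q" "bessel_l2 q (\<lambda>x :: real ^ 'n. 0) = 0"
proof -
  \<comment> \<open>\<open>fourier\<close> of the zero function is an arbitrary choice in its class.
    Reading 0 as the multiple 0 * 0 lets homogeneity determine it almost everywhere.\<close>
  have eq: "fourier (\<lambda>x :: real ^ 'n. 0) = fourier (\<lambda>x. 0 * 0)" by simp
  have AE: "AE \<xi> in lborel. fourier (\<lambda>x :: real ^ 'n. 0) \<xi> = 0"
    unfolding eq using fourier_cmult_AE[OF square_integrable_0, of 0] by simp
  show "(\<lambda>x :: real ^ 'n. 0) \<in> sobolev q" by (rule sobolev_bessel_l2I[OF _ _ AE]) auto
  show "bessel_l2 q (\<lambda>x :: real ^ 'n. 0) = 0"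
    by (subst sobolev_bessel_l2I(2)[OF _ _ AE]) (auto simp: abs_l2_0)
qed

text \<open>The real coefficients \<open>r a\<close> are the lengths of the subintervals when this
  is applied to the Riemann sums of an H^q-valued integral.\<close>

lemma sobolev_sum:
  assumes "finite A" "\<And>a. a \<in> A \<Longrightarrow> u a \<in> sobolev q"
  shows "(\<lambda>x. \<Sum>a\<in>A. r a *\<^sub>R u a x) \<in> sobolev q \<and>
    bessel_l2 q (\<lambda>x. \<Sum>a\<in>A. r a *\<^sub>R u a x) = (\<Sum>a\<in>A. r a *\<^sub>R bessel_l2 q (u a))"
  using assms
proof (induction A rule: finite_induct)
  case empty
  then show ?case by (simp add: sobolev_0)
next
  case (insert a A)
  then have IH: "(\<lambda>x. \<Sum>a\<in>A. r a *\<^sub>R u a x) \<in> sobolev q"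
    "bessel_l2 q (\<lambda>x. \<Sum>a\<in>A. r a *\<^sub>R u a x) = (\<Sum>a\<in>A. r a *\<^sub>R bessel_l2 q (u a))" by auto
  have a: "u a \<in> sobolev q" using insert.prems by simp
  show ?case
    using insert.hyps sobolev_add[OF sobolev_scaleR(1)[OF a, of "r a"] IH(1)] IH(2) sobolev_scaleR(2)[OF a, of "r a"]
    by simp
qed

lemma inverse_fourier_props:
  assumes v: "square_integrable v"
  shows "square_integrable (inverse_fourier v)"
    and "abs_l2 (inverse_fourier v) = reflect_l2 (fourier_l2 (abs_l2 v))"
    and "AE \<xi> in lborel. fourier (inverse_fourier v) \<xi> = v \<xi>"
proof -
  note sv = square_integrable_fourier[OF v]
  have eq: "inverse_fourier v = (\<lambda>x. fourier v (- x))" by (simp add: fun_eq_iff inverse_fourier_def)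
  show s: "square_integrable (inverse_fourier v)" unfolding eq by (rule square_integrable_reflect[OF sv])
  show a: "abs_l2 (inverse_fourier v) = reflect_l2 (fourier_l2 (abs_l2 v))"
    unfolding eq by (simp only: fourier_l2_abs[OF v] reflect_l2_abs[OF sv])
  have "abs_l2 (fourier (inverse_fourier v)) = abs_l2 v"
    unfolding fourier_l2_abs[OF s, symmetric] a by (rule fourier_l2_inversion)
  then show "AE \<xi> in lborel. fourier (inverse_fourier v) \<xi> = v \<xi>"
    by (simp only: abs_l2_eq_iff[OF square_integrable_fourier[OF s] v])
qed

lemma sobolev_rep: "sobolev_rep q x \<in> sobolev q" "bessel_l2 q (sobolev_rep q x) = x"
proof -
  let ?v = "\<lambda>\<xi>. complex_of_real (inverse (bessel_weight q \<xi>)) * rep_l2 x \<xi>"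
  have v: "square_integrable ?v"
  proof (rule square_integrable_mult_bounded[where B = 1])
    show "cmod (complex_of_real (inverse (bessel_weight q \<xi>))) \<le> 1" for \<xi> :: "real ^ 'a"
      using bessel_weight_ge_1[of q \<xi>] by (simp add: norm_inverse inverse_le_1_iff)
  qed simp_all
  have eq: "complex_of_real (bessel_weight q \<xi>) * ?v \<xi> = rep_l2 x \<xi>" for \<xi>
    using bessel_weight_pos[of q \<xi>] by simp
  have w: "square_integrable (\<lambda>\<xi>. complex_of_real (bessel_weight q \<xi>) * ?v \<xi>)"
    unfolding eq by simp
  note * = sobolev_bessel_l2I[OF inverse_fourier_props(1)[OF v] w inverse_fourier_props(3)[OF v]]
  show "sobolev_rep q x \<in> sobolev q" unfolding sobolev_rep_def by (rule *)
  show "bessel_l2 q (sobolev_rep q x) = x" unfolding sobolev_rep_def *(2) eq by simp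
qed

lemma fourier_l2_eq_iff: "fourier_l2 x = fourier_l2 y \<longleftrightarrow> x = y"
  by (metis fourier_l2_inversion(1))

text \<open>The weight never vanishes and the transform is injective on classes, so the coordinate
  determines the function up to null sets.\<close>

lemma bessel_l2_eq_iff:
  assumes u: "u \<in> sobolev q" and v: "v \<in> sobolev q"
  shows "bessel_l2 q u = bessel_l2 q v \<longleftrightarrow> (AE x in lborel. u x = v x)"
proof
  assume "bessel_l2 q u = bessel_l2 q v"
  then have "AE \<xi> in lborel. complex_of_real (bessel_weight q \<xi>) * fourier u \<xi> = complex_of_real (bessel_weight q \<xi>) * fourier v \<xi>"
    unfolding bessel_l2_def abs_l2_eq_iff[OF sobolev_weighted[OF u] sobolev_weighted[OF v]] .
  then have "AE \<xi> in lborel. fourier u \<xi> = fourier v \<xi>"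
  proof eventually_elim
    case (elim \<xi>)
    then show ?case using bessel_weight_pos[of q \<xi>] by simp
  qed
  then have "abs_l2 (fourier u) = abs_l2 (fourier v)"
    using abs_l2_eq_iff[OF square_integrable_fourier[OF sobolevD[OF u]] square_integrable_fourier[OF sobolevD[OF v]]] by simp
  then have "fourier_l2 (abs_l2 u) = fourier_l2 (abs_l2 v)"
    by (simp only: fourier_l2_abs[OF sobolevD[OF u]] fourier_l2_abs[OF sobolevD[OF v]])
  then have "abs_l2 u = abs_l2 v" by (simp only: fourier_l2_eq_iff)
  then show "AE x in lborel. u x = v x"
    by (simp only: abs_l2_eq_iff[OF sobolevD[OF u] sobolevD[OF v]])
next
  assume "AE x in lborel. u x = v x"
  then show "bessel_l2 q u = bessel_l2 q v"
    by (rule sobolev_cong_AE(2)[OF v square_integrableD[OF sobolevD[OF u]]])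
qed

section \<open>Free group and complex conjugation in these coordinates\<close>

definition phase :: "real \<Rightarrow> real ^ 'n \<Rightarrow> complex" where
  "phase t \<xi> = cis (- (t * (norm \<xi>)\<^sup>2))"

lemma phase_measurable [measurable]: "phase t \<in> borel_measurable borel"
  unfolding phase_def[abs_def] by measurable

lemma norm_phase [simp]: "cmod (phase t \<xi>) = 1"
  by (simp add: phase_def)

lemma sobolev_schroedinger_group:
  assumes u: "u \<in> sobolev q"
  shows "schroedinger_group t u \<in> sobolev q"
    and "bessel_l2 q (schroedinger_group t u) = mult_l2 (phase t) (bessel_l2 q u)"
proof -
  have eq: "schroedinger_group t u = inverse_fourier (\<lambda>\<xi>. phase t \<xi> * fourier u \<xi>)"
    by (simp add: schroedinger_group_def phase_def)
  note wu = sobolev_weighted[OF u]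
  have v: "square_integrable (\<lambda>\<xi>. phase t \<xi> * fourier u \<xi>)"
    by (rule square_integrable_mult_bounded[OF square_integrable_fourier[OF sobolevD[OF u]], where B = 1]) auto
  have com: "complex_of_real (bessel_weight q \<xi>) * (phase t \<xi> * fourier u \<xi>) = phase t \<xi> * (complex_of_real (bessel_weight q \<xi>) * fourier u \<xi>)" for \<xi>
    by simp
  have w: "square_integrable (\<lambda>\<xi>. complex_of_real (bessel_weight q \<xi>) * (phase t \<xi> * fourier u \<xi>))"
    unfolding com by (rule square_integrable_mult_bounded[OF wu, where B = 1]) auto
  note * = sobolev_bessel_l2I[OF inverse_fourier_props(1)[OF v] w inverse_fourier_props(3)[OF v]]
  show "schroedinger_group t u \<in> sobolev q" unfolding eq by (rule *)
  show "bessel_l2 q (schroedinger_group t u) = mult_l2 (phase t) (bessel_l2 q u)"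
    unfolding eq *(2) com unfolding bessel_l2_def by (rule mult_l2_abs[where B = 1, symmetric]) (auto intro: wu)
qed

text \<open>Conjugation in physical space as seen on the Fourier side, where it also reflects the
  frequency. It is linear over the reals only, which is all that the type requires.\<close>

definition conj_l2 :: "'n::finite l2 \<Rightarrow> 'n l2" where
  "conj_l2 x = abs_l2 (\<lambda>\<xi>. cnj (rep_l2 x (- \<xi>)))"

lemma square_integrable_cnj: "square_integrable u \<Longrightarrow> square_integrable (\<lambda>x. cnj (u x))"
  by (auto simp: square_integrable_def intro: measurable_compose[OF _ borel_measurable_cnj])

lemma square_integrable_conj_reflect: "square_integrable u \<Longrightarrow> square_integrable (\<lambda>x. cnj (u (- x)))"
  by (intro square_integrable_cnj square_integrable_reflect)

lemma conj_l2_abs: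
  assumes u: "square_integrable u"
  shows "conj_l2 (abs_l2 u) = abs_l2 (\<lambda>\<xi>. cnj (u (- \<xi>)))"
  unfolding conj_l2_def
proof (rule abs_l2_eqI[OF square_integrable_conj_reflect[OF u]])
  have [measurable]: "u \<in> borel_measurable borel" by (rule square_integrableD[OF u])
  have "AE x in lborel. rep_l2 (abs_l2 u) (- x) = u (- x)"
    by (rule AE_lborel_uminus[OF _ rep_abs_l2[OF u]]) measurable
  then show "AE x in lborel. cnj (rep_l2 (abs_l2 u) (- x)) = cnj (u (- x))" by eventually_elim simp
  show "(\<lambda>t. cnj (rep_l2 (abs_l2 u) (- t))) \<in> borel_measurable borel" by measurable
qed

lemma norm_conj_l2: "norm (conj_l2 x) = norm x"
proof -
  have "l2_energy (\<lambda>\<xi>. cnj (rep_l2 x (- \<xi>))) = l2_energy (\<lambda>\<xi>. rep_l2 x (- \<xi>))"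
    by (simp add: l2_energy_def)
  then have "norm (conj_l2 x) = sqrt (enn2real (l2_energy (rep_l2 x)))"
    unfolding conj_l2_def by (subst norm_abs_l2) (auto intro: square_integrable_conj_reflect simp: l2_energy_reflect)
  then show ?thesis using norm_abs_l2[of "rep_l2 x"] by simp
qed

lemma bounded_linear_conj_l2: "bounded_linear (conj_l2 :: 'n::finite l2 \<Rightarrow> 'n l2)"
proof
  fix x y :: "'n l2" and r :: real
  have "conj_l2 (abs_l2 (\<lambda>t. rep_l2 x t + rep_l2 y t)) = conj_l2 x + conj_l2 y"
    by (subst conj_l2_abs) (auto simp: square_integrable_add square_integrable_conj_reflect abs_l2_add conj_l2_def)
  then show "conj_l2 (x + y) = conj_l2 x + conj_l2 y" by (simp add: abs_l2_add)
  have "conj_l2 (abs_l2 (\<lambda>t. r *\<^sub>R rep_l2 x t)) = abs_l2 (\<lambda>\<xi>. r *\<^sub>R cnj (rep_l2 x (- \<xi>)))"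
    by (subst conj_l2_abs) (auto simp: square_integrable_scaleR)
  then have "conj_l2 (abs_l2 (\<lambda>t. r *\<^sub>R rep_l2 x t)) = r *\<^sub>R conj_l2 x"
    by (simp add: abs_l2_scaleR square_integrable_conj_reflect conj_l2_def)
  then show "conj_l2 (r *\<^sub>R x) = r *\<^sub>R conj_l2 x" by (simp add: abs_l2_scaleR)
next
  show "\<exists>K. \<forall>x. norm (conj_l2 x) \<le> norm x * K"
    by (intro exI[of _ 1]) (simp add: norm_conj_l2)
qed

lemma fourier_trunc_cnj: "fourier_trunc R (\<lambda>x. cnj (u x)) \<xi> = cnj (fourier_trunc R u (- \<xi>))"
proof -
  have "truncation R (\<lambda>x. cnj (u x)) = (\<lambda>x. cnj (truncation R u x))"
    by (simp add: fun_eq_iff truncation_def)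
  then show ?thesis by (simp only: fourier_trunc_eq fourier_int_cnj)
qed

lemma sobolev_cnj:
  assumes u: "u \<in> sobolev q"
  shows "(\<lambda>x. cnj (u x)) \<in> sobolev q" and "bessel_l2 q (\<lambda>x. cnj (u x)) = conj_l2 (bessel_l2 q u)"
proof -
  note su = sobolevD[OF u] and wu = sobolev_weighted[OF u]
  have eq: "abs_l2 (fourier_trunc R (\<lambda>x. cnj (u x))) = conj_l2 (abs_l2 (fourier_trunc R u))" for R
    by (simp only: conj_l2_abs[OF fourier_int_truncation(1)[OF su]] fourier_trunc_cnj[abs_def])
  have "abs_l2 (fourier (\<lambda>x. cnj (u x))) = conj_l2 (abs_l2 (fourier u))"
  proof (rule abs_fourier_eqI[OF square_integrable_cnj[OF su]])
    show "((\<lambda>R. abs_l2 (fourier_trunc R (\<lambda>x. cnj (u x)))) \<longlongrightarrow> conj_l2 (abs_l2 (fourier u))) at_top"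
      unfolding eq by (intro bounded_linear.tendsto[OF bounded_linear_conj_l2] fourier_square_integrable_tendsto su)
  qed
  then have AE: "AE \<xi> in lborel. fourier (\<lambda>x. cnj (u x)) \<xi> = cnj (fourier u (- \<xi>))"
    by (simp only: conj_l2_abs[OF square_integrable_fourier[OF su]]
        abs_l2_eq_iff[OF square_integrable_fourier[OF square_integrable_cnj[OF su]]
          square_integrable_conj_reflect[OF square_integrable_fourier[OF su]]])
  have com: "complex_of_real (bessel_weight q \<xi>) * cnj (fourier u (- \<xi>)) =
      cnj (complex_of_real (bessel_weight q (- \<xi>)) * fourier u (- \<xi>))" for \<xi>
    by (simp add: bessel_weight_uminus)
  have w: "square_integrable (\<lambda>\<xi>. complex_of_real (bessel_weight q \<xi>) * cnj (fourier u (- \<xi>)))"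
    unfolding com by (rule square_integrable_conj_reflect[OF wu])
  note * = sobolev_bessel_l2I[OF square_integrable_cnj[OF su] w AE]
  show "(\<lambda>x. cnj (u x)) \<in> sobolev q" by (rule *)
  show "bessel_l2 q (\<lambda>x. cnj (u x)) = conj_l2 (bessel_l2 q u)"
    unfolding *(2) com unfolding bessel_l2_def by (rule conj_l2_abs[OF wu, symmetric])
qed

section \<open>Products of Sobolev functions\<close>

lemma fourier_integrable_bound:
  assumes q: "real q > real CARD('n) / 2"
  obtains S where "S \<ge> 0" "\<And>u :: real ^ 'n \<Rightarrow> complex. u \<in> sobolev q \<Longrightarrow>
    integrable lborel (fourier u) \<and>
    (\<integral>\<^sup>+\<xi>. ennreal (cmod (fourier u \<xi>)) \<partial>lborel)\<^sup>2 \<le> ennreal (S * (norm (bessel_l2 q u))\<^sup>2)"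
proof -
  \<comment> \<open>The squared L^2 norm of the inverse weight, which is the constant that
    Cauchy-Schwarz produces when the weight is split off the transform.\<close>
  define S where "S = (LINT \<xi>|lborel. inverse ((1 + (norm (\<xi> :: real ^ 'n))\<^sup>2) ^ q))"
  have S: "S \<ge> 0" unfolding S_def by (intro integral_nonneg_AE AE_I2) simp
  show ?thesis
  proof (rule that[OF S])
    fix u :: "real ^ 'n \<Rightarrow> complex" assume u: "u \<in> sobolev q"
    note wu = sobolev_weighted[OF u]
    have [measurable]: "fourier u \<in> borel_measurable borel"
      by (rule square_integrableD[OF square_integrable_fourier[OF sobolevD[OF u]]])
    have "(\<integral>\<^sup>+\<xi>. ennreal (inverse (bessel_weight q \<xi>)) * ennreal (bessel_weight q \<xi> * cmod (fourier u \<xi>)) \<partial>lborel)\<^sup>2 \<le>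
        (\<integral>\<^sup>+\<xi>. (ennreal (inverse (bessel_weight q (\<xi> :: real ^ 'n))))\<^sup>2 \<partial>lborel) *
        (\<integral>\<^sup>+\<xi>. (ennreal (bessel_weight q \<xi> * cmod (fourier u \<xi>)))\<^sup>2 \<partial>lborel)"
      by (rule Cauchy_Schwarz_nn_integral) measurable
    moreover have "ennreal (inverse (bessel_weight q \<xi>)) * ennreal (bessel_weight q \<xi> * cmod (fourier u \<xi>)) = ennreal (cmod (fourier u \<xi>))" for \<xi>
      using bessel_weight_pos[of q \<xi>] by (simp add: ennreal_mult[symmetric] mult.assoc[symmetric])
    moreover have "(\<integral>\<^sup>+\<xi>. (ennreal (inverse (bessel_weight q (\<xi> :: real ^ 'n))))\<^sup>2 \<partial>lborel) = ennreal S"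
    proof -
      have e: "(ennreal (inverse (bessel_weight q \<xi>)))\<^sup>2 = ennreal (inverse ((1 + (norm \<xi>)\<^sup>2) ^ q))" for \<xi> :: "real ^ 'n"
        using bessel_weight_pos[of q \<xi>] by (simp add: ennreal_power power_inverse bessel_weight_squared)
      show ?thesis unfolding e S_def
        by (rule nn_integral_eq_integral[OF integrable_inverse_one_plus_norm_squared[OF q]]) simp
    qed
    moreover have "(\<integral>\<^sup>+\<xi>. (ennreal (bessel_weight q \<xi> * cmod (fourier u \<xi>)))\<^sup>2 \<partial>lborel) = ennreal ((norm (bessel_l2 q u))\<^sup>2)"
    proof -
      have e: "(ennreal (bessel_weight q \<xi> * cmod (fourier u \<xi>)))\<^sup>2 = ennreal ((cmod (complex_of_real (bessel_weight q \<xi>) * fourier u \<xi>))\<^sup>2)" for \<xi>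
        using bessel_weight_pos[of q \<xi>] by (simp add: ennreal_power norm_mult)
      show ?thesis unfolding e bessel_l2_def norm_abs_l2_squared[OF wu] l2_energy_def ..
    qed
    ultimately have le: "(\<integral>\<^sup>+\<xi>. ennreal (cmod (fourier u \<xi>)) \<partial>lborel)\<^sup>2 \<le> ennreal S * ennreal ((norm (bessel_l2 q u))\<^sup>2)"
      by (simp only:)
    also have "\<dots> = ennreal (S * (norm (bessel_l2 q u))\<^sup>2)" using S by (simp add: ennreal_mult)
    finally have le: "(\<integral>\<^sup>+\<xi>. ennreal (cmod (fourier u \<xi>)) \<partial>lborel)\<^sup>2 \<le> ennreal (S * (norm (bessel_l2 q u))\<^sup>2)" .
    then have "(\<integral>\<^sup>+\<xi>. ennreal (cmod (fourier u \<xi>)) \<partial>lborel) < \<infinity>"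
      by (cases "(\<integral>\<^sup>+\<xi>. ennreal (cmod (fourier u \<xi>)) \<partial>lborel)") (auto simp: ennreal_top_mult power2_eq_square top_unique)
    then have "integrable lborel (fourier u)" by (intro integrableI_bounded) auto
    then show "integrable lborel (fourier u) \<and>
        (\<integral>\<^sup>+\<xi>. ennreal (cmod (fourier u \<xi>)) \<partial>lborel)\<^sup>2 \<le> ennreal (S * (norm (bessel_l2 q u))\<^sup>2)"
      using le by blast
  qed
qed

lemma ennreal_add_squared_le: "(a + b)\<^sup>2 \<le> 2 * a\<^sup>2 + 2 * b\<^sup>2" for a b :: ennreal
proof (cases a)
  case (real r)
  show ?thesis
  proof (cases b)
    case (real s)
    have "(r + s)\<^sup>2 \<le> 2 * r\<^sup>2 + 2 * s\<^sup>2" using norm_add_squared_le[of r s] by simp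
    then have "ennreal ((r + s)\<^sup>2) \<le> ennreal (2 * r\<^sup>2 + 2 * s\<^sup>2)" by (rule ennreal_leI)
    moreover have "(ennreal r + ennreal s)\<^sup>2 = ennreal ((r + s)\<^sup>2)"
      using \<open>0 \<le> r\<close> \<open>0 \<le> s\<close> by (simp add: ennreal_plus[symmetric] ennreal_power del: ennreal_plus)
    ultimately show ?thesis
      using \<open>a = ennreal r\<close> \<open>0 \<le> r\<close> \<open>b = ennreal s\<close> \<open>0 \<le> s\<close> by (simp add: ennreal_power ennreal_mult)
  next
    case top
    then show ?thesis by (simp add: ennreal_mult_top power2_eq_square)
  qed
next
  case top
  then show ?thesis by (simp add: ennreal_mult_top power2_eq_square)
qed

text \<open>After the weight is distributed over the two factors, each summand is a convolution of a
  weighted factor in L^2 with an unweighted one in L^1, and Young's inequality applies to both.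
  Squaring the sum costs the factor 2.\<close>

lemma weighted_convolution_energy:
  fixes f g :: "real ^ 'n \<Rightarrow> complex"
  assumes [measurable]: "f \<in> borel_measurable borel" "g \<in> borel_measurable borel"
  shows "l2_energy (\<lambda>\<xi>. complex_of_real (bessel_weight q \<xi>) * lconvolution f g \<xi>) \<le>
    ennreal (2 * (2 ^ q)\<^sup>2) *
      ((\<integral>\<^sup>+\<xi>. ennreal (cmod (g \<xi>)) \<partial>lborel)\<^sup>2 * bessel_energy (int q) f +
       (\<integral>\<^sup>+\<xi>. ennreal (cmod (f \<xi>)) \<partial>lborel)\<^sup>2 * bessel_energy (int q) g)"
proof -
  let ?w = "bessel_weight q :: real ^ 'n \<Rightarrow> real"
  define P where "P \<xi> = (\<integral>\<^sup>+\<zeta>. ennreal (?w (\<xi> - \<zeta>) * cmod (f (\<xi> - \<zeta>)) * cmod (g \<zeta>)) \<partial>lborel)" for \<xi>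
  define Q where "Q \<xi> = (\<integral>\<^sup>+\<zeta>. ennreal (?w (\<xi> - \<zeta>) * cmod (g (\<xi> - \<zeta>)) * cmod (f \<zeta>)) \<partial>lborel)" for \<xi>
  have [measurable]: "P \<in> borel_measurable borel" "Q \<in> borel_measurable borel"
    unfolding P_def[abs_def] Q_def[abs_def] by measurable
  have wn: "0 \<le> ?w \<xi>" for \<xi> using bessel_weight_pos[of q \<xi>] by simp
  have E: "(\<integral>\<^sup>+\<xi>. ennreal ((?w \<xi> * cmod (h \<xi>))\<^sup>2) \<partial>lborel) = bessel_energy (int q) h" for h
    unfolding bessel_energy_eq l2_energy_def using wn by (simp add: norm_mult)
  have PQ: "ennreal (cmod (complex_of_real (?w \<xi>) * lconvolution f g \<xi>)) \<le> ennreal (2 ^ q) * (P \<xi> + Q \<xi>)" for \<xi>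
  proof -
    \<comment> \<open>Reversing \<zeta> to \<xi> - \<zeta> exchanges the roles of the factors.
      \<open>Q\<close> is defined with the weighted factor at \<xi> - \<zeta>, the position that
      Young's inequality expects, whereas the splitting produces it at \<zeta>.\<close>
    have Q': "Q \<xi> = (\<integral>\<^sup>+\<zeta>. ennreal (?w \<zeta> * cmod (g \<zeta>) * cmod (f (\<xi> - \<zeta>))) \<partial>lborel)"
      unfolding Q_def using nn_integral_lborel_affine[of "\<lambda>\<zeta>. ennreal (?w (\<xi> - \<zeta>) * cmod (g (\<xi> - \<zeta>)) * cmod (f \<zeta>))" "-1" \<xi>]
      by simp
    have "ennreal (cmod (complex_of_real (?w \<xi>) * lconvolution f g \<xi>)) = ennreal (?w \<xi>) * ennreal (cmod (lconvolution f g \<xi>))"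
      using wn by (simp add: norm_mult ennreal_mult)
    also have "\<dots> \<le> ennreal (?w \<xi>) * (\<integral>\<^sup>+\<zeta>. ennreal (cmod (f (\<xi> - \<zeta>)) * cmod (g \<zeta>)) \<partial>lborel)"
      by (intro mult_left_mono norm_convolution_le) auto
    also have "\<dots> = (\<integral>\<^sup>+\<zeta>. ennreal (?w \<xi>) * ennreal (cmod (f (\<xi> - \<zeta>)) * cmod (g \<zeta>)) \<partial>lborel)"
      by (rule nn_integral_cmult[symmetric]) measurable
    also have "\<dots> \<le> (\<integral>\<^sup>+\<zeta>. ennreal (2 ^ q) * (ennreal (?w (\<xi> - \<zeta>) * cmod (f (\<xi> - \<zeta>)) * cmod (g \<zeta>)) +
        ennreal (?w \<zeta> * cmod (g \<zeta>) * cmod (f (\<xi> - \<zeta>)))) \<partial>lborel)"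
    proof (rule nn_integral_mono)
      fix \<zeta>
      have "?w \<xi> \<le> 2 ^ q * (?w (\<xi> - \<zeta>) + ?w \<zeta>)"
        using bessel_weight_add_le[of q "\<xi> - \<zeta>" \<zeta>] by simp
      then have "?w \<xi> * (cmod (f (\<xi> - \<zeta>)) * cmod (g \<zeta>)) \<le> 2 ^ q * (?w (\<xi> - \<zeta>) + ?w \<zeta>) * (cmod (f (\<xi> - \<zeta>)) * cmod (g \<zeta>))"
        by (rule mult_right_mono) simp
      also have "\<dots> = 2 ^ q * (?w (\<xi> - \<zeta>) * cmod (f (\<xi> - \<zeta>)) * cmod (g \<zeta>) + ?w \<zeta> * cmod (g \<zeta>) * cmod (f (\<xi> - \<zeta>)))"
        by (simp add: algebra_simps)
      finally have "ennreal (?w \<xi> * (cmod (f (\<xi> - \<zeta>)) * cmod (g \<zeta>))) \<le>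
          ennreal (2 ^ q * (?w (\<xi> - \<zeta>) * cmod (f (\<xi> - \<zeta>)) * cmod (g \<zeta>) + ?w \<zeta> * cmod (g \<zeta>) * cmod (f (\<xi> - \<zeta>))))"
        by (rule ennreal_leI)
      then show "ennreal (?w \<xi>) * ennreal (cmod (f (\<xi> - \<zeta>)) * cmod (g \<zeta>)) \<le>
          ennreal (2 ^ q) * (ennreal (?w (\<xi> - \<zeta>) * cmod (f (\<xi> - \<zeta>)) * cmod (g \<zeta>)) + ennreal (?w \<zeta> * cmod (g \<zeta>) * cmod (f (\<xi> - \<zeta>))))"
        using wn by (simp add: ennreal_mult[symmetric] ennreal_plus[symmetric] del: ennreal_plus)
    qed
    also have "\<dots> = ennreal (2 ^ q) * (P \<xi> + Q \<xi>)"
      unfolding P_def Q' by (simp add: nn_integral_cmult nn_integral_add)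
    finally show ?thesis .
  qed
  have "l2_energy (\<lambda>\<xi>. complex_of_real (?w \<xi>) * lconvolution f g \<xi>) =
      (\<integral>\<^sup>+\<xi>. (ennreal (cmod (complex_of_real (?w \<xi>) * lconvolution f g \<xi>)))\<^sup>2 \<partial>lborel)"
    unfolding l2_energy_def by (simp add: ennreal_power)
  also have "\<dots> \<le> (\<integral>\<^sup>+\<xi>. (ennreal (2 ^ q) * (P \<xi> + Q \<xi>))\<^sup>2 \<partial>lborel)"
    by (intro nn_integral_mono power_mono PQ) auto
  also have "\<dots> \<le> (\<integral>\<^sup>+\<xi>. ennreal ((2 ^ q)\<^sup>2) * (2 * (P \<xi>)\<^sup>2 + 2 * (Q \<xi>)\<^sup>2) \<partial>lborel)"
    unfolding power_mult_distrib
    by (intro nn_integral_mono) (auto intro!: mult_mono ennreal_add_squared_le simp: ennreal_power)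
  also have "\<dots> = ennreal ((2 ^ q)\<^sup>2) * (2 * (\<integral>\<^sup>+\<xi>. (P \<xi>)\<^sup>2 \<partial>lborel) + 2 * (\<integral>\<^sup>+\<xi>. (Q \<xi>)\<^sup>2 \<partial>lborel))"
    by (simp add: nn_integral_cmult nn_integral_add)
  also have "\<dots> \<le> ennreal ((2 ^ q)\<^sup>2) * (2 * ((\<integral>\<^sup>+\<xi>. ennreal (cmod (g \<xi>)) \<partial>lborel)\<^sup>2 * bessel_energy (int q) f) +
      2 * ((\<integral>\<^sup>+\<xi>. ennreal (cmod (f \<xi>)) \<partial>lborel)\<^sup>2 * bessel_energy (int q) g))"
  proof (intro mult_left_mono add_mono)
    show "(\<integral>\<^sup>+\<xi>. (P \<xi>)\<^sup>2 \<partial>lborel) \<le> (\<integral>\<^sup>+\<xi>. ennreal (cmod (g \<xi>)) \<partial>lborel)\<^sup>2 * bessel_energy (int q) f"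
      unfolding P_def E[symmetric]
      by (rule nn_integral_convolution_square_le[where A = "\<lambda>\<xi>. ?w \<xi> * cmod (f \<xi>)" and b = "\<lambda>\<xi>. cmod (g \<xi>)"])
         (auto simp: wn)
    show "(\<integral>\<^sup>+\<xi>. (Q \<xi>)\<^sup>2 \<partial>lborel) \<le> (\<integral>\<^sup>+\<xi>. ennreal (cmod (f \<xi>)) \<partial>lborel)\<^sup>2 * bessel_energy (int q) g"
      unfolding Q_def E[symmetric]
      by (rule nn_integral_convolution_square_le[where A = "\<lambda>\<xi>. ?w \<xi> * cmod (g \<xi>)" and b = "\<lambda>\<xi>. cmod (f \<xi>)"])
         (auto simp: wn)
  qed auto
  also have "\<dots> = ennreal (2 * (2 ^ q)\<^sup>2) *
      ((\<integral>\<^sup>+\<xi>. ennreal (cmod (g \<xi>)) \<partial>lborel)\<^sup>2 * bessel_energy (int q) f +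
       (\<integral>\<^sup>+\<xi>. ennreal (cmod (f \<xi>)) \<partial>lborel)\<^sup>2 * bessel_energy (int q) g)"
    by (simp add: ennreal_mult distrib_left mult_ac)
  finally show ?thesis .
qed

text \<open>The abstract inversion becomes an integral formula once the transform is integrable;
  this is how pointwise products are reached from the Fourier side.\<close>

lemma fourier_inversion_AE:
  assumes u: "square_integrable u" and i: "integrable lborel (fourier u)"
  shows "AE x in lborel. u x = fourier_int (fourier u) (- x)"
proof -
  note sf = square_integrable_fourier[OF u] and sF = fourier_int_isometry(1)[OF i square_integrable_fourier[OF u]]
  have "abs_l2 u = reflect_l2 (fourier_l2 (fourier_l2 (abs_l2 u)))" by (rule fourier_l2_inversion(1)[symmetric])
  also have "\<dots> = abs_l2 (\<lambda>x. fourier_int (fourier u) (- x))"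
    by (simp only: fourier_l2_abs[OF u] fourier_l2_abs[OF sf] abs_fourier_integrable[OF sf i] reflect_l2_abs[OF sF])
  finally show ?thesis by (simp only: abs_l2_eq_iff[OF u square_integrable_reflect[OF sF]])
qed

lemma fourier_reflect_fourier_int:
  assumes i: "integrable lborel h" and s: "square_integrable h"
  shows "square_integrable (\<lambda>x. fourier_int h (- x))" "AE \<xi> in lborel. fourier (\<lambda>x. fourier_int h (- x)) \<xi> = h \<xi>"
proof -
  note sF = fourier_int_isometry(1)[OF i s]
  show r: "square_integrable (\<lambda>x. fourier_int h (- x))" by (rule square_integrable_reflect[OF sF])
  have "abs_l2 (fourier (\<lambda>x. fourier_int h (- x))) = fourier_l2 (reflect_l2 (fourier_l2 (abs_l2 h)))"
    by (simp only: fourier_l2_abs[OF s] abs_fourier_integrable[OF s i] reflect_l2_abs[OF sF] fourier_l2_abs[OF r])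
  also have "\<dots> = abs_l2 h" by (rule fourier_l2_inversion(2))
  finally show "AE \<xi> in lborel. fourier (\<lambda>x. fourier_int h (- x)) \<xi> = h \<xi>"
    by (simp only: abs_l2_eq_iff[OF square_integrable_fourier[OF r] s])
qed

text \<open>The transform of u v is not computed directly. Instead h, the normalized convolution of
  the two transforms, is shown to be integrable with finite weighted energy; its inverse transform
  lies in H^q and turns out to be u v almost everywhere.\<close>

lemma sobolev_mult:
  assumes q: "real q > real CARD('n) / 2"
  shows "\<exists>C\<ge>0. \<forall>u\<in>sobolev q. \<forall>v\<in>sobolev q. (\<lambda>x :: real ^ 'n. u x * v x) \<in> sobolev q \<and>
    norm (bessel_l2 q (\<lambda>x. u x * v x)) \<le> C * (norm (bessel_l2 q u) * norm (bessel_l2 q v))"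
proof -
  obtain S where S: "S \<ge> 0" "\<And>u :: real ^ 'n \<Rightarrow> complex. u \<in> sobolev q \<Longrightarrow>
    integrable lborel (fourier u) \<and>
    (\<integral>\<^sup>+\<xi>. ennreal (cmod (fourier u \<xi>)) \<partial>lborel)\<^sup>2 \<le> ennreal (S * (norm (bessel_l2 q u))\<^sup>2)"
    using fourier_integrable_bound[OF q] by blast
  define c where "c = (2 * pi) powr (- real CARD('n) / 2)"
  have c: "c > 0" by (simp add: c_def)
  \<comment> \<open>\<open>c\<close> normalizes the convolution. The two Young terms contribute S
    U^2 V^2 each, so the energy is at most 2 (2^q)^2 * 2 S U^2 V^2, whose root is 2 * 2^q * sqrt S *
    U V.\<close>
  define C where "C = c * (2 * 2 ^ q * sqrt S)"
  show ?thesis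
  proof (intro exI[of _ C] conjI[of "C \<ge> 0"] ballI)
    show "C \<ge> 0" using c S by (simp add: C_def)
    fix u v :: "real ^ 'n \<Rightarrow> complex" assume u: "u \<in> sobolev q" and v: "v \<in> sobolev q"
    define f where "f = fourier u"
    define g where "g = fourier v"
    define h where "h \<xi> = c *\<^sub>R lconvolution f g \<xi>" for \<xi>
    define U where "U = norm (bessel_l2 q u)"
    define V where "V = norm (bessel_l2 q v)"
    have i: "integrable lborel f" "integrable lborel g" using S(2)[OF u] S(2)[OF v] by (auto simp: f_def g_def)
    have L1: "(\<integral>\<^sup>+\<xi>. ennreal (cmod (f \<xi>)) \<partial>lborel)\<^sup>2 \<le> ennreal (S * U\<^sup>2)"
      "(\<integral>\<^sup>+\<xi>. ennreal (cmod (g \<xi>)) \<partial>lborel)\<^sup>2 \<le> ennreal (S * V\<^sup>2)"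
      using S(2)[OF u] S(2)[OF v] by (auto simp: f_def g_def U_def V_def)
    have L2: "bessel_energy (int q) f = ennreal (U\<^sup>2)" "bessel_energy (int q) g = ennreal (V\<^sup>2)"
      unfolding f_def g_def U_def V_def bessel_l2_def bessel_energy_eq
      by (simp_all add: norm_abs_l2_squared sobolev_weighted u v)
    have m [measurable]: "f \<in> borel_measurable borel" "g \<in> borel_measurable borel" using i by auto
    have mc [measurable]: "lconvolution f g \<in> borel_measurable borel" by (rule convolution_measurable[OF m])
    have mh: "h \<in> borel_measurable borel" unfolding h_def[abs_def] by measurable
    have ih: "integrable lborel h" unfolding h_def[abs_def] by (intro integrable_scaleR_right integrable_convolution i)
    let ?wc = "\<lambda>\<xi>. complex_of_real (bessel_weight q \<xi>) * lconvolution f g \<xi>"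
    have "l2_energy ?wc \<le> ennreal (2 * (2 ^ q)\<^sup>2) * (ennreal (S * V\<^sup>2) * ennreal (U\<^sup>2) + ennreal (S * U\<^sup>2) * ennreal (V\<^sup>2))"
      by (rule order_trans[OF weighted_convolution_energy[OF m, of q, unfolded L2]])
         (intro mult_left_mono add_mono mult_right_mono L1; simp)
    also have "\<dots> = ennreal ((2 * 2 ^ q * sqrt S * (U * V))\<^sup>2)"
    proof -
      have "2 * (2 ^ q)\<^sup>2 * (S * V\<^sup>2 * U\<^sup>2 + S * U\<^sup>2 * V\<^sup>2) = (2 * 2 ^ q * sqrt S * (U * V))\<^sup>2"
        using S(1) by (simp add: power_mult_distrib algebra_simps)
      then show ?thesis using S(1) by (simp add: ennreal_mult[symmetric] ennreal_plus[symmetric] del: ennreal_plus)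
    qed
    finally have Ewc: "l2_energy ?wc \<le> ennreal ((2 * 2 ^ q * sqrt S * (U * V))\<^sup>2)" .
    then have swc: "square_integrable ?wc"
      by (auto simp: square_integrable_iff_l2_energy intro: le_less_trans)
    have nwc: "norm (abs_l2 ?wc) \<le> 2 * 2 ^ q * sqrt S * (U * V)"
      using S(1) by (intro norm_abs_l2_le[OF swc Ewc]) (simp add: U_def V_def)
    have wh: "complex_of_real (bessel_weight q \<xi>) * h \<xi> = c *\<^sub>R ?wc \<xi>" for \<xi> by (simp add: h_def)
    have swh: "square_integrable (\<lambda>\<xi>. complex_of_real (bessel_weight q \<xi>) * h \<xi>)"
      unfolding wh by (rule square_integrable_scaleR[OF swc])
    have sh: "square_integrable h"
    proof -
      have "l2_energy h \<le> l2_energy (\<lambda>\<xi>. complex_of_real (bessel_weight q \<xi>) * h \<xi>)"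
      proof (intro l2_energy_mono_AE AE_I2)
        fix \<xi>
        have "1 * cmod (h \<xi>) \<le> bessel_weight q \<xi> * cmod (h \<xi>)"
          by (intro mult_right_mono bessel_weight_ge_1) auto
        then show "cmod (h \<xi>) \<le> cmod (complex_of_real (bessel_weight q \<xi>) * h \<xi>)"
          using bessel_weight_pos[of q \<xi>] by (simp add: norm_mult)
      qed
      then show ?thesis using mh swh by (auto simp: square_integrable_iff_l2_energy intro: le_less_trans)
    qed
    have "fourier_int h y = c *\<^sub>R fourier_int (lconvolution f g) y" for y
      unfolding h_def[abs_def] fourier_int_def by simp
    then have Fh: "fourier_int h y = fourier_int f y * fourier_int g y" for y
      using fourier_int_convolution[OF i, of y] by (simp only: c_def)
    note w = fourier_reflect_fourier_int[OF ih sh]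
    \<comment> \<open>Inversion writes \<open>u\<close> and \<open>v\<close> as integrals at - x,
      and the product of these integrals is the transform of the convolution at the same
      point.\<close>
    have uv: "AE x in lborel. u x * v x = fourier_int h (- x)"
      using fourier_inversion_AE[OF sobolevD[OF u] i(1)[unfolded f_def]]
        fourier_inversion_AE[OF sobolevD[OF v] i(2)[unfolded g_def]]
      unfolding f_def[symmetric] g_def[symmetric] Fh by eventually_elim simp
    have muv: "(\<lambda>x. u x * v x) \<in> borel_measurable borel"
      using square_integrableD[OF sobolevD[OF u]] square_integrableD[OF sobolevD[OF v]] by measurable
    note ws = sobolev_bessel_l2I[OF w(1) swh w(2)]
    note uvs = sobolev_cong_AE[OF ws(1) muv uv]
    have "bessel_l2 q (\<lambda>x. u x * v x) = c *\<^sub>R abs_l2 ?wc"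
      unfolding uvs(2) ws(2) wh by (rule abs_l2_scaleR[OF swc])
    then have "norm (bessel_l2 q (\<lambda>x. u x * v x)) \<le> C * (U * V)"
      using nwc c by (simp add: C_def mult.assoc mult_left_mono)
    then show "(\<lambda>x. u x * v x) \<in> sobolev q \<and>
        norm (bessel_l2 q (\<lambda>x. u x * v x)) \<le> C * (norm (bessel_l2 q u) * norm (bessel_l2 q v))"
      using uvs(1) by (simp only: U_def V_def simp_thms)
  qed
qed

section \<open>The nonlinear Schroedinger equation\<close>

text \<open>Pointwise multiplication carried over to coordinates. That the choice of representatives
  does not matter is the content of \<open>prod_l2_bessel\<close>.\<close>

definition prod_l2 :: "nat \<Rightarrow> 'n::finite l2 \<Rightarrow> 'n l2 \<Rightarrow> 'n l2" where
  "prod_l2 q x y = bessel_l2 q (\<lambda>t. sobolev_rep q x t * sobolev_rep q y t)"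

definition power_l2 :: "nat \<Rightarrow> nat \<Rightarrow> 'n::finite l2 \<Rightarrow> 'n l2" where
  "power_l2 q k x = ((\<lambda>y. prod_l2 q (prod_l2 q x (conj_l2 x)) y) ^^ k) x"

lemma power_l2_Suc: "power_l2 q (Suc k) x = prod_l2 q (prod_l2 q x (conj_l2 x)) (power_l2 q k x)"
  by (simp add: power_l2_def)

lemma sobolev_measurable: "u \<in> sobolev q \<Longrightarrow> u \<in> borel_measurable borel"
  by (intro square_integrableD sobolevD)

lemma prod_l2_bessel:
  fixes u v :: "real ^ 'n \<Rightarrow> complex"
  assumes q: "real q > real CARD('n) / 2" and u: "u \<in> sobolev q" and v: "v \<in> sobolev q"
  shows "(\<lambda>x. u x * v x) \<in> sobolev q" and "prod_l2 q (bessel_l2 q u) (bessel_l2 q v) = bessel_l2 q (\<lambda>x. u x * v x)"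
proof -
  obtain C where C: "\<forall>u\<in>sobolev q. \<forall>v\<in>sobolev q. (\<lambda>x :: real ^ 'n. u x * v x) \<in> sobolev q \<and>
      norm (bessel_l2 q (\<lambda>x. u x * v x)) \<le> C * (norm (bessel_l2 q u) * norm (bessel_l2 q v))"
    using sobolev_mult[OF q] by (elim exE conjE)
  show uv: "(\<lambda>x. u x * v x) \<in> sobolev q" using bspec[OF bspec[OF C u] v] by (rule conjunct1)
  have r: "AE x in lborel. sobolev_rep q (bessel_l2 q w) x = w x" if "w \<in> sobolev q" for w :: "real ^ 'n \<Rightarrow> complex"
    using bessel_l2_eq_iff[OF sobolev_rep(1) that, of "bessel_l2 q w"] sobolev_rep(2)[of q "bessel_l2 q w"] by simp
  show "prod_l2 q (bessel_l2 q u) (bessel_l2 q v) = bessel_l2 q (\<lambda>x. u x * v x)"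
    unfolding prod_l2_def
  proof (rule sobolev_cong_AE(2)[OF uv])
    show "AE x in lborel. sobolev_rep q (bessel_l2 q u) x * sobolev_rep q (bessel_l2 q v) x = u x * v x"
      using r[OF u] r[OF v] by eventually_elim simp
  qed (intro borel_measurable_times sobolev_measurable[OF sobolev_rep(1)])
qed

lemma prod_l2_commute: "prod_l2 q x y = prod_l2 q y x"
  by (simp add: prod_l2_def mult.commute)

lemma bounded_bilinear_prod_l2:
  assumes q: "real q > real CARD('n) / 2"
  shows "bounded_bilinear (prod_l2 q :: 'n::finite l2 \<Rightarrow> 'n l2 \<Rightarrow> 'n l2)"
proof
  note P = prod_l2_bessel[OF q]
  have add: "prod_l2 q (x + x') y = prod_l2 q x y + prod_l2 q x' y" for x x' y :: "'n l2"
  proof -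
    let ?x = "sobolev_rep q x" and ?x' = "sobolev_rep q x'" and ?y = "sobolev_rep q y"
    have "prod_l2 q (x + x') y = prod_l2 q (bessel_l2 q (\<lambda>t. ?x t + ?x' t)) (bessel_l2 q ?y)"
      by (simp only: sobolev_add(2)[OF sobolev_rep(1) sobolev_rep(1)] sobolev_rep(2))
    also have "\<dots> = bessel_l2 q (\<lambda>t. (?x t + ?x' t) * ?y t)"
      by (rule P(2)[OF sobolev_add(1)[OF sobolev_rep(1) sobolev_rep(1)] sobolev_rep(1)])
    also have "\<dots> = prod_l2 q x y + prod_l2 q x' y"
      unfolding distrib_right prod_l2_def by (rule sobolev_add(2)[OF P(1)[OF sobolev_rep(1) sobolev_rep(1)] P(1)[OF sobolev_rep(1) sobolev_rep(1)]])
    finally show ?thesis .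
  qed
  have scale: "prod_l2 q (r *\<^sub>R x) y = r *\<^sub>R prod_l2 q x y" for r and x y :: "'n l2"
  proof -
    let ?x = "sobolev_rep q x" and ?y = "sobolev_rep q y"
    have "prod_l2 q (r *\<^sub>R x) y = prod_l2 q (bessel_l2 q (\<lambda>t. r *\<^sub>R ?x t)) (bessel_l2 q ?y)"
      by (simp only: sobolev_scaleR(2)[OF sobolev_rep(1)] sobolev_rep(2))
    also have "\<dots> = bessel_l2 q (\<lambda>t. (r *\<^sub>R ?x t) * ?y t)"
      by (rule P(2)[OF sobolev_scaleR(1)[OF sobolev_rep(1)] sobolev_rep(1)])
    also have "\<dots> = r *\<^sub>R prod_l2 q x y"
      unfolding mult_scaleR_left prod_l2_def by (rule sobolev_scaleR(2)[OF P(1)[OF sobolev_rep(1) sobolev_rep(1)]])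
    finally show ?thesis .
  qed
  fix x x' y :: "'n l2" and r :: real
  show "prod_l2 q (x + x') y = prod_l2 q x y + prod_l2 q x' y" by (rule add)
  show "prod_l2 q y (x + x') = prod_l2 q y x + prod_l2 q y x'"
    unfolding prod_l2_commute[of q y] by (rule add)
  show "prod_l2 q (r *\<^sub>R x) y = r *\<^sub>R prod_l2 q x y" by (rule scale)
  show "prod_l2 q y (r *\<^sub>R x) = r *\<^sub>R prod_l2 q y x"
    unfolding prod_l2_commute[of q y] by (rule scale)
next
  obtain C where C: "\<forall>u\<in>sobolev q. \<forall>v\<in>sobolev q. (\<lambda>x :: real ^ 'n. u x * v x) \<in> sobolev q \<and>
      norm (bessel_l2 q (\<lambda>x. u x * v x)) \<le> C * (norm (bessel_l2 q u) * norm (bessel_l2 q v))"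
    using sobolev_mult[OF q] by (elim exE conjE)
  have "norm (prod_l2 q x y) \<le> norm x * norm y * C" for x y :: "'n l2"
    using bspec[OF bspec[OF C sobolev_rep(1)[of q x]] sobolev_rep(1)[of q y]]
    by (simp add: prod_l2_def sobolev_rep(2) mult.commute)
  then show "\<exists>K. \<forall>x y :: 'n l2. norm (prod_l2 q x y) \<le> norm x * norm y * K" by blast
qed

lemma bessel_l2_power:
  fixes u :: "real ^ 'n \<Rightarrow> complex"
  assumes q: "real q > real CARD('n) / 2" and u: "u \<in> sobolev q"
  shows "(\<lambda>x. complex_of_real (cmod (u x) ^ (2 * k)) * u x) \<in> sobolev q \<and>
    bessel_l2 q (\<lambda>x. complex_of_real (cmod (u x) ^ (2 * k)) * u x) = power_l2 q k (bessel_l2 q u)"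
proof (induction k)
  case 0
  then show ?case using u by (simp add: power_l2_def)
next
  case (Suc k)
  let ?v = "\<lambda>x. complex_of_real (cmod (u x) ^ (2 * k)) * u x"
  note cu = sobolev_cnj[OF u]
  note uu = prod_l2_bessel[OF q u cu(1)]
  have IH: "?v \<in> sobolev q" "bessel_l2 q ?v = power_l2 q k (bessel_l2 q u)" using Suc by blast+
  note p = prod_l2_bessel[OF q uu(1) IH(1)]
  have eq: "complex_of_real (cmod (u x) ^ (2 * Suc k)) * u x = u x * cnj (u x) * ?v x" for x
    unfolding complex_norm_square[symmetric] by (simp add: power_add[symmetric] flip: of_real_power of_real_mult)
  have "bessel_l2 q (\<lambda>x. u x * cnj (u x) * ?v x) = power_l2 q (Suc k) (bessel_l2 q u)"
    unfolding p(2)[symmetric] uu(2)[symmetric] cu(2) IH(2) power_l2_Suc ..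
  then show ?case using p(1) by (simp only: eq simp_thms)
qed

text \<open>This class contains the identity and is closed under bounded linear maps and bounded
  bilinear products, so a polynomial in u and its conjugate belongs to it.\<close>

definition locally_lipschitz :: "('a::real_normed_vector \<Rightarrow> 'b::real_normed_vector) \<Rightarrow> bool" where
  "locally_lipschitz F \<longleftrightarrow> (\<forall>R. \<exists>L. \<forall>x y. norm x \<le> R \<longrightarrow> norm y \<le> R \<longrightarrow> norm (F x - F y) \<le> L * norm (x - y))"

lemma locally_lipschitzE:
  assumes "locally_lipschitz F"
  obtains L B where "L \<ge> 0" "B \<ge> 0"
    "\<And>x y. norm x \<le> R \<Longrightarrow> norm y \<le> R \<Longrightarrow> norm (F x - F y) \<le> L * norm (x - y)"
    "\<And>x. norm x \<le> R \<Longrightarrow> norm (F x) \<le> B"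
proof -
  obtain L where L: "\<And>x y. norm x \<le> R \<Longrightarrow> norm y \<le> R \<Longrightarrow> norm (F x - F y) \<le> L * norm (x - y)"
    using assms unfolding locally_lipschitz_def by blast
  have L': "norm (F x - F y) \<le> \<bar>L\<bar> * norm (x - y)" if "norm x \<le> R" "norm y \<le> R" for x y
    using L[OF that] by (rule order_trans) (intro mult_right_mono, auto)
  have B: "norm (F x) \<le> norm (F 0) + \<bar>L\<bar> * \<bar>R\<bar>" if x: "norm x \<le> R" for x
  proof -
    have "0 \<le> R" using x norm_ge_zero[of x] by linarith
    then have "norm (F x - F 0) \<le> \<bar>L\<bar> * norm x" using L'[OF x, of 0] by simp
    also have "\<dots> \<le> \<bar>L\<bar> * \<bar>R\<bar>" using x by (intro mult_left_mono) auto
    finally show ?thesis using norm_triangle_ineq2[of "F x" "F 0"] by linarith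
  qed
  show ?thesis by (rule that[of "\<bar>L\<bar>" "norm (F 0) + \<bar>L\<bar> * \<bar>R\<bar>"]) (use L' B in auto)
qed

lemma locally_lipschitz_bounded_linear:
  fixes F :: "'a::real_normed_vector \<Rightarrow> 'b::real_normed_vector"
  assumes "bounded_linear T" "locally_lipschitz F"
  shows "locally_lipschitz (\<lambda>x. T (F x))"
  unfolding locally_lipschitz_def
proof
  fix R
  interpret bounded_linear T by fact
  obtain K where K: "\<And>x. norm (T x) \<le> norm x * K" using bounded by blast
  obtain L B where L: "L \<ge> 0" "\<And>x y. norm x \<le> R \<Longrightarrow> norm y \<le> R \<Longrightarrow> norm (F x - F y) \<le> L * norm (x - y)"
    using locally_lipschitzE[OF assms(2)] by metis
  show "\<exists>L. \<forall>(x :: 'a) y. norm x \<le> R \<longrightarrow> norm y \<le> R \<longrightarrow> norm (T (F x) - T (F y)) \<le> L * norm (x - y)"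
  proof (intro exI[of _ "L * \<bar>K\<bar>"] allI impI)
    fix x y :: 'a assume xy: "norm x \<le> R" "norm y \<le> R"
    have "norm (T (F x) - T (F y)) \<le> norm (F x - F y) * K" unfolding diff[symmetric] by (rule K)
    also have "\<dots> \<le> norm (F x - F y) * \<bar>K\<bar>" by (intro mult_left_mono) auto
    also have "\<dots> \<le> L * norm (x - y) * \<bar>K\<bar>" by (intro mult_right_mono L xy) auto
    finally show "norm (T (F x) - T (F y)) \<le> L * \<bar>K\<bar> * norm (x - y)" by (simp add: mult_ac)
  qed
qed

lemma locally_lipschitz_bilinear:
  fixes F :: "'a::real_normed_vector \<Rightarrow> 'b::real_normed_vector" and G :: "'a \<Rightarrow> 'c::real_normed_vector"
  assumes "bounded_bilinear P" "locally_lipschitz F" "locally_lipschitz G"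
  shows "locally_lipschitz (\<lambda>x. P (F x) (G x))"
  unfolding locally_lipschitz_def
proof
  fix R
  interpret bounded_bilinear P by fact
  obtain K where K: "K \<ge> 0" "\<And>x y. norm (P x y) \<le> norm x * norm y * K" using nonneg_bounded by blast
  obtain L B where L: "L \<ge> 0" "B \<ge> 0" "\<And>x y. norm x \<le> R \<Longrightarrow> norm y \<le> R \<Longrightarrow> norm (F x - F y) \<le> L * norm (x - y)"
    "\<And>x. norm x \<le> R \<Longrightarrow> norm (F x) \<le> B"
    using locally_lipschitzE[OF assms(2)] by metis
  obtain M D where M: "M \<ge> 0" "D \<ge> 0" "\<And>x y. norm x \<le> R \<Longrightarrow> norm y \<le> R \<Longrightarrow> norm (G x - G y) \<le> M * norm (x - y)"
    "\<And>x. norm x \<le> R \<Longrightarrow> norm (G x) \<le> D"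
    using locally_lipschitzE[OF assms(3)] by metis
  show "\<exists>L. \<forall>(x :: 'a) y. norm x \<le> R \<longrightarrow> norm y \<le> R \<longrightarrow> norm (P (F x) (G x) - P (F y) (G y)) \<le> L * norm (x - y)"
  proof (intro exI[of _ "L * D * K + B * M * K"] allI impI)
    fix x y :: 'a assume xy: "norm x \<le> R" "norm y \<le> R"
    have "P (F x) (G x) - P (F y) (G y) = P (F x - F y) (G x) + P (F y) (G x - G y)"
      by (simp add: diff_left diff_right)
    also have "norm \<dots> \<le> norm (P (F x - F y) (G x)) + norm (P (F y) (G x - G y))" by (rule norm_triangle_ineq)
    also have "\<dots> \<le> norm (F x - F y) * norm (G x) * K + norm (F y) * norm (G x - G y) * K"
      by (intro add_mono K)
    also have "\<dots> \<le> (L * norm (x - y)) * D * K + B * (M * norm (x - y)) * K"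
      by (intro add_mono mult_right_mono mult_mono L M K xy mult_nonneg_nonneg norm_ge_zero)
    finally show "norm (P (F x) (G x) - P (F y) (G y)) \<le> (L * D * K + B * M * K) * norm (x - y)"
      by (simp add: algebra_simps)
  qed
qed

lemma locally_lipschitz_id: "locally_lipschitz (\<lambda>x. x)"
  unfolding locally_lipschitz_def by (intro allI exI[of _ 1]) simp

lemma locally_lipschitz_continuous_on:
  assumes "locally_lipschitz F"
  shows "continuous_on UNIV F"
proof -
  have "isCont F x" for x
  proof -
    obtain L B where L: "\<And>y z. norm y \<le> norm x + 1 \<Longrightarrow> norm z \<le> norm x + 1 \<Longrightarrow> norm (F y - F z) \<le> L * norm (y - z)"
      using locally_lipschitzE[OF assms] by metis
    have "((\<lambda>y. F y - F x) \<longlongrightarrow> 0) (at x)"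
    proof (rule Lim_null_comparison)
      show "\<forall>\<^sub>F y in at x. norm (F y - F x) \<le> L * norm (y - x)"
        unfolding eventually_at
      proof (intro exI[of _ 1] conjI ballI impI L)
        fix y assume "y \<noteq> x \<and> dist y x < 1"
        then show "norm y \<le> norm x + 1" using norm_triangle_ineq2[of y x] by (simp add: dist_norm)
      qed auto
      show "((\<lambda>y. L * norm (y - x)) \<longlongrightarrow> 0) (at x)"
        by (rule tendsto_eq_rhs[OF tendsto_mult[OF tendsto_const tendsto_norm[OF tendsto_diff[OF tendsto_ident_at tendsto_const]]]]) simp
    qed
    then show ?thesis unfolding isCont_def by (rule LIM_zero_cancel)
  qed
  then show ?thesis by (simp add: continuous_on_eq_continuous_at)
qed

lemma locally_lipschitz_power_l2:
  assumes q: "real q > real CARD('n) / 2"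
  shows "locally_lipschitz (power_l2 q k :: 'n::finite l2 \<Rightarrow> 'n l2)"
proof (induction k)
  case 0
  then show ?case by (simp add: power_l2_def[abs_def] locally_lipschitz_id)
next
  case (Suc k)
  have eq: "(power_l2 q (Suc k) :: 'n l2 \<Rightarrow> 'n l2) = (\<lambda>x. prod_l2 q (prod_l2 q x (conj_l2 x)) (power_l2 q k x))"
    by (simp add: power_l2_def fun_eq_iff)
  show ?case
    unfolding eq
    by (intro locally_lipschitz_bilinear[OF bounded_bilinear_prod_l2[OF q]] locally_lipschitz_id Suc
        locally_lipschitz_bounded_linear[OF bounded_linear_conj_l2])
qed

lemma power_l2_0:
  assumes q: "real q > real CARD('n) / 2"
  shows "power_l2 q k (0 :: 'n::finite l2) = 0"
proof (induction k)
  case (Suc k)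
  then show ?case by (simp add: power_l2_def bounded_bilinear.zero_right[OF bounded_bilinear_prod_l2[OF q]])
qed (simp add: power_l2_def)

section \<open>Fourier multipliers and strong continuity of the free flow\<close>

lemma mult_l2_mult_l2:
  assumes "m \<in> borel_measurable borel" "\<And>\<xi>. cmod (m \<xi>) \<le> B" "m' \<in> borel_measurable borel" "\<And>\<xi>. cmod (m' \<xi>) \<le> B'"
  shows "mult_l2 m (mult_l2 m' x) = mult_l2 (\<lambda>\<xi>. m \<xi> * m' \<xi>) x"
proof -
  have "square_integrable (\<lambda>\<xi>. m' \<xi> * rep_l2 x \<xi>)"
    by (rule square_integrable_mult_bounded[OF _ assms(3,4)]) simp
  then have "mult_l2 m (abs_l2 (\<lambda>\<xi>. m' \<xi> * rep_l2 x \<xi>)) = abs_l2 (\<lambda>\<xi>. m \<xi> * (m' \<xi> * rep_l2 x \<xi>))"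
    by (rule mult_l2_abs[OF assms(1,2)])
  then show ?thesis
    by (simp only: mult_l2_def[of m' x] mult_l2_def[of "\<lambda>\<xi>. m \<xi> * m' \<xi>" x] mult.assoc)
qed

lemma mult_l2_1: "mult_l2 (\<lambda>_. 1) x = x"
  by (simp add: mult_l2_def)

text \<open>Dominated convergence at a fixed \<open>x\<close>: pointwise bounded convergence of
  multipliers gives strong convergence, without any uniformity in the frequency. Both continuity of
  the flow and differentiability at 0 rest on this.\<close>

lemma mult_l2_tendsto:
  fixes m :: "nat \<Rightarrow> real ^ 'n \<Rightarrow> complex"
  assumes m: "\<And>n. m n \<in> borel_measurable borel" "\<And>n \<xi>. cmod (m n \<xi>) \<le> B"
    and m': "m' \<in> borel_measurable borel"
    and lim: "\<And>\<xi>. (\<lambda>n. m n \<xi>) \<longlonglongrightarrow> m' \<xi>"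
  shows "(\<lambda>n. mult_l2 (m n) x) \<longlonglongrightarrow> mult_l2 m' x"
proof -
  have B': "cmod (m' \<xi>) \<le> B" for \<xi>
    by (rule LIMSEQ_le_const2[OF tendsto_norm[OF lim]]) (auto intro: m)
  have B: "0 \<le> B" using order_trans[OF norm_ge_zero m(2)[of 0 0]] .
  have s: "square_integrable (\<lambda>\<xi>. m n \<xi> * rep_l2 x \<xi>)" for n
    by (rule square_integrable_mult_bounded[OF square_integrable_rep_l2 m])
  have s': "square_integrable (\<lambda>\<xi>. m' \<xi> * rep_l2 x \<xi>)"
    by (rule square_integrable_mult_bounded[OF square_integrable_rep_l2 m' B'])
  show ?thesis
    unfolding mult_l2_def tendsto_abs_l2_iff[of "\<lambda>n \<xi>. m n \<xi> * rep_l2 x \<xi>", OF s s'] l2_energy_def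
  proof (rule nn_integral_power_dominated_convergence[where w = "\<lambda>\<xi>. (2 * B)\<^sup>2 * (cmod (rep_l2 x \<xi>))\<^sup>2"])
    have "(\<integral>\<^sup>+\<xi>. ennreal ((2 * B)\<^sup>2 * (cmod (rep_l2 x \<xi>))\<^sup>2) \<partial>lborel) = ennreal ((2 * B)\<^sup>2) * l2_energy (rep_l2 x)"
      unfolding l2_energy_def by (simp add: ennreal_mult nn_integral_cmult)
    also have "\<dots> < \<infinity>" by (simp add: norm_l2_squared[symmetric] ennreal_mult_less_top)
    finally show "(\<integral>\<^sup>+\<xi>. ennreal ((2 * B)\<^sup>2 * (cmod (rep_l2 x \<xi>))\<^sup>2) \<partial>lborel) < \<infinity>" .
    show "AE \<xi> in lborel. (cmod (m n \<xi> * rep_l2 x \<xi> - m' \<xi> * rep_l2 x \<xi>))\<^sup>2 \<le> (2 * B)\<^sup>2 * (cmod (rep_l2 x \<xi>))\<^sup>2" for n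
    proof (intro AE_I2)
      fix \<xi>
      have "cmod (m n \<xi> - m' \<xi>) \<le> cmod (m n \<xi>) + cmod (m' \<xi>)" by (rule norm_triangle_ineq4)
      also have "\<dots> \<le> 2 * B" using m(2)[of n \<xi>] B'[of \<xi>] by linarith
      finally have "(cmod (m n \<xi> - m' \<xi>))\<^sup>2 \<le> (2 * B)\<^sup>2" by (intro power_mono) auto
      then have "(cmod (m n \<xi> - m' \<xi>))\<^sup>2 * (cmod (rep_l2 x \<xi>))\<^sup>2 \<le> (2 * B)\<^sup>2 * (cmod (rep_l2 x \<xi>))\<^sup>2"
        by (rule mult_right_mono) simp
      then show "(cmod (m n \<xi> * rep_l2 x \<xi> - m' \<xi> * rep_l2 x \<xi>))\<^sup>2 \<le> (2 * B)\<^sup>2 * (cmod (rep_l2 x \<xi>))\<^sup>2"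
        by (simp only: left_diff_distrib[symmetric] norm_mult power_mult_distrib)
    qed
    show "AE \<xi> in lborel. (\<lambda>n. m n \<xi> * rep_l2 x \<xi>) \<longlonglongrightarrow> m' \<xi> * rep_l2 x \<xi>"
      by (intro AE_I2 tendsto_mult lim tendsto_const)
  qed (use m m' in measurable)
qed

abbreviation flow :: "real \<Rightarrow> 'n::finite l2 \<Rightarrow> 'n l2" where
  "flow t \<equiv> mult_l2 (phase t)"

lemma bounded_linear_flow: "bounded_linear (flow t)"
  by (rule bounded_linear_mult_l2[where B = 1]) auto

lemma flow_0 [simp]: "flow 0 x = x"
  by (simp add: phase_def[abs_def] mult_l2_1)

lemma flow_flow: "flow s (flow t x) = flow (s + t) x"
proof -
  have "flow s (flow t x) = mult_l2 (\<lambda>\<xi>. phase s \<xi> * phase t \<xi>) x"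
    by (rule mult_l2_mult_l2[where B = 1 and B' = 1]) auto
  also have "(\<lambda>\<xi> :: real ^ 'a. phase s \<xi> * phase t \<xi>) = phase (s + t)"
    by (simp add: fun_eq_iff phase_def cis_mult algebra_simps)
  finally show ?thesis .
qed

lemma norm_flow [simp]: "norm (flow t x) = norm x"
proof -
  have le: "norm (flow t x) \<le> norm x" for t and x :: "'a l2"
    using norm_mult_l2_le[of "phase t" 1 x] by simp
  have "norm (flow (- t) (flow t x)) \<le> norm (flow t x)" by (rule le)
  then show ?thesis using le[of t x] by (simp add: flow_flow)
qed

lemma flow_diff: "flow t (x - y) = flow t x - flow t y"
  by (rule linear_diff[OF bounded_linear.linear[OF bounded_linear_flow]])

lemma continuous_on_flow_orbit: "continuous_on UNIV (\<lambda>t. flow t x)"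
  unfolding continuous_on_sequentially
proof (intro allI ballI impI)
  fix X :: "nat \<Rightarrow> real" and t assume "(\<forall>n. X n \<in> UNIV) \<and> X \<longlonglongrightarrow> t"
  then have X: "X \<longlonglongrightarrow> t" by blast
  show "((\<lambda>t. flow t x) \<circ> X) \<longlonglongrightarrow> flow t x"
    unfolding o_def
  proof (rule mult_l2_tendsto[where B = 1])
    show "(\<lambda>n. phase (X n) \<xi>) \<longlonglongrightarrow> phase t \<xi>" for \<xi> :: "real ^ 'a"
      unfolding phase_def cis_conv_exp by (intro tendsto_intros X)
  qed auto
qed

text \<open>Strong continuity treats a fixed vector; the isometry property absorbs the error from
  the moving one.\<close>

lemma tendsto_flow:
  assumes r: "(r \<longlongrightarrow> t) F" and z: "(z \<longlongrightarrow> y) F"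
  shows "((\<lambda>s. flow (r s) (z s)) \<longlongrightarrow> flow t y) F"
proof -
  have "isCont (\<lambda>t. flow t y) t"
    using continuous_on_flow_orbit[of y] by (simp add: continuous_on_eq_continuous_at)
  then have "((\<lambda>s. flow (r s) y) \<longlongrightarrow> flow t y) F" using r by (rule isCont_tendsto_compose)
  moreover have "((\<lambda>s. flow (r s) (z s - y)) \<longlongrightarrow> 0) F"
  proof (rule tendsto_norm_zero_cancel)
    show "((\<lambda>s. norm (flow (r s) (z s - y))) \<longlongrightarrow> 0) F"
      using z by (simp add: tendsto_norm_zero_iff LIM_zero_iff)
  qed
  ultimately have "((\<lambda>s. flow (r s) (z s - y) + flow (r s) y) \<longlongrightarrow> 0 + flow t y) F"
    by (rule tendsto_add[rotated])
  then show ?thesis by (simp add: flow_diff)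
qed

lemma continuous_on_flow:
  "continuous_on S r \<Longrightarrow> continuous_on S z \<Longrightarrow> continuous_on S (\<lambda>s. flow (r s) (z s))"
  unfolding continuous_on_def by (blast intro: tendsto_flow)

text \<open>\<open>bessel_l2\<close> is linear and turns the Sobolev norm into the norm of
  \<open>l2\<close>, so both sides use the same Riemann sums and errors. The tags lie in the
  interval, hence every value that occurs in a sum is in H^q.\<close>

lemma has_sobolev_integral_iff:
  assumes g: "\<And>s. s \<in> {a..b} \<Longrightarrow> g s \<in> sobolev q" and v: "v \<in> sobolev q"
  shows "has_sobolev_integral q g v a b \<longleftrightarrow> ((\<lambda>s. bessel_l2 q (g s)) has_integral bessel_l2 q v) {a..b}"
proof -
  have norm_eq: "sobolev_norm q (\<lambda>x. (\<Sum>(s, K)\<in>D. measure lborel K *\<^sub>R g s x) - v x) =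
      norm ((\<Sum>(s, K)\<in>D. measure lborel K *\<^sub>R bessel_l2 q (g s)) - bessel_l2 q v)"
    if D: "D tagged_division_of {a..b}" for D
  proof -
    have fin: "finite D" using D by (rule tagged_division_of_finite)
    have mem: "g (fst p) \<in> sobolev q" if "p \<in> D" for p
      using tagged_division_ofD(2,3)[OF D, of "fst p" "snd p"] that by (intro g) auto
    note s = sobolev_sum[OF fin, of "\<lambda>p. g (fst p)" q "\<lambda>p. measure lborel (snd p)", OF mem]
    have "sobolev_norm q (\<lambda>x. (\<Sum>p\<in>D. measure lborel (snd p) *\<^sub>R g (fst p) x) - v x) =
        norm ((\<Sum>p\<in>D. measure lborel (snd p) *\<^sub>R bessel_l2 q (g (fst p))) - bessel_l2 q v)"
      by (simp only: sobolev_norm_eq[OF sobolev_diff(1)[OF conjunct1[OF s] v]] sobolev_diff(2)[OF conjunct1[OF s] v] conjunct2[OF s])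
    then show ?thesis by (simp only: case_prod_beta')
  qed
  have "has_sobolev_integral q g v a b \<longleftrightarrow>
     (\<forall>e>0. \<exists>\<gamma>. gauge \<gamma> \<and> (\<forall>D. D tagged_division_of {a..b} \<and> \<gamma> fine D \<longrightarrow>
        norm ((\<Sum>(s, K)\<in>D. measure lborel K *\<^sub>R bessel_l2 q (g s)) - bessel_l2 q v) < e))"
    unfolding has_sobolev_integral_def using g v norm_eq by (auto simp: Ball_def)
  also have "\<dots> \<longleftrightarrow> ((\<lambda>s. bessel_l2 q (g s)) has_integral bessel_l2 q v) {a..b}"
    unfolding has_integral_real by simp
  finally show ?thesis .
qed

lemma sobolev_norm_diff_eq:
  "u \<in> sobolev q \<Longrightarrow> v \<in> sobolev q \<Longrightarrow> sobolev_norm q (\<lambda>x. u x - v x) = norm (bessel_l2 q u - bessel_l2 q v)"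
  by (simp only: sobolev_norm_eq[OF sobolev_diff(1)] sobolev_diff(2))

lemma sobolev_continuous_on_iff:
  "sobolev_continuous_on q S \<psi> \<longleftrightarrow> (\<forall>t\<in>S. \<psi> t \<in> sobolev q) \<and> continuous_on S (\<lambda>t. bessel_l2 q (\<psi> t))"
proof (cases "\<forall>t\<in>S. \<psi> t \<in> sobolev q")
  case True
  have "((\<lambda>s. sobolev_norm q (\<lambda>x. \<psi> s x - \<psi> t x)) \<longlongrightarrow> 0) (at t within S) \<longleftrightarrow>
      ((\<lambda>s. bessel_l2 q (\<psi> s)) \<longlongrightarrow> bessel_l2 q (\<psi> t)) (at t within S)" if t: "t \<in> S" for t
  proof -
    have "\<forall>\<^sub>F s in at t within S. sobolev_norm q (\<lambda>x. \<psi> s x - \<psi> t x) = norm (bessel_l2 q (\<psi> s) - bessel_l2 q (\<psi> t))"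
      unfolding eventually_at_filter using True t by (intro always_eventually) (simp add: sobolev_norm_diff_eq)
    then have "((\<lambda>s. sobolev_norm q (\<lambda>x. \<psi> s x - \<psi> t x)) \<longlongrightarrow> 0) (at t within S) \<longleftrightarrow>
      ((\<lambda>s. norm (bessel_l2 q (\<psi> s) - bessel_l2 q (\<psi> t))) \<longlongrightarrow> 0) (at t within S)"
      by (rule tendsto_cong)
    then show ?thesis by (simp only: tendsto_norm_zero_iff LIM_zero_iff)
  qed
  then show ?thesis using True by (simp add: sobolev_continuous_on_def continuous_on_def)
qed (auto simp: sobolev_continuous_on_def)

text \<open>The \<open>itself\<close> argument pins down the dimension, which the types of the other
  parameters do not mention.\<close>

locale nls_setting =
  fixes q \<eta> :: nat and lam :: complex and N :: "'n::finite itself"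
  assumes q: "real q > real CARD('n) / 2"
begin

text \<open>The factor -i lambda arises when the equation is solved for the time derivative. It acts
  as a constant multiplier because \<open>l2\<close> is only a real vector space.\<close>

definition nonlin :: "'n l2 \<Rightarrow> 'n l2" where
  "nonlin x = mult_l2 (\<lambda>_. - \<i> * lam) (power_l2 q \<eta> x)"

definition field :: "real \<Rightarrow> 'n l2 \<Rightarrow> 'n l2" where
  "field t x = flow (- t) (nonlin (flow t x))"

lemma bounded_linear_mult_const: "bounded_linear (mult_l2 (\<lambda>_. c))"
  by (rule bounded_linear_mult_l2[where B = "cmod c"]) auto

lemma locally_lipschitz_nonlin: "locally_lipschitz nonlin"
  unfolding nonlin_def[abs_def]
  by (rule locally_lipschitz_bounded_linear[OF bounded_linear_mult_const locally_lipschitz_power_l2[OF q]])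

lemma nonlin_0: "nonlin 0 = 0"
  unfolding nonlin_def power_l2_0[OF q] by (rule linear_0[OF bounded_linear.linear[OF bounded_linear_mult_const]])

lemma flow_zero: "flow t 0 = 0"
  by (rule linear_0[OF bounded_linear.linear[OF bounded_linear_flow]])

text \<open>The isometric flow maps balls to themselves and preserves distances, so the Lipschitz
  constants of \<open>nonlin\<close> serve at all times. Strong continuity is enough for continuity
  along curves.\<close>

sublocale lipschitz_ode field
proof
  show "continuous_on S (\<lambda>t. field t (z t))" if z: "continuous_on S z" for S and z :: "real \<Rightarrow> 'n l2"
  proof -
    have "continuous_on S (\<lambda>t. nonlin (flow t (z t)))"
      by (rule continuous_on_compose2[OF locally_lipschitz_continuous_on[OF locally_lipschitz_nonlin]
            continuous_on_flow[OF continuous_on_id z]]) auto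
    then show ?thesis
      unfolding field_def by (intro continuous_on_flow continuous_on_minus continuous_on_id)
  qed
  show "\<exists>L. \<forall>t x y. norm x \<le> R \<longrightarrow> norm y \<le> R \<longrightarrow> norm (field t x - field t y) \<le> L * norm (x - y)" for R
  proof -
    obtain L B where L: "\<And>x y. norm x \<le> R \<Longrightarrow> norm y \<le> R \<Longrightarrow> norm (nonlin x - nonlin y) \<le> L * norm (x - y)"
      using locally_lipschitzE[OF locally_lipschitz_nonlin] by metis
    have "norm (field t x - field t y) \<le> L * norm (x - y)" if "norm x \<le> R" "norm y \<le> R" for t x y
      using L[of "flow t x" "flow t y"] that
      by (simp add: field_def flow_diff[symmetric])
    then show ?thesis by blast
  qed
  show "field t 0 = 0" for t
    by (simp add: field_def flow_zero nonlin_0)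
qed

section \<open>Mild solutions in the interaction picture\<close>

definition profile :: "(real \<Rightarrow> real ^ 'n \<Rightarrow> complex) \<Rightarrow> real \<Rightarrow> 'n l2" where
  "profile \<psi> t = flow (- t) (bessel_l2 q (\<psi> t))"

lemma flow_profile: "flow t (profile \<psi> t) = bessel_l2 q (\<psi> t)"
  by (simp add: profile_def flow_flow)

text \<open>Complex linearity of the flow. Real linearity comes with the type, but the factor -i
  lambda has to pass through as well.\<close>

lemma flow_mult_const: "flow t (mult_l2 (\<lambda>_. c) x) = mult_l2 (\<lambda>_. c) (flow t x)"
proof -
  have "flow t (mult_l2 (\<lambda>_. c) x) = mult_l2 (\<lambda>\<xi>. phase t \<xi> * c) x"
    by (rule mult_l2_mult_l2[where B = 1 and B' = "cmod c"]) auto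
  also have "\<dots> = mult_l2 (\<lambda>\<xi>. c * phase t \<xi>) x" by (simp only: mult.commute)
  also have "\<dots> = mult_l2 (\<lambda>_. c) (flow t x)"
    by (rule mult_l2_mult_l2[where B = "cmod c" and B' = 1, symmetric]) auto
  finally show ?thesis .
qed

lemma field_profile:
  "flow (- t) (mult_l2 (\<lambda>_. - \<i> * lam) (flow (t - s) (power_l2 q \<eta> (bessel_l2 q (\<psi> s))))) = field s (profile \<psi> s)"
  unfolding field_def flow_profile nonlin_def by (simp add: flow_mult_const flow_flow)

lemma duhamel_integrand:
  fixes \<psi> :: "real \<Rightarrow> real ^ 'n \<Rightarrow> complex"
  assumes "\<psi> s \<in> sobolev q"
  shows "schroedinger_group (t - s) (\<lambda>x. complex_of_real (cmod (\<psi> s x) ^ (2 * \<eta>)) * \<psi> s x) \<in> sobolev q"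
    and "bessel_l2 q (schroedinger_group (t - s) (\<lambda>x. complex_of_real (cmod (\<psi> s x) ^ (2 * \<eta>)) * \<psi> s x)) =
      flow (t - s) (power_l2 q \<eta> (bessel_l2 q (\<psi> s)))"
  using sobolev_schroedinger_group[OF conjunct1[OF bessel_l2_power[OF q assms]]]
    conjunct2[OF bessel_l2_power[OF q assms]] by simp_all

lemma duhamel_rhs:
  assumes \<psi>0: "\<psi>0 \<in> sobolev q" and I: "I \<in> sobolev q"
  shows "(\<lambda>x. schroedinger_group t \<psi>0 x - \<i> * lam * I x) \<in> sobolev q"
    and "bessel_l2 q (\<lambda>x. schroedinger_group t \<psi>0 x - \<i> * lam * I x) =
      flow t (bessel_l2 q \<psi>0) + mult_l2 (\<lambda>_. - \<i> * lam) (bessel_l2 q I)"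
proof -
  have eq: "schroedinger_group t \<psi>0 x - \<i> * lam * I x = schroedinger_group t \<psi>0 x + (- \<i> * lam) * I x" for x
    by simp
  note s = sobolev_schroedinger_group[OF \<psi>0, of t] and c = sobolev_cmult[OF I, of "- \<i> * lam"]
  show "(\<lambda>x. schroedinger_group t \<psi>0 x - \<i> * lam * I x) \<in> sobolev q"
    unfolding eq by (rule sobolev_add(1)[OF s(1) c(1)])
  show "bessel_l2 q (\<lambda>x. schroedinger_group t \<psi>0 x - \<i> * lam * I x) =
      flow t (bessel_l2 q \<psi>0) + mult_l2 (\<lambda>_. - \<i> * lam) (bessel_l2 q I)"
    unfolding eq sobolev_add(2)[OF s(1) c(1)] s(2) c(2) ..
qed

text \<open>In the interaction picture the integrand no longer depends on the final time.\<close>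

lemma duhamel_imp_integral:
  assumes \<psi>0: "\<psi>0 \<in> sobolev q" and \<psi>: "\<And>s. s \<in> {0..t} \<Longrightarrow> \<psi> s \<in> sobolev q" and t: "t \<ge> 0"
    and d: "duhamel_at q \<eta> lam \<psi>0 \<psi> t"
  shows "((\<lambda>s. field s (profile \<psi> s)) has_integral (profile \<psi> t - bessel_l2 q \<psi>0)) {0..t}"
proof -
  let ?M = "mult_l2 (\<lambda>_. - \<i> * lam)"
  obtain I where I: "has_sobolev_integral q (\<lambda>\<nu>. schroedinger_group (t - \<nu>)
        (\<lambda>x. complex_of_real (cmod (\<psi> \<nu> x) ^ (2 * \<eta>)) * \<psi> \<nu> x)) I 0 t"
      and AE: "AE x in lborel. \<psi> t x = schroedinger_group t \<psi>0 x - \<i> * lam * I x"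
    using d unfolding duhamel_at_def by blast
  have sI: "I \<in> sobolev q" using I by (simp add: has_sobolev_integral_def)
  have "((\<lambda>s. bessel_l2 q (schroedinger_group (t - s)
        (\<lambda>x. complex_of_real (cmod (\<psi> s x) ^ (2 * \<eta>)) * \<psi> s x))) has_integral bessel_l2 q I) {0..t}"
    using I by (subst (asm) has_sobolev_integral_iff[OF duhamel_integrand(1)[OF \<psi>] sI])
  then have "((\<lambda>s. flow (t - s) (power_l2 q \<eta> (bessel_l2 q (\<psi> s)))) has_integral bessel_l2 q I) {0..t}"
    by (subst (asm) has_integral_cong[OF duhamel_integrand(2)[OF \<psi>]])
  from has_integral_linear[OF this bounded_linear_compose[OF bounded_linear_flow bounded_linear_mult_const, of "- t" "- \<i> * lam"]]
  have "((\<lambda>s. field s (profile \<psi> s)) has_integral flow (- t) (?M (bessel_l2 q I))) {0..t}"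
    unfolding o_def field_profile .
  moreover have "bessel_l2 q (\<psi> t) = flow t (bessel_l2 q \<psi>0) + ?M (bessel_l2 q I)"
    using sobolev_cong_AE(2)[OF duhamel_rhs(1)[OF \<psi>0 sI] sobolev_measurable[OF \<psi>] AE] t
    by (simp add: duhamel_rhs(2)[OF \<psi>0 sI])
  then have "?M (bessel_l2 q I) = bessel_l2 q (\<psi> t) - flow t (bessel_l2 q \<psi>0)" by simp
  then have "flow (- t) (?M (bessel_l2 q I)) = profile \<psi> t - bessel_l2 q \<psi>0"
    by (simp only: flow_diff flow_flow profile_def) simp
  ultimately show ?thesis by simp
qed

text \<open>The converse needs continuity of the profile, since now the existence of the Duhamel
  integral has to be established and not only used.\<close>

lemma duhamel_of_integral:
  assumes \<psi>0: "\<psi>0 \<in> sobolev q" and \<psi>: "\<And>s. s \<in> {0..t} \<Longrightarrow> \<psi> s \<in> sobolev q" and t: "t \<ge> 0"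
    and c: "continuous_on {0..t} (profile \<psi>)"
    and i: "((\<lambda>s. field s (profile \<psi> s)) has_integral (profile \<psi> t - bessel_l2 q \<psi>0)) {0..t}"
  shows "duhamel_at q \<eta> lam \<psi>0 \<psi> t"
proof -
  let ?M = "mult_l2 (\<lambda>_. - \<i> * lam)"
  \<comment> \<open>The integral is formed in \<open>l2\<close>, where continuous integrands are
    integrable, and \<open>sobolev_rep\<close> then provides the function that
    \<open>duhamel_at\<close> asks for.\<close>
  define y where "y = integral {0..t} (\<lambda>s. flow (t - s) (power_l2 q \<eta> (bessel_l2 q (\<psi> s))))"
  define I where "I = sobolev_rep q y"
  have sI: "I \<in> sobolev q" and JI: "bessel_l2 q I = y" unfolding I_def by (rule sobolev_rep)+
  have "continuous_on {0..t} (\<lambda>s. flow s (profile \<psi> s))"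
    by (intro continuous_on_flow continuous_on_id c)
  then have cw: "continuous_on {0..t} (\<lambda>s. bessel_l2 q (\<psi> s))" by (simp only: flow_profile)
  have "continuous_on {0..t} (\<lambda>s. power_l2 q \<eta> (bessel_l2 q (\<psi> s)))"
    by (rule continuous_on_compose2[OF locally_lipschitz_continuous_on[OF locally_lipschitz_power_l2[OF q]] cw]) auto
  then have "continuous_on {0..t} (\<lambda>s. flow (t - s) (power_l2 q \<eta> (bessel_l2 q (\<psi> s))))"
    by (intro continuous_on_flow continuous_on_diff continuous_on_const continuous_on_id)
  then have hi: "((\<lambda>s. flow (t - s) (power_l2 q \<eta> (bessel_l2 q (\<psi> s)))) has_integral y) {0..t}"
    unfolding y_def by (intro integrable_integral integrable_continuous_interval)
  have "((\<lambda>s. bessel_l2 q (schroedinger_group (t - s)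
        (\<lambda>x. complex_of_real (cmod (\<psi> s x) ^ (2 * \<eta>)) * \<psi> s x))) has_integral bessel_l2 q I) {0..t}"
    unfolding JI using hi by (subst has_integral_cong[OF duhamel_integrand(2)[OF \<psi>]])
  then have 1: "has_sobolev_integral q (\<lambda>s. schroedinger_group (t - s)
        (\<lambda>x. complex_of_real (cmod (\<psi> s x) ^ (2 * \<eta>)) * \<psi> s x)) I 0 t"
    by (subst has_sobolev_integral_iff[OF duhamel_integrand(1)[OF \<psi>] sI])
  from has_integral_linear[OF hi bounded_linear_compose[OF bounded_linear_flow bounded_linear_mult_const, of "- t" "- \<i> * lam"]]
  have "((\<lambda>s. field s (profile \<psi> s)) has_integral flow (- t) (?M y)) {0..t}"
    unfolding o_def field_profile .
  then have "profile \<psi> t - bessel_l2 q \<psi>0 = flow (- t) (?M y)" using i by (rule has_integral_unique[rotated])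
  then have "flow t (profile \<psi> t - bessel_l2 q \<psi>0) = ?M y" by (simp add: flow_flow)
  then have "bessel_l2 q (\<psi> t) = flow t (bessel_l2 q \<psi>0) + ?M (bessel_l2 q I)"
    unfolding flow_diff flow_profile JI by (simp add: algebra_simps)
  then have "bessel_l2 q (\<psi> t) = bessel_l2 q (\<lambda>x. schroedinger_group t \<psi>0 x - \<i> * lam * I x)"
    by (simp only: duhamel_rhs(2)[OF \<psi>0 sI])
  then have "AE x in lborel. \<psi> t x = schroedinger_group t \<psi>0 x - \<i> * lam * I x"
    using bessel_l2_eq_iff[OF \<psi> duhamel_rhs(1)[OF \<psi>0 sI]] t by simp
  then show ?thesis unfolding duhamel_at_def using 1 by blast
qed

lemma mild_solution_iff:
  assumes \<psi>0: "\<psi>0 \<in> sobolev q"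
  shows "mild_solution q \<eta> lam \<psi>0 T \<psi> \<longleftrightarrow> (\<forall>t\<in>{0..T}. \<psi> t \<in> sobolev q) \<and> sol 0 T (bessel_l2 q \<psi>0) (profile \<psi>)"
proof
  assume m: "mild_solution q \<eta> lam \<psi>0 T \<psi>"
  then have \<psi>: "\<forall>t\<in>{0..T}. \<psi> t \<in> sobolev q" and c: "continuous_on {0..T} (\<lambda>t. bessel_l2 q (\<psi> t))"
    and d: "\<forall>t\<in>{0..T}. duhamel_at q \<eta> lam \<psi>0 \<psi> t"
    by (auto simp: mild_solution_def sobolev_continuous_on_iff)
  have "continuous_on {0..T} (profile \<psi>)"
    unfolding profile_def[abs_def] by (intro continuous_on_flow continuous_on_minus continuous_on_id c)
  moreover have "((\<lambda>s. field s (profile \<psi> s)) has_integral (profile \<psi> t - bessel_l2 q \<psi>0)) {0..t}" if "t \<in> {0..T}" for t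
    using that \<psi> d by (intro duhamel_imp_integral \<psi>0) auto
  ultimately show "(\<forall>t\<in>{0..T}. \<psi> t \<in> sobolev q) \<and> sol 0 T (bessel_l2 q \<psi>0) (profile \<psi>)"
    using \<psi> by (simp add: sol_def)
next
  assume a: "(\<forall>t\<in>{0..T}. \<psi> t \<in> sobolev q) \<and> sol 0 T (bessel_l2 q \<psi>0) (profile \<psi>)"
  then have \<psi>: "\<forall>t\<in>{0..T}. \<psi> t \<in> sobolev q" and c: "continuous_on {0..T} (profile \<psi>)"
    and i: "\<forall>t\<in>{0..T}. ((\<lambda>s. field s (profile \<psi> s)) has_integral (profile \<psi> t - bessel_l2 q \<psi>0)) {0..t}"
    by (auto simp: sol_def)
  have "continuous_on {0..T} (\<lambda>s. flow s (profile \<psi> s))"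
    by (intro continuous_on_flow continuous_on_id c)
  then have "continuous_on {0..T} (\<lambda>s. bessel_l2 q (\<psi> s))" by (simp only: flow_profile)
  moreover have "duhamel_at q \<eta> lam \<psi>0 \<psi> t" if t: "t \<in> {0..T}" for t
  proof (rule duhamel_of_integral[OF \<psi>0])
    show "continuous_on {0..t} (profile \<psi>)" by (rule continuous_on_subset[OF c]) (use t in auto)
  qed (use t \<psi> i in auto)
  ultimately show "mild_solution q \<eta> lam \<psi>0 T \<psi>"
    using \<psi> by (simp add: mild_solution_def sobolev_continuous_on_iff)
qed

text \<open>A right inverse of \<open>profile\<close>. Its values lie in H^q at every real time,
  also where the curve \<open>z\<close> has no meaning as a solution, which spares side conditions
  later.\<close>

definition realize :: "(real \<Rightarrow> 'n l2) \<Rightarrow> real \<Rightarrow> real ^ 'n \<Rightarrow> complex" where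
  "realize z t = sobolev_rep q (flow t (z t))"

lemma realize_sobolev: "realize z t \<in> sobolev q"
  unfolding realize_def by (rule sobolev_rep)

lemma bessel_l2_realize: "bessel_l2 q (realize z t) = flow t (z t)"
  unfolding realize_def by (rule sobolev_rep)

lemma profile_realize: "profile (realize z) = z"
  by (simp add: fun_eq_iff profile_def bessel_l2_realize flow_flow)

lemma mild_solution_realize:
  "\<psi>0 \<in> sobolev q \<Longrightarrow> mild_solution q \<eta> lam \<psi>0 T (realize z) \<longleftrightarrow> sol 0 T (bessel_l2 q \<psi>0) z"
  by (simp add: mild_solution_iff realize_sobolev profile_realize)

lemma maximal_solution_iff:
  assumes \<psi>0: "\<psi>0 \<in> sobolev q"
  shows "maximal_solution q \<eta> lam \<psi>0 Tstar \<psi> \<longleftrightarrow>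
    (\<forall>t\<ge>0. ereal t < Tstar \<longrightarrow> \<psi> t \<in> sobolev q) \<and> max_sol (bessel_l2 q \<psi>0) Tstar (profile \<psi>)"
proof -
  \<comment> \<open>Nonexistence has to be carried across as well: every solution in
    \<open>l2\<close> is realized by functions, so a mild solution is missing exactly when a
    solution in \<open>l2\<close> is.\<close>
  have ex: "(\<exists>\<phi>. mild_solution q \<eta> lam \<psi>0 T \<phi>) \<longleftrightarrow> (\<exists>w. sol 0 T (bessel_l2 q \<psi>0) w)" for T
    using mild_solution_iff[OF \<psi>0] mild_solution_realize[OF \<psi>0] by blast
  have less: "ereal t < Tstar" if "t \<le> T" "ereal T < Tstar" for t T
    using that by (metis ereal_less_eq(3) le_less_trans)
  have "(\<forall>T\<ge>0. ereal T < Tstar \<longrightarrow> mild_solution q \<eta> lam \<psi>0 T \<psi>) \<longleftrightarrow>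
      (\<forall>t\<ge>0. ereal t < Tstar \<longrightarrow> \<psi> t \<in> sobolev q) \<and> (\<forall>T\<ge>0. ereal T < Tstar \<longrightarrow> sol 0 T (bessel_l2 q \<psi>0) (profile \<psi>))"
    unfolding mild_solution_iff[OF \<psi>0] using less by fastforce
  then show ?thesis unfolding maximal_solution_def max_sol_def ex by blast
qed

end

section \<open>The differential equation in H^{q-2}\<close>

lemma powi_diff_2:
  assumes "(a :: real) \<noteq> 0"
  shows "a powi (int q - 2) = a ^ q * (inverse a)\<^sup>2"
  using assms by (simp add: power_int_diff power_inverse divide_inverse)

text \<open>The multiplier of $(1 - \Delta)^{-1}$, which reduces the $H^{q-2}$ energy to an $L^2$ energy.\<close>

definition smoothing :: "real ^ 'n \<Rightarrow> complex" where
  "smoothing \<xi> = complex_of_real (inverse (1 + (norm \<xi>)\<^sup>2))"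

definition laplace_multiplier :: "real ^ 'n \<Rightarrow> complex" where
  "laplace_multiplier \<xi> = complex_of_real ((norm \<xi>)\<^sup>2 * inverse (1 + (norm \<xi>)\<^sup>2))"

lemma smoothing_measurable [measurable]: "smoothing \<in> borel_measurable borel"
  unfolding smoothing_def[abs_def] by measurable

lemma laplace_multiplier_measurable [measurable]: "laplace_multiplier \<in> borel_measurable borel"
  unfolding laplace_multiplier_def[abs_def] by measurable

lemma norm_smoothing_le: "cmod (smoothing \<xi>) \<le> 1"
proof -
  have "1 \<le> 1 + (norm \<xi>)\<^sup>2" by simp
  then have "inverse (1 + (norm \<xi>)\<^sup>2) \<le> 1" by (simp add: inverse_le_1_iff)
  then show ?thesis unfolding smoothing_def norm_of_real by (simp add: add_nonneg_nonneg)
qed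

lemma norm_laplace_multiplier_le: "cmod (laplace_multiplier \<xi>) \<le> 1"
proof -
  have p: "1 + (norm \<xi>)\<^sup>2 > 0" by (simp add: add_pos_nonneg)
  then have "(norm \<xi>)\<^sup>2 * inverse (1 + (norm \<xi>)\<^sup>2) \<le> 1" by (simp add: field_simps)
  then show ?thesis unfolding laplace_multiplier_def norm_of_real using p by simp
qed

lemma bessel_energy_diff_2:
  "bessel_energy (int q - 2) g = l2_energy (\<lambda>\<xi>. smoothing \<xi> * (complex_of_real (bessel_weight q \<xi>) * g \<xi>))"
proof -
  have "(1 + (norm \<xi>)\<^sup>2) powi (int q - 2) * (cmod (g \<xi>))\<^sup>2 =
      (cmod (smoothing \<xi> * (complex_of_real (bessel_weight q \<xi>) * g \<xi>)))\<^sup>2" for \<xi> :: "real ^ 'a"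
  proof -
    have p: "1 + (norm \<xi>)\<^sup>2 > 0" by (simp add: add_pos_nonneg)
    have "(1 + (norm \<xi>)\<^sup>2) powi (int q - 2) = (1 + (norm \<xi>)\<^sup>2) ^ q * (inverse (1 + (norm \<xi>)\<^sup>2))\<^sup>2"
      using p by (intro powi_diff_2) simp
    moreover have "cmod (smoothing \<xi>) = inverse (1 + (norm \<xi>)\<^sup>2)"
      unfolding smoothing_def norm_of_real using p by simp
    ultimately show ?thesis
      by (simp add: norm_mult power_mult_distrib bessel_weight_squared)
  qed
  then show ?thesis unfolding bessel_energy_def l2_energy_def by simp
qed

lemma norm_cis_minus_1_le: "cmod (cis r - 1) \<le> \<bar>r\<bar>"
  using iexp_approx1[of r 0] by (simp add: cis_conv_exp)

lemma vector_derivative_quotient_tendsto: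
  assumes "(f has_vector_derivative f') (at x)"
  shows "((\<lambda>h. (1 / h) *\<^sub>R (f (x + h) - f x)) \<longlongrightarrow> f') (at 0)"
proof (rule LIM_zero_cancel, rule tendsto_norm_zero_cancel)
  have "((\<lambda>h. norm (f (x + h) - f x - h *\<^sub>R f') / norm h) \<longlongrightarrow> 0) (at 0)"
    using assms by (simp add: has_vector_derivative_def has_derivative_at)
  moreover have "\<forall>\<^sub>F h in at 0. norm (f (x + h) - f x - h *\<^sub>R f') / norm h = norm ((1 / h) *\<^sub>R (f (x + h) - f x) - f')"
    unfolding eventually_at_filter
  proof (intro always_eventually allI impI)
    fix h :: real assume h: "h \<noteq> 0"
    then have "(1 / h) *\<^sub>R (f (x + h) - f x) - f' = (1 / h) *\<^sub>R (f (x + h) - f x - h *\<^sub>R f')"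
      by (simp add: scaleR_diff_right)
    then show "norm (f (x + h) - f x - h *\<^sub>R f') / norm h = norm ((1 / h) *\<^sub>R (f (x + h) - f x) - f')"
      by (simp only: norm_scaleR) simp
  qed
  ultimately show "((\<lambda>h. norm ((1 / h) *\<^sub>R (f (x + h) - f x) - f')) \<longlongrightarrow> 0) (at 0)"
    by (rule Lim_transform_eventually)
qed

lemma cis_difference_quotient: "((\<lambda>h. (cis (- (h * r)) - 1) / complex_of_real h) \<longlongrightarrow> - \<i> * complex_of_real r) (at 0)"
proof -
  have "((\<lambda>h. exp (h *\<^sub>R (- \<i> * complex_of_real r))) has_vector_derivative
      exp (0 *\<^sub>R (- \<i> * complex_of_real r)) * (- \<i> * complex_of_real r)) (at 0)"
    by (rule exp_scaleR_has_vector_derivative_right)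
  from vector_derivative_quotient_tendsto[OF this]
  have "((\<lambda>h. (1 / h) *\<^sub>R (exp ((0 + h) *\<^sub>R (- \<i> * complex_of_real r)) - exp (0 *\<^sub>R (- \<i> * complex_of_real r))))
      \<longlongrightarrow> exp (0 *\<^sub>R (- \<i> * complex_of_real r)) * (- \<i> * complex_of_real r)) (at 0)" .
  moreover have "(1 / h) *\<^sub>R (exp ((0 + h) *\<^sub>R (- \<i> * complex_of_real r)) - exp (0 *\<^sub>R (- \<i> * complex_of_real r))) =
      (cis (- (h * r)) - 1) / complex_of_real h" for h
    by (simp add: cis_conv_exp scaleR_conv_of_real mult_ac)
  ultimately show ?thesis by simp
qed

lemma mult_l2_diff:
  assumes "m \<in> borel_measurable borel" "\<And>\<xi>. cmod (m \<xi>) \<le> B" "m' \<in> borel_measurable borel" "\<And>\<xi>. cmod (m' \<xi>) \<le> B'"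
  shows "mult_l2 m x - mult_l2 m' x = mult_l2 (\<lambda>\<xi>. m \<xi> - m' \<xi>) x"
  unfolding mult_l2_def left_diff_distrib
  by (rule abs_l2_diff[symmetric]; rule square_integrable_mult_bounded[OF square_integrable_rep_l2]; fact)

text \<open>The generator is unbounded, but after smoothing the difference quotients have
  multipliers of modulus at most |\<xi>|^2 / (1 + |\<xi>|^2) <= 1, uniformly in the step, because
  |e^{ir} - 1| <= |r|. They converge pointwise, which is what strong convergence of multipliers
  needs.\<close>

lemma flow_generator:
  "((\<lambda>h. (1 / h) *\<^sub>R mult_l2 smoothing (flow h x - x)) \<longlongrightarrow> mult_l2 (\<lambda>\<xi>. - \<i> * laplace_multiplier \<xi>) x) (at 0)"
  unfolding tendsto_at_iff_sequentially
proof (intro allI impI)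
  fix X :: "nat \<Rightarrow> real" assume X0: "\<forall>i. X i \<in> UNIV - {0}" and X: "X \<longlonglongrightarrow> 0"
  define m where "m h \<xi> = complex_of_real (1 / h) * (smoothing \<xi> * (phase h \<xi> - 1))" for h and \<xi> :: "real ^ 'a"
  \<comment> \<open>This crude bound only legitimates the composition of multipliers at a fixed
    step; divided by \<open>h\<close> it would degenerate. The bound 1, uniform in the step, is
    proved further below.\<close>
  have p2: "cmod (phase h \<xi> - 1) \<le> 2" for h and \<xi> :: "real ^ 'a"
    using norm_triangle_ineq4[of "phase h \<xi>" 1] by simp
  have sp: "cmod (smoothing \<xi> * (phase h \<xi> - 1)) \<le> 2" for h and \<xi> :: "real ^ 'a"
    unfolding norm_mult using mult_mono[OF norm_smoothing_le[of \<xi>] p2[of h \<xi>]] by simp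
  have [measurable]: "(\<lambda>\<xi> :: real ^ 'a. smoothing \<xi> * (phase h \<xi> - 1)) \<in> borel_measurable borel" for h by measurable
  have eq: "(1 / h) *\<^sub>R mult_l2 smoothing (flow h x - x) = mult_l2 (m h) x" for h
  proof -
    have "flow h x - x = mult_l2 (phase h) x - mult_l2 (\<lambda>_. 1) x" by (simp add: mult_l2_1)
    also have "\<dots> = mult_l2 (\<lambda>\<xi>. phase h \<xi> - 1) x" by (rule mult_l2_diff[where B = 1 and B' = 1]) auto
    finally have "mult_l2 smoothing (flow h x - x) = mult_l2 smoothing (mult_l2 (\<lambda>\<xi>. phase h \<xi> - 1) x)" by simp
    also have "\<dots> = mult_l2 (\<lambda>\<xi>. smoothing \<xi> * (phase h \<xi> - 1)) x"
      by (rule mult_l2_mult_l2[where B = 1 and B' = 2]) (auto simp: norm_smoothing_le p2)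
    finally have "(1 / h) *\<^sub>R mult_l2 smoothing (flow h x - x) =
        mult_l2 (\<lambda>_. complex_of_real (1 / h)) (mult_l2 (\<lambda>\<xi>. smoothing \<xi> * (phase h \<xi> - 1)) x)"
      by (simp only: mult_l2_of_real)
    also have "\<dots> = mult_l2 (m h) x"
      unfolding m_def[abs_def]
      by (rule mult_l2_mult_l2[where B = "cmod (complex_of_real (1 / h))" and B' = 2]) (auto simp: sp)
    finally show ?thesis .
  qed
  have "(\<lambda>i. mult_l2 (m (X i)) x) \<longlonglongrightarrow> mult_l2 (\<lambda>\<xi>. - \<i> * laplace_multiplier \<xi>) x"
  proof (rule mult_l2_tendsto[where B = 1])
    show "m (X n) \<in> borel_measurable borel" for n unfolding m_def[abs_def] by measurable
    show "(\<lambda>\<xi> :: real ^ 'a. - \<i> * laplace_multiplier \<xi>) \<in> borel_measurable borel" by measurable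
    fix \<xi> :: "real ^ 'a"
    show "cmod (m (X n) \<xi>) \<le> 1" for n
    proof -
      have h: "X n \<noteq> 0" using X0 by simp
      have p: "1 + (norm \<xi>)\<^sup>2 > 0" by (simp add: add_pos_nonneg)
      have "cmod (phase (X n) \<xi> - 1) \<le> \<bar>X n\<bar> * (norm \<xi>)\<^sup>2"
        using norm_cis_minus_1_le[of "- (X n * (norm \<xi>)\<^sup>2)"] by (simp add: phase_def abs_mult)
      then have "cmod (m (X n) \<xi>) \<le> (1 / \<bar>X n\<bar>) * (inverse (1 + (norm \<xi>)\<^sup>2) * (\<bar>X n\<bar> * (norm \<xi>)\<^sup>2))"
        unfolding m_def norm_mult smoothing_def norm_of_real
        using p by (intro mult_mono) auto
      also have "\<dots> = (norm \<xi>)\<^sup>2 * inverse (1 + (norm \<xi>)\<^sup>2)" using h by simp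
      also have "\<dots> \<le> 1" using p by (simp add: field_simps)
      finally show ?thesis .
    qed
    have "filterlim X (at 0) sequentially" using X X0 by (intro filterlim_atI) auto
    then have "(\<lambda>n. (cis (- (X n * (norm \<xi>)\<^sup>2)) - 1) / complex_of_real (X n)) \<longlonglongrightarrow> - \<i> * complex_of_real ((norm \<xi>)\<^sup>2)"
      by (rule filterlim_compose[OF cis_difference_quotient])
    then have "(\<lambda>n. smoothing \<xi> * ((cis (- (X n * (norm \<xi>)\<^sup>2)) - 1) / complex_of_real (X n))) \<longlonglongrightarrow> smoothing \<xi> * (- \<i> * complex_of_real ((norm \<xi>)\<^sup>2))"
      by (rule tendsto_mult[OF tendsto_const])
    moreover have "smoothing \<xi> * ((cis (- (X n * (norm \<xi>)\<^sup>2)) - 1) / complex_of_real (X n)) = m (X n) \<xi>" for n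
      by (simp add: m_def phase_def)
    moreover have "smoothing \<xi> * (- \<i> * complex_of_real ((norm \<xi>)\<^sup>2)) = - \<i> * laplace_multiplier \<xi>"
      by (simp add: smoothing_def laplace_multiplier_def)
    ultimately show "(\<lambda>n. m (X n) \<xi>) \<longlonglongrightarrow> - \<i> * laplace_multiplier \<xi>" by (simp only:)
  qed
  then show "((\<lambda>h. (1 / h) *\<^sub>R mult_l2 smoothing (flow h x - x)) \<circ> X) \<longlonglongrightarrow> mult_l2 (\<lambda>\<xi>. - \<i> * laplace_multiplier \<xi>) x"
    unfolding o_def eq .
qed

lemma smoothing_bounded_linear: "bounded_linear (mult_l2 smoothing)"
  by (rule bounded_linear_mult_l2[where B = 1]) (auto simp: norm_smoothing_le)

context nls_setting
begin

text \<open>The curve \<open>z\<close> is differentiable in norm, being an integral of a continuous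
  function, but the flow acting on it is differentiable only after smoothing.\<close>

lemma sol_difference_quotient:
  assumes s: "sol 0 T x z" and t: "0 < t" "t < T"
  shows "((\<lambda>h. (1 / h) *\<^sub>R mult_l2 smoothing (flow (t + h) (z (t + h)) - flow t (z t))) \<longlongrightarrow>
    mult_l2 smoothing (nonlin (flow t (z t))) + mult_l2 (\<lambda>\<xi>. - \<i> * laplace_multiplier \<xi>) (flow t (z t))) (at 0)"
proof -
  have cz: "continuous_on {0..T} z" using s by (simp add: sol_def)
  have cf: "continuous_on {0..T} (\<lambda>s. field s (z s))" by (rule cont_comp[OF cz])
  have at: "at t within {0..T} = at t" using t by (rule at_within_Icc_at)
  have "((\<lambda>u. x + integral {0..u} (\<lambda>s. field s (z s))) has_vector_derivative 0 + field t (z t)) (at t within {0..T})"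
    using t by (intro has_vector_derivative_add has_vector_derivative_const integral_has_vector_derivative[OF cf]) auto
  moreover have "x + integral {0..u} (\<lambda>s. field s (z s)) = z u" if "u \<in> {0..T}" for u
    using integral_unique[OF sol_integral[OF s that]] by simp
  ultimately have "(z has_vector_derivative 0 + field t (z t)) (at t within {0..T})"
    using t by (intro has_vector_derivative_transform[where f = "\<lambda>u. x + integral {0..u} (\<lambda>s. field s (z s))" and g = z]) auto
  then have "(z has_vector_derivative field t (z t)) (at t)" by (simp add: at)
  then have dz: "((\<lambda>h. (1 / h) *\<^sub>R (z (t + h) - z t)) \<longlongrightarrow> field t (z t)) (at 0)"
    by (rule vector_derivative_quotient_tendsto)
  have th: "((\<lambda>h. t + h) \<longlongrightarrow> t) (at 0)"
    using tendsto_add[OF tendsto_const tendsto_ident_at, of t 0 UNIV] by simp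
  have "((\<lambda>h. flow (t + h) ((1 / h) *\<^sub>R (z (t + h) - z t))) \<longlongrightarrow> flow t (field t (z t))) (at 0)"
    by (rule tendsto_flow[OF th dz])
  then have 1: "((\<lambda>h. mult_l2 smoothing (flow (t + h) ((1 / h) *\<^sub>R (z (t + h) - z t)))) \<longlongrightarrow> mult_l2 smoothing (nonlin (flow t (z t)))) (at 0)"
    by (intro bounded_linear.tendsto[OF smoothing_bounded_linear]) (simp add: field_def flow_flow)
  have eq: "(1 / h) *\<^sub>R mult_l2 smoothing (flow (t + h) (z (t + h)) - flow t (z t)) =
      mult_l2 smoothing (flow (t + h) ((1 / h) *\<^sub>R (z (t + h) - z t))) +
      (1 / h) *\<^sub>R mult_l2 smoothing (flow h (flow t (z t)) - flow t (z t))" for h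
  proof -
    have "flow (t + h) (z (t + h)) - flow t (z t) = flow (t + h) (z (t + h) - z t) + (flow h (flow t (z t)) - flow t (z t))"
      by (simp add: flow_diff flow_flow add.commute)
    then show ?thesis
      by (simp only: linear_add[OF bounded_linear.linear[OF smoothing_bounded_linear]] scaleR_add_right
          linear_scale[OF bounded_linear.linear[OF smoothing_bounded_linear]] linear_scale[OF bounded_linear.linear[OF bounded_linear_flow]])
  qed
  show ?thesis unfolding eq by (rule tendsto_add[OF 1 flow_generator])
qed

lemma nls_equation:
  fixes \<psi> :: "real \<Rightarrow> real ^ 'n \<Rightarrow> complex"
  assumes \<psi>: "\<And>s. \<psi> s \<in> sobolev q" and s: "sol 0 T x (profile \<psi>)" and t: "0 < t" "t < T"
  shows "nls_equation_at q \<eta> lam \<psi> t"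
proof -
  define w where "w s = bessel_l2 q (\<psi> s)" for s
  define F where "F = (\<lambda>x. nls_nonlin lam \<eta> (\<psi> t x))"
  have F: "F \<in> sobolev q" "bessel_l2 q F = mult_l2 (\<lambda>_. lam) (power_l2 q \<eta> (w t))"
  proof -
    have eq: "F = (\<lambda>x. lam * (complex_of_real (cmod (\<psi> t x) ^ (2 * \<eta>)) * \<psi> t x))"
      by (simp add: F_def nls_nonlin_def mult.assoc)
    note b = bessel_l2_power[OF q \<psi>[of t], of \<eta>]
    show "F \<in> sobolev q" unfolding eq by (rule sobolev_cmult(1)[OF conjunct1[OF b]])
    show "bessel_l2 q F = mult_l2 (\<lambda>_. lam) (power_l2 q \<eta> (w t))"
      unfolding eq sobolev_cmult(2)[OF conjunct1[OF b]] conjunct2[OF b] w_def ..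
  qed
  \<comment> \<open>The residual of the equation, weighted and smoothed, as an element of
    \<open>l2\<close>. Its squared norm is the energy of order q - 2 that
    \<open>nls_equation_at\<close> sends to 0.\<close>
  define E where "E h = mult_l2 (\<lambda>_. \<i>) ((1 / h) *\<^sub>R mult_l2 smoothing (w (t + h) - w t)) - mult_l2 laplace_multiplier (w t) - mult_l2 smoothing (bessel_l2 q F)" for h
  have energy: "bessel_energy (int q - 2) (\<lambda>\<xi>. \<i> * ((fourier (\<psi> (t + h)) \<xi> - fourier (\<psi> t) \<xi>) / complex_of_real h)
                 - complex_of_real ((norm \<xi>)\<^sup>2) * fourier (\<psi> t) \<xi> - fourier F \<xi>) = ennreal ((norm (E h))\<^sup>2)" for h
  proof -
    define a where "a s \<xi> = complex_of_real (bessel_weight q \<xi>) * fourier (\<psi> s) \<xi>" for s \<xi>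
    define n where "n \<xi> = complex_of_real (bessel_weight q \<xi>) * fourier F \<xi>" for \<xi>
    have sa: "square_integrable (a s)" and wa: "w s = abs_l2 (a s)" for s
      unfolding a_def[abs_def] w_def bessel_l2_def by (rule sobolev_weighted[OF \<psi>], rule refl)
    have sn: "square_integrable n" and Fn: "bessel_l2 q F = abs_l2 n"
      unfolding n_def[abs_def] bessel_l2_def by (rule sobolev_weighted[OF F(1)], rule refl)
    have sd: "square_integrable (\<lambda>\<xi>. smoothing \<xi> * (a (t + h) \<xi> - a t \<xi>))"
      by (rule square_integrable_mult_bounded[OF square_integrable_diff[OF sa sa] smoothing_measurable norm_smoothing_le])
    have sl: "square_integrable (\<lambda>\<xi>. laplace_multiplier \<xi> * a t \<xi>)"
      by (rule square_integrable_mult_bounded[OF sa laplace_multiplier_measurable norm_laplace_multiplier_le])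
    have ss: "square_integrable (\<lambda>\<xi>. smoothing \<xi> * n \<xi>)"
      by (rule square_integrable_mult_bounded[OF sn smoothing_measurable norm_smoothing_le])
    let ?A = "\<lambda>\<xi>. \<i> * ((1 / h) *\<^sub>R (smoothing \<xi> * (a (t + h) \<xi> - a t \<xi>)))"
    have sA: "square_integrable ?A" by (intro square_integrable_cmult square_integrable_scaleR sd)
    have "mult_l2 (\<lambda>_. \<i>) ((1 / h) *\<^sub>R mult_l2 smoothing (w (t + h) - w t)) = abs_l2 ?A"
      unfolding wa abs_l2_diff[OF sa sa, symmetric] mult_l2_abs[OF smoothing_measurable norm_smoothing_le square_integrable_diff[OF sa sa]]
        abs_l2_scaleR[OF sd, symmetric]
      by (rule mult_l2_abs[where B = 1]) (auto intro: square_integrable_scaleR sd)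
    then have "E h = abs_l2 (\<lambda>\<xi>. ?A \<xi> - laplace_multiplier \<xi> * a t \<xi> - smoothing \<xi> * n \<xi>)"
      unfolding E_def wa Fn mult_l2_abs[OF laplace_multiplier_measurable norm_laplace_multiplier_le sa]
        mult_l2_abs[OF smoothing_measurable norm_smoothing_le sn]
      by (simp only: abs_l2_diff[OF square_integrable_diff[OF sA sl] ss] abs_l2_diff[OF sA sl])
    then have "ennreal ((norm (E h))\<^sup>2) = l2_energy (\<lambda>\<xi>. ?A \<xi> - laplace_multiplier \<xi> * a t \<xi> - smoothing \<xi> * n \<xi>)"
      by (simp only: norm_abs_l2_squared[OF square_integrable_diff[OF square_integrable_diff[OF sA sl] ss]])
    moreover have "smoothing \<xi> * (complex_of_real (bessel_weight q \<xi>) * (\<i> * ((fourier (\<psi> (t + h)) \<xi> - fourier (\<psi> t) \<xi>) / complex_of_real h)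
                 - complex_of_real ((norm \<xi>)\<^sup>2) * fourier (\<psi> t) \<xi> - fourier F \<xi>)) =
        ?A \<xi> - laplace_multiplier \<xi> * a t \<xi> - smoothing \<xi> * n \<xi>" for \<xi>
    proof -
      have l: "laplace_multiplier \<xi> = smoothing \<xi> * complex_of_real ((norm \<xi>)\<^sup>2)"
        by (simp add: laplace_multiplier_def smoothing_def)
      \<comment> \<open>At H = 0 both quotients are 0 by convention, so the identity holds for every
        step without a side condition.\<close>
      have alg: "S * (W * (\<i> * ((u - v) / H) - r * v - f)) = \<i> * ((1 / H) * (S * (W * u - W * v))) - (S * r) * (W * v) - S * (W * f)"
        for S W u v H r f :: complex
        by (cases "H = 0") (simp_all add: field_simps)
      show ?thesis
        unfolding l a_def n_def scaleR_conv_of_real of_real_divide of_real_1 by (rule alg)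
    qed
    ultimately show ?thesis unfolding bessel_energy_diff_2 by (simp only:)
  qed
  have wt: "w s = flow s (profile \<psi> s)" for s by (simp add: w_def flow_profile)
  have "((\<lambda>h. (1 / h) *\<^sub>R mult_l2 smoothing (w (t + h) - w t)) \<longlongrightarrow>
      mult_l2 smoothing (nonlin (w t)) + mult_l2 (\<lambda>\<xi>. - \<i> * laplace_multiplier \<xi>) (w t)) (at 0)"
    unfolding wt by (rule sol_difference_quotient[OF s t])
  from bounded_linear.tendsto[OF bounded_linear_mult_const[of \<i>] this]
  have "(E \<longlongrightarrow> mult_l2 (\<lambda>_. \<i>) (mult_l2 smoothing (nonlin (w t)) + mult_l2 (\<lambda>\<xi>. - \<i> * laplace_multiplier \<xi>) (w t))
      - mult_l2 laplace_multiplier (w t) - mult_l2 smoothing (bessel_l2 q F)) (at 0)"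
    unfolding E_def[abs_def] by (intro tendsto_diff tendsto_const)
  moreover have "mult_l2 (\<lambda>_. \<i>) (mult_l2 smoothing (nonlin (w t))) = mult_l2 smoothing (bessel_l2 q F)"
  proof -
    let ?p = "power_l2 q \<eta> (w t)"
    have m: "(\<lambda>\<xi> :: real ^ 'n. smoothing \<xi> * c) \<in> borel_measurable borel" "cmod (smoothing \<xi> * c) \<le> cmod c" for c and \<xi> :: "real ^ 'n"
      using mult_right_mono[OF norm_smoothing_le[of \<xi>] norm_ge_zero[of c]] by (auto simp: norm_mult)
    have c: "mult_l2 smoothing (mult_l2 (\<lambda>_. c) ?p) = mult_l2 (\<lambda>\<xi>. smoothing \<xi> * c) ?p" for c
      by (rule mult_l2_mult_l2[OF smoothing_measurable norm_smoothing_le, where B' = "cmod c"]) auto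
    have "mult_l2 (\<lambda>_. \<i>) (mult_l2 smoothing (nonlin (w t))) = mult_l2 (\<lambda>\<xi>. \<i> * (smoothing \<xi> * (- \<i> * lam))) ?p"
      unfolding nonlin_def c by (rule mult_l2_mult_l2[OF _ _ m, where B = 1]) auto
    also have "(\<lambda>\<xi> :: real ^ 'n. \<i> * (smoothing \<xi> * (- \<i> * lam))) = (\<lambda>\<xi>. smoothing \<xi> * lam)"
    proof
      fix \<xi> :: "real ^ 'n"
      have "\<i> * (smoothing \<xi> * (- \<i> * lam)) = (\<i> * - \<i>) * (smoothing \<xi> * lam)" by (simp only: mult_ac)
      then show "\<i> * (smoothing \<xi> * (- \<i> * lam)) = smoothing \<xi> * lam" by simp
    qed
    finally show ?thesis unfolding F(2) c .
  qed
  moreover have "mult_l2 (\<lambda>_. \<i>) (mult_l2 (\<lambda>\<xi>. - \<i> * laplace_multiplier \<xi>) (w t)) = mult_l2 laplace_multiplier (w t)"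
  proof -
    have "mult_l2 (\<lambda>_. \<i>) (mult_l2 (\<lambda>\<xi>. - \<i> * laplace_multiplier \<xi>) (w t)) = mult_l2 (\<lambda>\<xi>. \<i> * (- \<i> * laplace_multiplier \<xi>)) (w t)"
      by (rule mult_l2_mult_l2[where B = 1 and B' = 1]) (auto simp: norm_mult norm_laplace_multiplier_le)
    also have "(\<lambda>\<xi> :: real ^ 'n. \<i> * (- \<i> * laplace_multiplier \<xi>)) = laplace_multiplier" by (simp add: fun_eq_iff)
    finally show ?thesis .
  qed
  ultimately have "(E \<longlongrightarrow> 0) (at 0)"
    by (simp add: linear_add[OF bounded_linear.linear[OF bounded_linear_mult_const]])
  then have "((\<lambda>h. (norm (E h))\<^sup>2) \<longlongrightarrow> 0\<^sup>2) (at 0)"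
    by (intro tendsto_power tendsto_norm_zero)
  then have "((\<lambda>h. ennreal ((norm (E h))\<^sup>2)) \<longlongrightarrow> ennreal (0\<^sup>2)) (at 0)" by (rule tendsto_ennrealI)
  then show ?thesis unfolding nls_equation_at_def energy[unfolded F_def] by simp
qed

end

section \<open>Essentially bounded curves in H^q\<close>

lemma esssup_lebesgue_on_nonneg:
  fixes f :: "real \<Rightarrow> ereal"
  assumes T: "0 < T" and f: "\<And>t. 0 \<le> f t"
  shows "0 \<le> esssup (lebesgue_on {0<..<T}) f"
proof (rule ccontr)
  assume "\<not> 0 \<le> esssup (lebesgue_on {0<..<T}) f"
  then have "f t \<le> esssup (lebesgue_on {0<..<T}) f \<longleftrightarrow> False" for t
    using f[of t] by (auto simp: not_le intro: less_le_trans)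
  then have "AE t in lebesgue_on {0<..<T}. False" using esssup_AE[of f "lebesgue_on {0<..<T}"] by simp
  \<comment> \<open>If even a false statement holds almost everywhere, the whole interval is null;
    positivity of \<open>T\<close> excludes this.\<close>
  then have "emeasure (lebesgue_on {0<..<T}) (space (lebesgue_on {0<..<T})) = 0"
    unfolding ae_filter_eq_bot_iff[symmetric] trivial_limit_def .
  then show False using T by (simp add: emeasure_restrict_space)
qed

lemma Linf_sobolev_norm_nonneg: "0 < T \<Longrightarrow> 0 \<le> Linf_sobolev_norm q T \<psi>"
  unfolding Linf_sobolev_norm_def by (rule esssup_lebesgue_on_nonneg) (simp_all add: sobolev_norm_def)

text \<open>Continuity serves measurability, without which a pointwise bound would say nothing about
  the essential supremum.\<close>

lemma Linf_sobolev_norm_le: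
  assumes \<psi>: "\<And>t. t \<in> {0<..<T} \<Longrightarrow> \<psi> t \<in> sobolev q"
    and c: "continuous_on {0<..<T} (\<lambda>t. bessel_l2 q (\<psi> t))"
    and B: "\<And>t. t \<in> {0<..<T} \<Longrightarrow> norm (bessel_l2 q (\<psi> t)) \<le> B"
  shows "Linf_sobolev_norm q T \<psi> \<le> ereal B"
  unfolding Linf_sobolev_norm_def
proof (rule esssup_I)
  have "(\<lambda>t. norm (bessel_l2 q (\<psi> t))) \<in> borel_measurable (lebesgue_on {0<..<T})"
    by (intro continuous_imp_measurable_on_sets_lebesgue continuous_on_norm c) auto
  then have "(\<lambda>t. ereal (norm (bessel_l2 q (\<psi> t)))) \<in> borel_measurable (lebesgue_on {0<..<T})"
    by measurable
  then show "(\<lambda>t. ereal (sobolev_norm q (\<psi> t))) \<in> borel_measurable (lebesgue_on {0<..<T})"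
    by (subst measurable_cong[where g = "\<lambda>t. ereal (norm (bessel_l2 q (\<psi> t)))"]) (auto simp: sobolev_norm_eq \<psi>)
  show "AE t in lebesgue_on {0<..<T}. ereal (sobolev_norm q (\<psi> t)) \<le> ereal B"
    by (intro AE_I2) (auto simp: sobolev_norm_eq \<psi> intro: B)
qed

text \<open>A continuous curve is a pointwise limit of its values at the grid points to the left.\<close>

lemma Linf_sobolev_of_continuous:
  assumes \<psi>: "\<And>t. t \<in> {0..T} \<Longrightarrow> \<psi> t \<in> sobolev q"
    and c: "continuous_on {0..T} (\<lambda>t. bessel_l2 q (\<psi> t))"
  shows "\<psi> \<in> Linf_sobolev q T"
proof -
  \<comment> \<open>Rounding down, rather than to the nearest grid point, keeps the value between 0
    and \<open>t\<close>, hence in the interval where \<psi> is known to lie in H^q. On a bounded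
    interval only finitely many grid points occur, so the composition is simple.\<close>
  define \<rho> where "\<rho> n t = real_of_int \<lfloor>t * real (Suc n)\<rfloor> / real (Suc n)" for n and t :: real
  have \<rho>: "\<rho> n t \<le> t" "t - 1 / real (Suc n) \<le> \<rho> n t" for n t
  proof -
    have p: "real (Suc n) > 0" by simp
    have "real_of_int \<lfloor>t * real (Suc n)\<rfloor> \<le> t * real (Suc n)" by (rule of_int_floor_le)
    then show "\<rho> n t \<le> t" unfolding \<rho>_def by (simp only: pos_divide_le_eq[OF p])
    have "t * real (Suc n) - 1 \<le> real_of_int \<lfloor>t * real (Suc n)\<rfloor>" by linarith
    then have "(t * real (Suc n) - 1) / real (Suc n) \<le> \<rho> n t" unfolding \<rho>_def by (intro divide_right_mono) auto
    then show "t - 1 / real (Suc n) \<le> \<rho> n t" by (simp add: diff_divide_distrib)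
  qed
  have \<rho>0: "0 \<le> \<rho> n t" if "0 \<le> t" for n t using that by (simp add: \<rho>_def)
  have \<rho>T: "\<rho> n t \<in> {0..T}" if "t \<in> {0<..<T}" for n t
    using that \<rho>(1)[of n t] \<rho>0[of t n] by auto
  have \<rho>lim: "(\<lambda>n. \<rho> n t) \<longlonglongrightarrow> t" for t
  proof (rule tendsto_sandwich[OF _ _ _ tendsto_const])
    show "(\<lambda>n. t - 1 / real (Suc n)) \<longlonglongrightarrow> t"
      using tendsto_diff[OF tendsto_const LIMSEQ_inverse_real_of_nat, of t] by (simp add: inverse_eq_divide)
  qed (use \<rho> in auto)
  have simple: "simple_function (lebesgue_on {0<..<T}) (\<lambda>t. \<psi> (\<rho> n t))" for n
  proof (rule simple_function_compose1, rule simple_function_borel_measurable)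
    have "\<rho> n \<in> borel_measurable borel" unfolding \<rho>_def[abs_def] by measurable
    then have "\<rho> n \<in> borel_measurable lebesgue" by (simp add: measurable_completion)
    then show "\<rho> n \<in> borel_measurable (lebesgue_on {0<..<T})" by (rule measurable_restrict_space1)
    have "\<rho> n ` {0<..<T} \<subseteq> (\<lambda>k. real_of_int k / real (Suc n)) ` {0..\<lfloor>T * real (Suc n)\<rfloor>}"
    proof
      fix y assume "y \<in> \<rho> n ` {0<..<T}"
      then obtain t where t: "0 < t" "t < T" "y = \<rho> n t" by auto
      have "\<lfloor>t * real (Suc n)\<rfloor> \<in> {0..\<lfloor>T * real (Suc n)\<rfloor>}"
        using t by (auto intro!: floor_mono mult_right_mono)
      then show "y \<in> (\<lambda>k. real_of_int k / real (Suc n)) ` {0..\<lfloor>T * real (Suc n)\<rfloor>}"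
        unfolding t(3) \<rho>_def by blast
    qed
    then have "finite (\<rho> n ` {0<..<T})"
      by (rule finite_subset) (intro finite_imageI finite_atLeastAtMost_int)
    then show "finite (\<rho> n ` space (lebesgue_on {0<..<T}))" by simp
  qed
  have conv: "(\<lambda>n. sobolev_norm q (\<lambda>x. \<psi> (\<rho> n t) x - \<psi> t x)) \<longlonglongrightarrow> 0" if t: "t \<in> {0<..<T}" for t
  proof -
    have t': "t \<in> {0..T}" using t by auto
    have "(\<lambda>n. bessel_l2 q (\<psi> (\<rho> n t))) \<longlonglongrightarrow> bessel_l2 q (\<psi> t)"
      by (rule continuous_on_tendsto_compose[OF c \<rho>lim t']) (simp add: \<rho>T[OF t] del: atLeastAtMost_iff)
    then have "(\<lambda>n. norm (bessel_l2 q (\<psi> (\<rho> n t)) - bessel_l2 q (\<psi> t))) \<longlonglongrightarrow> 0"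
      by (simp only: tendsto_norm_zero_iff LIM_zero_iff)
    then show ?thesis by (simp only: sobolev_norm_diff_eq[OF \<psi>[OF \<rho>T[OF t]] \<psi>[OF t']])
  qed
  have "bounded ((\<lambda>t. bessel_l2 q (\<psi> t)) ` {0..T})"
    by (intro compact_imp_bounded compact_continuous_image c) simp
  then obtain B where "\<forall>y\<in>(\<lambda>t. bessel_l2 q (\<psi> t)) ` {0..T}. norm y \<le> B"
    unfolding bounded_iff by (elim exE)
  then have B: "norm (bessel_l2 q (\<psi> t)) \<le> B" if "t \<in> {0..T}" for t using that by blast
  have "Linf_sobolev_norm q T \<psi> \<le> ereal B"
    by (rule Linf_sobolev_norm_le) (use \<psi> B in \<open>auto intro: continuous_on_subset[OF c]\<close>)
  then have fin: "Linf_sobolev_norm q T \<psi> < \<infinity>" by (rule le_less_trans) simp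
  have "\<exists>\<sigma>. (\<forall>n. simple_function (lebesgue_on {0<..<T}) (\<sigma> n) \<and> (\<forall>t\<in>{0<..<T}. \<sigma> n t \<in> sobolev q)) \<and>
      (AE t in lebesgue_on {0<..<T}. (\<lambda>n. sobolev_norm q (\<lambda>x. \<sigma> n t x - \<psi> t x)) \<longlonglongrightarrow> 0)"
  proof (intro exI[of _ "\<lambda>n t. \<psi> (\<rho> n t)"] conjI allI ballI simple)
    show "\<psi> (\<rho> n t) \<in> sobolev q" if "t \<in> {0<..<T}" for n t by (rule \<psi>[OF \<rho>T[OF that]])
    show "AE t in lebesgue_on {0<..<T}. (\<lambda>n. sobolev_norm q (\<lambda>x. \<psi> (\<rho> n t) x - \<psi> t x)) \<longlonglongrightarrow> 0"
      by (intro AE_I2 conv) simp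
  qed
  then show ?thesis unfolding Linf_sobolev_def using fin \<psi> by auto
qed

context nls_setting
begin

lemma sol_bessel_continuous:
  assumes "sol 0 T x (profile \<psi>)"
  shows "continuous_on {0..T} (\<lambda>t. bessel_l2 q (\<psi> t))"
proof -
  have "continuous_on {0..T} (\<lambda>t. flow t (profile \<psi> t))"
    using assms by (intro continuous_on_flow continuous_on_id) (simp add: sol_def)
  then show ?thesis by (simp only: flow_profile)
qed

text \<open>Continuity comes for free: an indefinite gauge integral is continuous.\<close>

lemma Linf_solution_imp_sol:
  assumes \<psi>0: "\<psi>0 \<in> sobolev q" and T: "0 < T" and \<phi>: "Linf_solution q \<eta> lam \<psi>0 T \<phi>"
  shows "sol 0 T (bessel_l2 q \<psi>0) (profile \<phi>)"
proof -
  have s: "\<And>t. t \<in> {0..T} \<Longrightarrow> \<phi> t \<in> sobolev q" and d: "\<And>t. t \<in> {0..T} \<Longrightarrow> duhamel_at q \<eta> lam \<psi>0 \<phi> t"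
    using \<phi> by (auto simp: Linf_solution_def)
  have i: "((\<lambda>s. field s (profile \<phi> s)) has_integral (profile \<phi> t - bessel_l2 q \<psi>0)) {0..t}" if "t \<in> {0..T}" for t
    using that by (intro duhamel_imp_integral[OF \<psi>0] s d) auto
  have "(\<lambda>s. field s (profile \<phi> s)) integrable_on {0..T}" using i[of T] T by (auto simp: integrable_on_def)
  then have "continuous_on {0..T} (\<lambda>t. bessel_l2 q \<psi>0 + integral {0..t} (\<lambda>s. field s (profile \<phi> s)))"
    by (intro continuous_on_add continuous_on_const indefinite_integral_continuous_1)
  moreover have "profile \<phi> t = bessel_l2 q \<psi>0 + integral {0..t} (\<lambda>s. field s (profile \<phi> s))" if "t \<in> {0..T}" for t
    using integral_unique[OF i[OF that]] by simp
  ultimately have "continuous_on {0..T} (profile \<phi>)"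
    by (subst continuous_on_cong[OF refl])
  then show ?thesis using i by (simp add: sol_def)
qed

lemma profile_eq_imp_AE:
  assumes "\<phi> t \<in> sobolev q" "\<psi> t \<in> sobolev q" "profile \<phi> t = profile \<psi> t"
  shows "AE x in lborel. \<phi> t x = \<psi> t x"
proof -
  have "bessel_l2 q (\<phi> t) = bessel_l2 q (\<psi> t)" unfolding flow_profile[symmetric] assms(3) ..
  then show ?thesis by (simp only: bessel_l2_eq_iff[OF assms(1,2)])
qed

lemma norm_bessel_diff: "norm (bessel_l2 q (\<phi> t) - bessel_l2 q (\<psi> t)) = norm (profile \<phi> t - profile \<psi> t)"
  unfolding flow_profile[symmetric] flow_diff[symmetric] by simp

text \<open>The flow at time t is the same isometry for both solutions, so the distance of the
  profiles is the H^q distance at each time. A bound uniform in t then passes to the essential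
  supremum.\<close>

lemma continuous_dependence:
  fixes \<psi>0 :: "real ^ 'n \<Rightarrow> complex"
  assumes \<psi>0: "\<psi>0 \<in> sobolev q" and m: "maximal_solution q \<eta> lam \<psi>0 Tstar \<psi>"
    and \<psi>0s: "\<And>j. \<psi>0s j \<in> sobolev q"
    and conv: "(\<lambda>j. sobolev_norm q (\<lambda>x. \<psi>0s j x - \<psi>0 x)) \<longlonglongrightarrow> 0"
    and ms: "\<And>j. maximal_solution q \<eta> lam (\<psi>0s j) (Ts j) (\<psi>s j)"
    and T: "0 < T" "ereal T < Tstar"
  shows "\<forall>\<^sub>F j in sequentially. ereal T < Ts j"
    and "(\<lambda>j. Linf_sobolev_norm q T (\<lambda>t x. \<psi>s j t x - \<psi> t x)) \<longlonglongrightarrow> 0"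
proof -
  have less: "ereal t < S" if "t \<le> T" "ereal T < S" for t S
    using that by (metis ereal_less_eq(3) le_less_trans)
  have max: "max_sol (bessel_l2 q \<psi>0) Tstar (profile \<psi>)" and s: "\<And>t. t \<in> {0..T} \<Longrightarrow> \<psi> t \<in> sobolev q"
    using m[unfolded maximal_solution_iff[OF \<psi>0]] less[OF _ T(2)] by auto
  have maxs: "max_sol (bessel_l2 q (\<psi>0s j)) (Ts j) (profile (\<psi>s j))" for j
    using ms[of j, unfolded maximal_solution_iff[OF \<psi>0s]] by blast
  have c0: "(\<lambda>j. norm (bessel_l2 q (\<psi>0s j) - bessel_l2 q \<psi>0)) \<longlonglongrightarrow> 0"
    using conv by (simp only: sobolev_norm_diff_eq[OF \<psi>0s \<psi>0])
  then have lim: "(\<lambda>j. bessel_l2 q (\<psi>0s j)) \<longlonglongrightarrow> bessel_l2 q \<psi>0"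
    by (simp only: tendsto_norm_zero_iff LIM_zero_iff)
  obtain C where C: "C \<ge> 0" "\<forall>\<^sub>F j in sequentially. ereal T < Ts j \<and>
     (\<forall>t\<in>{0..T}. norm (profile (\<psi>s j) t - profile \<psi> t) \<le> C * norm (bessel_l2 q (\<psi>0s j) - bessel_l2 q \<psi>0))"
    by (rule max_sol_dependence[where xs = "\<lambda>j. bessel_l2 q (\<psi>0s j)" and zs = "\<lambda>j. profile (\<psi>s j)", OF max maxs lim T])
  show "\<forall>\<^sub>F j in sequentially. ereal T < Ts j" using C(2) by eventually_elim simp
  have bound: "\<forall>\<^sub>F j in sequentially. Linf_sobolev_norm q T (\<lambda>t x. \<psi>s j t x - \<psi> t x) \<le>
      ereal (C * norm (bessel_l2 q (\<psi>0s j) - bessel_l2 q \<psi>0))"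
    using C(2)
  proof eventually_elim
    case (elim j)
    have sj: "\<psi>s j t \<in> sobolev q" if "t \<in> {0..T}" for t
      using ms[of j, unfolded maximal_solution_iff[OF \<psi>0s]] less[OF _ conjunct1[OF elim]] that by auto
    have "sol 0 T (bessel_l2 q (\<psi>0s j)) (profile (\<psi>s j))" "sol 0 T (bessel_l2 q \<psi>0) (profile \<psi>)"
      using maxs[of j] max elim T by (auto simp: max_sol_def)
    then have cc: "continuous_on {0..T} (\<lambda>t. bessel_l2 q (\<psi>s j t) - bessel_l2 q (\<psi> t))"
      by (intro continuous_on_diff sol_bessel_continuous)
    have sub: "t \<in> {0..T}" if "t \<in> {0<..<T}" for t using that by auto
    have eq: "bessel_l2 q (\<lambda>x. \<psi>s j t x - \<psi> t x) = bessel_l2 q (\<psi>s j t) - bessel_l2 q (\<psi> t)" if "t \<in> {0<..<T}" for t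
      by (rule sobolev_diff(2)[OF sj[OF sub[OF that]] s[OF sub[OF that]]])
    show ?case
    proof (rule Linf_sobolev_norm_le)
      show "(\<lambda>x. \<psi>s j t x - \<psi> t x) \<in> sobolev q" if "t \<in> {0<..<T}" for t
        by (rule sobolev_diff(1)[OF sj[OF sub[OF that]] s[OF sub[OF that]]])
      show "continuous_on {0<..<T} (\<lambda>t. bessel_l2 q (\<lambda>x. \<psi>s j t x - \<psi> t x))"
        by (subst continuous_on_cong[OF refl eq]) (auto intro: continuous_on_subset[OF cc])
      show "norm (bessel_l2 q (\<lambda>x. \<psi>s j t x - \<psi> t x)) \<le> C * norm (bessel_l2 q (\<psi>0s j) - bessel_l2 q \<psi>0)" if "t \<in> {0<..<T}" for t
        unfolding eq[OF that] norm_bessel_diff using elim sub[OF that] by blast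
    qed
  qed
  have "(\<lambda>j. C * norm (bessel_l2 q (\<psi>0s j) - bessel_l2 q \<psi>0)) \<longlonglongrightarrow> C * 0"
    by (rule tendsto_mult[OF tendsto_const c0])
  then have up: "(\<lambda>j. ereal (C * norm (bessel_l2 q (\<psi>0s j) - bessel_l2 q \<psi>0))) \<longlonglongrightarrow> 0"
    by (simp add: zero_ereal_def)
  \<comment> \<open>Convergence in the extended reals needs a lower bound too; it is 0, the interval
    having positive length.\<close>
  show "(\<lambda>j. Linf_sobolev_norm q T (\<lambda>t x. \<psi>s j t x - \<psi> t x)) \<longlonglongrightarrow> 0"
    by (rule tendsto_sandwich[OF _ bound tendsto_const up]) (intro always_eventually allI Linf_sobolev_norm_nonneg T)
qed

end

theorem theorem1p2:
  fixes \<eta> q :: nat and lam :: complex and CL :: real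
    and \<psi>0 :: "real ^ 'n \<Rightarrow> complex"
  assumes eta: "\<eta> \<ge> 1"
    and q_dim: "real q > real CARD('n) / 2"
    and q_eta: "q \<ge> \<eta>"
    and H1: "\<forall>f g :: real.
      cmod (nls_nonlin lam \<eta> (complex_of_real f) - nls_nonlin lam \<eta> (complex_of_real g))
        \<le> CL * \<bar>f - g\<bar> * (\<bar>f\<bar> ^ (2 * \<eta>) + \<bar>g\<bar> ^ (2 * \<eta>))"
    and H2: "\<exists>\<sigma> :: nat. \<forall>f g :: real.
      cmod (nth_vector_derivative \<sigma> (\<lambda>x. nls_nonlin lam \<eta> (complex_of_real x)) f
            - nth_vector_derivative \<sigma> (\<lambda>x. nls_nonlin lam \<eta> (complex_of_real x)) g)
        \<le> CL * \<bar>f - g\<bar> * (\<bar>f\<bar> powi (2 * int \<eta> - int \<sigma>) + \<bar>g\<bar> powi (2 * int \<eta> - int \<sigma>))"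
    and psi0: "\<psi>0 \<in> sobolev q"
  shows "\<exists>(Tstar :: ereal) (\<psi> :: real \<Rightarrow> real ^ 'n \<Rightarrow> complex).
    \<comment> \<open>existence\<close>
    maximal_solution q \<eta> lam \<psi>0 Tstar \<psi> \<and>
    (\<forall>T>0. ereal T < Tstar \<longrightarrow> Linf_solution q \<eta> lam \<psi>0 T \<psi>) \<and>
    (\<forall>t>0. ereal t < Tstar \<longrightarrow> nls_equation_at q \<eta> lam \<psi> t) \<and>
    (AE x in lborel. \<psi> 0 x = \<psi>0 x) \<and>
    \<comment> \<open>uniqueness\<close>
    (\<forall>T>0. \<forall>\<phi>. Linf_solution q \<eta> lam \<psi>0 T \<phi> \<longrightarrow>
       ereal T < Tstar \<and> (\<forall>t\<in>{0..T}. AE x in lborel. \<phi> t x = \<psi> t x)) \<and>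
    (\<forall>Tstar' \<phi>. maximal_solution q \<eta> lam \<psi>0 Tstar' \<phi> \<longrightarrow>
       Tstar' = Tstar \<and> (\<forall>t\<ge>0. ereal t < Tstar \<longrightarrow> (AE x in lborel. \<phi> t x = \<psi> t x))) \<and>
    \<comment> \<open>blow-up alternative\<close>
    (\<forall>\<tau>. Tstar = ereal \<tau> \<longrightarrow>
       filterlim (\<lambda>t. sobolev_norm q (\<psi> t)) at_top (at_left \<tau>)) \<and>
    (Tstar = \<infinity> \<longrightarrow> (\<forall>T\<ge>0. mild_solution q \<eta> lam \<psi>0 T \<psi>)) \<and>
    \<comment> \<open>continuous dependence\<close>
    (\<forall>(\<psi>0s :: nat \<Rightarrow> real ^ 'n \<Rightarrow> complex) Ts \<psi>s.
       (\<forall>j. \<psi>0s j \<in> sobolev q) \<and>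
       (\<lambda>j. sobolev_norm q (\<lambda>x. \<psi>0s j x - \<psi>0 x)) \<longlonglongrightarrow> 0 \<and>
       (\<forall>j. maximal_solution q \<eta> lam (\<psi>0s j) (Ts j) (\<psi>s j)) \<longrightarrow>
       (\<forall>T>0. ereal T < Tstar \<longrightarrow>
          (\<forall>\<^sub>F j in sequentially. ereal T < Ts j) \<and>
          (\<lambda>j. Linf_sobolev_norm q T (\<lambda>t x. \<psi>s j t x - \<psi> t x)) \<longlonglongrightarrow> 0))"
proof -
  interpret nls_setting q \<eta> lam "TYPE('n)" by unfold_locales (rule q_dim)
  let ?x0 = "bessel_l2 q \<psi>0"
  obtain Tstar z where z: "max_sol ?x0 Tstar z" using max_sol_exists by blast
  define \<psi> where "\<psi> = realize z"
  have s: "\<psi> t \<in> sobolev q" for t unfolding \<psi>_def by (rule realize_sobolev)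
  have p: "profile \<psi> = z" unfolding \<psi>_def by (rule profile_realize)
  have m: "maximal_solution q \<eta> lam \<psi>0 Tstar \<psi>"
    unfolding maximal_solution_iff[OF psi0] p using s z by blast
  have sol: "sol 0 T ?x0 (profile \<psi>)" if "0 \<le> T" "ereal T < Tstar" for T
    using z that unfolding p max_sol_def by blast
  have below: "ereal t < Tstar" if "t \<le> T" "ereal T < Tstar" for t T
    using that by (metis ereal_less_eq(3) le_less_trans)
  \<comment> \<open>The difference quotient in the equation is two-sided, so \<open>t\<close> has to
    be interior to some interval of existence.\<close>
  have above: "\<exists>T>t. ereal T < Tstar" if "ereal t < Tstar" for t
    using ereal_dense2[OF that] by (metis ereal_less(2) less_ereal.simps(1))
  have mild: "mild_solution q \<eta> lam \<psi>0 T \<psi>" if "0 \<le> T" "ereal T < Tstar" for T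
    unfolding mild_solution_iff[OF psi0] using s sol[OF that] by blast
  have Linf: "Linf_solution q \<eta> lam \<psi>0 T \<psi>" if T: "T > 0" "ereal T < Tstar" for T
  proof -
    have "\<psi> \<in> Linf_sobolev q T"
      by (rule Linf_sobolev_of_continuous[OF s sol_bessel_continuous[OF sol]]) (use T in auto)
    then show ?thesis
      using mild[of T] s T by (simp add: Linf_solution_def mild_solution_def)
  qed
  have eqn: "nls_equation_at q \<eta> lam \<psi> t" if t: "t > 0" "ereal t < Tstar" for t
  proof -
    obtain T where T: "T > t" "ereal T < Tstar" using above[OF t(2)] by blast
    show ?thesis by (rule nls_equation[OF s sol[OF _ T(2)] t(1) T(1)]) (use t T in auto)
  qed
  have init: "AE x in lborel. \<psi> 0 x = \<psi>0 x"
  proof -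
    have "0 < Tstar" using z by (simp add: max_sol_def)
    \<comment> \<open>On the degenerate interval the integral vanishes and only the initial
      condition remains; at time 0 the flow is the identity.\<close>
    then have "sol 0 0 ?x0 (profile \<psi>)" by (intro sol) (auto simp: zero_ereal_def)
    then have "profile \<psi> 0 = ?x0" by (rule sol_start) simp
    then have "bessel_l2 q (\<psi> 0) = ?x0" using flow_profile[of 0 \<psi>] by simp
    then show ?thesis by (simp only: bessel_l2_eq_iff[OF s psi0])
  qed
  have uniq1: "ereal T < Tstar \<and> (\<forall>t\<in>{0..T}. AE x in lborel. \<phi> t x = \<psi> t x)"
    if T: "T > 0" and \<phi>: "Linf_solution q \<eta> lam \<psi>0 T \<phi>" for T \<phi>
  proof -
    have sphi: "sol 0 T ?x0 (profile \<phi>)" by (rule Linf_solution_imp_sol[OF psi0 T \<phi>])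
    \<comment> \<open>Maximality excludes every curve on the closed interval up to
      \<open>Tstar\<close>, not merely an extension of \<psi>, so a competing solution cannot reach
      that time.\<close>
    have less: "ereal T < Tstar" by (rule max_sol_less[OF z sphi])
    have "AE x in lborel. \<phi> t x = \<psi> t x" if t: "t \<in> {0..T}" for t
    proof (rule profile_eq_imp_AE)
      show "\<phi> t \<in> sobolev q" using \<phi> t by (simp add: Linf_solution_def)
      show "profile \<phi> t = profile \<psi> t" by (rule sol_unique[OF sphi sol[OF _ less] t]) (use T in simp)
    qed (rule s)
    then show ?thesis using less by blast
  qed
  have uniq2: "Tstar' = Tstar \<and> (\<forall>t\<ge>0. ereal t < Tstar \<longrightarrow> (AE x in lborel. \<phi> t x = \<psi> t x))"
    if \<phi>: "maximal_solution q \<eta> lam \<psi>0 Tstar' \<phi>" for Tstar' \<phi>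
  proof -
    have mphi: "max_sol ?x0 Tstar' (profile \<phi>)" and sphi: "\<And>t. 0 \<le> t \<Longrightarrow> ereal t < Tstar' \<Longrightarrow> \<phi> t \<in> sobolev q"
      using \<phi> unfolding maximal_solution_iff[OF psi0] by blast+
    have eq: "Tstar' = Tstar" by (rule max_sol_unique(1)[OF z mphi])
    have "AE x in lborel. \<phi> t x = \<psi> t x" if t: "0 \<le> t" "ereal t < Tstar" for t
      by (rule profile_eq_imp_AE[OF sphi s]) (use t eq max_sol_unique(2)[OF z mphi t] in \<open>simp_all add: p\<close>)
    then show ?thesis using eq by blast
  qed
  have blow: "filterlim (\<lambda>t. sobolev_norm q (\<psi> t)) at_top (at_left \<tau>)" if \<tau>: "Tstar = ereal \<tau>" for \<tau>
  proof -
    \<comment> \<open>The isometric flow lets the blow-up of the profile be read off as blow-up of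
      the H^q norm.\<close>
    have "sobolev_norm q (\<psi> t) = norm (z t)" for t
      unfolding sobolev_norm_eq[OF s] flow_profile[symmetric] p by simp
    then show ?thesis using max_sol_blowup[OF z[unfolded \<tau>]] by (simp only:)
  qed
  show ?thesis
  proof (intro exI[of _ Tstar] exI[of _ \<psi>] conjI)
    show "maximal_solution q \<eta> lam \<psi>0 Tstar \<psi>" by (rule m)
    show "\<forall>T>0. ereal T < Tstar \<longrightarrow> Linf_solution q \<eta> lam \<psi>0 T \<psi>" using Linf by blast
    show "\<forall>t>0. ereal t < Tstar \<longrightarrow> nls_equation_at q \<eta> lam \<psi> t" using eqn by blast
    show "AE x in lborel. \<psi> 0 x = \<psi>0 x" by (rule init)
    show "\<forall>T>0. \<forall>\<phi>. Linf_solution q \<eta> lam \<psi>0 T \<phi> \<longrightarrow>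
       ereal T < Tstar \<and> (\<forall>t\<in>{0..T}. AE x in lborel. \<phi> t x = \<psi> t x)" using uniq1 by blast
    show "\<forall>Tstar' \<phi>. maximal_solution q \<eta> lam \<psi>0 Tstar' \<phi> \<longrightarrow>
       Tstar' = Tstar \<and> (\<forall>t\<ge>0. ereal t < Tstar \<longrightarrow> (AE x in lborel. \<phi> t x = \<psi> t x))" using uniq2 by blast
    show "\<forall>\<tau>. Tstar = ereal \<tau> \<longrightarrow> filterlim (\<lambda>t. sobolev_norm q (\<psi> t)) at_top (at_left \<tau>)" using blow by blast
    show "Tstar = \<infinity> \<longrightarrow> (\<forall>T\<ge>0. mild_solution q \<eta> lam \<psi>0 T \<psi>)" using mild by simp
    show "\<forall>(\<psi>0s :: nat \<Rightarrow> real ^ 'n \<Rightarrow> complex) Ts \<psi>s.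
       (\<forall>j. \<psi>0s j \<in> sobolev q) \<and>
       (\<lambda>j. sobolev_norm q (\<lambda>x. \<psi>0s j x - \<psi>0 x)) \<longlonglongrightarrow> 0 \<and>
       (\<forall>j. maximal_solution q \<eta> lam (\<psi>0s j) (Ts j) (\<psi>s j)) \<longrightarrow>
       (\<forall>T>0. ereal T < Tstar \<longrightarrow>
          (\<forall>\<^sub>F j in sequentially. ereal T < Ts j) \<and>
          (\<lambda>j. Linf_sobolev_norm q T (\<lambda>t x. \<psi>s j t x - \<psi> t x)) \<longlonglongrightarrow> 0)"
    proof (intro allI impI conjI; elim conjE)
      fix \<psi>0s :: "nat \<Rightarrow> real ^ 'n \<Rightarrow> complex" and Ts \<psi>s T
      assume a: "\<forall>j. \<psi>0s j \<in> sobolev q" "(\<lambda>j. sobolev_norm q (\<lambda>x. \<psi>0s j x - \<psi>0 x)) \<longlonglongrightarrow> 0"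
        "\<forall>j. maximal_solution q \<eta> lam (\<psi>0s j) (Ts j) (\<psi>s j)" and T: "0 < T" "ereal T < Tstar"
      note dep = continuous_dependence[OF psi0 m spec[OF a(1)] a(2) spec[OF a(3)] T]
      show "\<forall>\<^sub>F j in sequentially. ereal T < Ts j" by (rule dep)
      show "(\<lambda>j. Linf_sobolev_norm q T (\<lambda>t x. \<psi>s j t x - \<psi> t x)) \<longlonglongrightarrow> 0" by (rule dep)
    qed
  qed
qed

end
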